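(* For each odd prime $p$ choose integers $N_p\ge s_p\ge 4$, put $s=s_p$, $N=N_p$, $l=s$, and let $\lambda=(\lambda_1,\dots,\lambda_s)=(p^{sN},p^{(s-1)N},\dots,p^{N})$. Let $\alpha\in M_s(\mathbf Z)$ be the skew-symmetric matrix $$\alpha=\begin{pmatrix}0&p^{s-2}&p^{s-3}&\cdots&p&1\\-p^{s-2}&0&p^{s-4}&\cdots&1&0\\-p^{s-3}&-p^{s-4}&0&\cdots&0&0\\\vdots&\vdots&\vdots&\ddots&\vdots&\vdots\\-p&-1&0&\cdots&0&0\\-1&0&0&\cdots&0&0\end{pmatrix},$$ i.e. $\alpha_{ii}=0$, and for $i<j$: $\alpha_{ij}=p^{s+1-i-j}$ if $i+j\le s+1$, $\alpha_{ij}=0$ if $i+j>s+1$, and $\alpha_{ji}=-\alpha_{ij}$. Let $L_p=L(\alpha)$ be the finite group defined in the context and $G_p=f(\mathbf Z^s/p^\lambda\mathbf Z^s)\subset L_p$. Let $\nabla_p$ be a symplectic self-duality of $L_p$ for which $G_p$ is a maximal isotropic subgroup. Let $L=\prod'_p(L_p,G_p)$ be the restricted product over all odd primes $p$ (sequences $(x_p)$ with $x_p\in L_p$ and $x_p\in G_p$ for all but finitely many $p$, topologized so that $\prod_p G_p$ is a compact open subgroup), and define $\nabla:L\to\hat L$ by $\nabla(x)(y)=\sum_p\nabla_p(x_p)(y_p)$. Then $\nabla$ is a symplectic self-duality of $L$, the pair $(L,\nabla)$ is not standard, and in fact $L$ is not isomorphic (as a topological group) to $A\times\hat A$ for any locally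 compact abelian group $A$.
   Context: All groups are locally compact abelian (LCA); $\mathbf T=\mathbf R/\mathbf Z$; the Pontryagin dual $\hat L$ is the group of continuous homomorphisms $L\to\mathbf T$ with the compact-open topology. A symplectic self-duality of $L$ is an isomorphism of topological groups $\nabla:L\to\hat L$ with $\nabla(x)(x)=0$ for all $x$. A subgroup $N$ is isotropic if $\nabla(x)(y)=0$ for all $x,y\in N$, and maximal isotropic if it is maximal among isotropic subgroups. For an LCA group $A$, the standard symplectic self-duality $\nabla^0$ of $A\times\hat A$ is $\nabla^0(x,\chi)(y,\lambda)=\chi(y)-\lambda(x)$; a pair $(L,\nabla)$ is standard if there is an isomorphism $\phi:A\times\hat A\to L$ for some LCA $A$ with $\nabla(\phi(u))(\phi(v))=\nabla^0(u)(v)$ for all $u,v$. Construction of $L(\alpha)$: for a prime $p$, a sequence $\lambda=(\lambda_1,\dots,\lambda_l)$ of positive integers and $\alpha\in M_l(\mathbf Z)$, let $p^\lambda:\mathbf Z^l\to\mathbf Z^l$ be $(x_i)\mapsto(p^{\lambda_i}x_i)$, $\mathbf Z/p^\lambda:=\mathbf Z^l/p^\lambda\mathbf Z^l$, and $a_\alpha:\mathbf Z^l\to\mathbf Z/p^\lambda$ the homomorphism sending the $i$-th standard basis vector to the class of $(\alpha_{i1},\dots,\alpha_{il})$. Set $L(\alpha)=(\mathbf Z/p^\lambda\oplus\mathbf Z^l)/\{(a_\alpha(x),-p^\lambda x):x\in\mathbf Z^l\}$ (a finite discrete group) and $f:\mathbf Z/p^\lambda\to L(\alpha)$, $c\mapsto[(c,0)]$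 (injective). *)

theory Defs
  imports "HOL-Analysis.Analysis" "HOL-Algebra.Algebra"
begin

text \<open>An LCA group is a commutative group (HOL-Algebra record) together with
  an abstract topology on its carrier making it a Hausdorff locally compact
  topological group.  The circle group T = R/Z is modelled by the unit circle
  in the complex numbers via t |-> exp(2 pi i t); so addition in T becomes
  multiplication and 0 in T becomes 1.\<close>

definition circle :: "complex set" where
  "circle = sphere 0 1"

definition LCA :: "('a, 'm) monoid_scheme \<Rightarrow> 'a topology \<Rightarrow> bool" where
  "LCA G T \<longleftrightarrow> comm_group G \<and> topspace T = carrier G
     \<and> continuous_map (prod_topology T T) T (\<lambda>(x, y). x \<otimes>\<^bsub>G\<^esub> y)
     \<and> continuous_map T T (\<lambda>x. inv\<^bsub>G\<^esub> x)
     \<and> Hausdorff_space T \<and> locally_compact_space T"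

definition characters :: "('a, 'm) monoid_scheme \<Rightarrow> 'a topology \<Rightarrow> ('a \<Rightarrow> complex) set" where
  "characters G T = {ch. ch \<in> extensional (carrier G)
      \<and> continuous_map T (top_of_set circle) ch
      \<and> (\<forall>x\<in>carrier G. \<forall>y\<in>carrier G. ch (x \<otimes>\<^bsub>G\<^esub> y) = ch x * ch y)}"

definition dual :: "('a, 'm) monoid_scheme \<Rightarrow> 'a topology \<Rightarrow> ('a \<Rightarrow> complex) monoid" where
  "dual G T = \<lparr> carrier = characters G T,
                mult = (\<lambda>ch ps. restrict (\<lambda>x. ch x * ps x) (carrier G)),
                one = restrict (\<lambda>x. 1) (carrier G) \<rparr>"

definition dual_top :: "('a, 'm) monoid_scheme \<Rightarrow> 'a topology \<Rightarrow> ('a \<Rightarrow> complex) topology" where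
  "dual_top G T = topology_generated_by
     {{ch \<in> characters G T. ch ` K \<subseteq> U} | K U. compactin T K \<and> open U}"

definition top_group_iso ::
  "('a, 'm) monoid_scheme \<Rightarrow> 'a topology \<Rightarrow> ('b, 'n) monoid_scheme \<Rightarrow> 'b topology \<Rightarrow> ('a \<Rightarrow> 'b) \<Rightarrow> bool" where
  "top_group_iso G TG H TH \<phi> \<longleftrightarrow> \<phi> \<in> iso G H \<and> homeomorphic_map TG TH \<phi>"

definition symplectic_self_duality ::
  "('a, 'm) monoid_scheme \<Rightarrow> 'a topology \<Rightarrow> ('a \<Rightarrow> 'a \<Rightarrow> complex) \<Rightarrow> bool" where
  "symplectic_self_duality G T nb \<longleftrightarrow>
     top_group_iso G T (dual G T) (dual_top G T) nb \<and> (\<forall>x\<in>carrier G. nb x x = 1)"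

definition isotropic :: "('a, 'm) monoid_scheme \<Rightarrow> ('a \<Rightarrow> 'a \<Rightarrow> complex) \<Rightarrow> 'a set \<Rightarrow> bool" where
  "isotropic G nb N \<longleftrightarrow> subgroup N G \<and> (\<forall>x\<in>N. \<forall>y\<in>N. nb x y = 1)"

definition max_isotropic :: "('a, 'm) monoid_scheme \<Rightarrow> ('a \<Rightarrow> 'a \<Rightarrow> complex) \<Rightarrow> 'a set \<Rightarrow> bool" where
  "max_isotropic G nb N \<longleftrightarrow> isotropic G nb N
     \<and> (\<forall>N'. isotropic G nb N' \<and> N \<subseteq> N' \<longrightarrow> N' = N)"

text \<open>Standard symplectic self-duality of A x dual(A):
  nabla0 (x, chi) (y, lambda) = chi(y) - lambda(x), written multiplicatively.\<close>

definition nabla0 :: "'a \<times> ('a \<Rightarrow> complex) \<Rightarrow> 'a \<times> ('a \<Rightarrow> complex) \<Rightarrow> complex" where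
  "nabla0 u v = snd u (fst v) / snd v (fst u)"

text \<open>(L, nabla) is standard via the LCA group (A, TA).  "Standard" means that such
  an A exists; since that is an existential over all LCA groups (of all types), its
  negation is stated in the main theorem with A ranging over a universally
  quantified type variable.\<close>

definition standard_via ::
  "('a, 'm) monoid_scheme \<Rightarrow> 'a topology \<Rightarrow> ('b, 'n) monoid_scheme \<Rightarrow> 'b topology
     \<Rightarrow> ('b \<Rightarrow> 'b \<Rightarrow> complex) \<Rightarrow> bool" where
  "standard_via A TA L TL nb \<longleftrightarrow> LCA A TA \<and>
     (\<exists>\<phi>. top_group_iso (A \<times>\<times> dual A TA) (prod_topology TA (dual_top A TA)) L TL \<phi>
        \<and> (\<forall>u\<in>carrier (A \<times>\<times> dual A TA). \<forall>v\<in>carrier (A \<times>\<times> dual A TA).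
              nb (\<phi> u) (\<phi> v) = nabla0 u v))"

definition vecs :: "nat \<Rightarrow> (nat \<Rightarrow> int) set" where
  "vecs l = {v. \<forall>i. i \<notin> {1..l} \<longrightarrow> v i = 0}"

definition Zl :: "nat \<Rightarrow> (nat \<Rightarrow> int) monoid" where
  "Zl l = \<lparr> carrier = vecs l, mult = (\<lambda>u v i. u i + v i), one = (\<lambda>i. 0) \<rparr>"

definition plam :: "nat \<Rightarrow> (nat \<Rightarrow> nat) \<Rightarrow> (nat \<Rightarrow> int) \<Rightarrow> (nat \<Rightarrow> int)" where
  "plam p lam x = (\<lambda>i. int p ^ lam i * x i)"

definition Zmodplam :: "nat \<Rightarrow> nat \<Rightarrow> (nat \<Rightarrow> nat) \<Rightarrow> (nat \<Rightarrow> int) set monoid" where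
  "Zmodplam p l lam = Zl l Mod (plam p lam ` vecs l)"

definition a_alpha :: "nat \<Rightarrow> nat \<Rightarrow> (nat \<Rightarrow> nat) \<Rightarrow> (nat \<Rightarrow> nat \<Rightarrow> int) \<Rightarrow> (nat \<Rightarrow> int) \<Rightarrow> (nat \<Rightarrow> int) set" where
  "a_alpha p l lam \<alpha> x = (plam p lam ` vecs l) #>\<^bsub>Zl l\<^esub>
       (\<lambda>j. if j \<in> {1..l} then (\<Sum>i=1..l. x i * \<alpha> i j) else 0)"

definition rel_alpha :: "nat \<Rightarrow> nat \<Rightarrow> (nat \<Rightarrow> nat) \<Rightarrow> (nat \<Rightarrow> nat \<Rightarrow> int) \<Rightarrow> ((nat \<Rightarrow> int) set \<times> (nat \<Rightarrow> int)) set" where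
  "rel_alpha p l lam \<alpha> = {(a_alpha p l lam \<alpha> x, \<lambda>i. - plam p lam x i) | x. x \<in> vecs l}"

definition L_alpha :: "nat \<Rightarrow> nat \<Rightarrow> (nat \<Rightarrow> nat) \<Rightarrow> (nat \<Rightarrow> nat \<Rightarrow> int)
     \<Rightarrow> ((nat \<Rightarrow> int) set \<times> (nat \<Rightarrow> int)) set monoid" where
  "L_alpha p l lam \<alpha> = (Zmodplam p l lam \<times>\<times> Zl l) Mod rel_alpha p l lam \<alpha>"

definition f_alpha :: "nat \<Rightarrow> nat \<Rightarrow> (nat \<Rightarrow> nat) \<Rightarrow> (nat \<Rightarrow> nat \<Rightarrow> int)
     \<Rightarrow> (nat \<Rightarrow> int) set \<Rightarrow> ((nat \<Rightarrow> int) set \<times> (nat \<Rightarrow> int)) set" where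
  "f_alpha p l lam \<alpha> c = rel_alpha p l lam \<alpha> #>\<^bsub>Zmodplam p l lam \<times>\<times> Zl l\<^esub> (c, \<one>\<^bsub>Zl l\<^esub>)"

definition odd_prime :: "nat \<Rightarrow> bool" where
  "odd_prime p \<longleftrightarrow> Factorial_Ring.prime p \<and> odd p"

definition lam_ex :: "nat \<Rightarrow> nat \<Rightarrow> nat \<Rightarrow> nat \<Rightarrow> nat" where
  "lam_ex p s N i = p ^ ((s + 1 - i) * N)"

definition alpha_ex :: "nat \<Rightarrow> nat \<Rightarrow> nat \<Rightarrow> nat \<Rightarrow> int" where
  "alpha_ex p s i j =
     (if i < j \<and> i + j \<le> s + 1 then int p ^ (s + 1 - i - j)
      else if j < i \<and> i + j \<le> s + 1 then - (int p ^ (s + 1 - i - j))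
      else 0)"

type_synonym Lelem = "((nat \<Rightarrow> int) set \<times> (nat \<Rightarrow> int)) set"

definition Lp :: "(nat \<Rightarrow> nat) \<Rightarrow> (nat \<Rightarrow> nat) \<Rightarrow> nat \<Rightarrow> Lelem monoid" where
  "Lp s N p = L_alpha p (s p) (lam_ex p (s p) (N p)) (alpha_ex p (s p))"

definition Gp :: "(nat \<Rightarrow> nat) \<Rightarrow> (nat \<Rightarrow> nat) \<Rightarrow> nat \<Rightarrow> Lelem set" where
  "Gp s N p = f_alpha p (s p) (lam_ex p (s p) (N p)) (alpha_ex p (s p))
                ` carrier (Zmodplam p (s p) (lam_ex p (s p) (N p)))"

definition resprod :: "(nat \<Rightarrow> Lelem monoid) \<Rightarrow> (nat \<Rightarrow> Lelem set) \<Rightarrow> (nat \<Rightarrow> Lelem) monoid" where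
  "resprod LL GG = \<lparr> carrier = {x. (\<forall>p. odd_prime p \<longrightarrow> x p \<in> carrier (LL p))
                          \<and> (\<forall>p. \<not> odd_prime p \<longrightarrow> x p = undefined)
                          \<and> finite {p. odd_prime p \<and> x p \<notin> GG p}},
       mult = (\<lambda>x y p. if odd_prime p then x p \<otimes>\<^bsub>LL p\<^esub> y p else undefined),
       one = (\<lambda>p. if odd_prime p then \<one>\<^bsub>LL p\<^esub> else undefined) \<rparr>"

text \<open>Restricted product topology (each L_p discrete): basis of sets prod_p U_p
  with U_p subset of L_p and U_p = G_p for all but finitely many p.\<close>

definition resprod_top :: "(nat \<Rightarrow> Lelem monoid) \<Rightarrow> (nat \<Rightarrow> Lelem set) \<Rightarrow> (nat \<Rightarrow> Lelem) topology" where
  "resprod_top LL GG = topology_generated_by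
     {{x \<in> carrier (resprod LL GG). \<forall>p. odd_prime p \<longrightarrow> x p \<in> U p} | U.
        (\<forall>p. odd_prime p \<longrightarrow> U p \<subseteq> carrier (LL p))
        \<and> finite {p. odd_prime p \<and> U p \<noteq> GG p}}"

text \<open>nabla(x)(y) = sum_p nabla_p(x_p)(y_p), a sum with finitely many nonzero terms;
  multiplicatively: the product of the terms different from 1.\<close>

definition resprod_nabla :: "(nat \<Rightarrow> Lelem monoid) \<Rightarrow> (nat \<Rightarrow> Lelem set)
     \<Rightarrow> (nat \<Rightarrow> Lelem \<Rightarrow> Lelem \<Rightarrow> complex) \<Rightarrow> (nat \<Rightarrow> Lelem) \<Rightarrow> (nat \<Rightarrow> Lelem) \<Rightarrow> complex" where
  "resprod_nabla LL GG nb x = restrict (\<lambda>y.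
      \<Prod>p \<in> {p. odd_prime p \<and> nb p (x p) (y p) \<noteq> 1}. nb p (x p) (y p))
     (carrier (resprod LL GG))"

end

theory Submission
  imports Defs
begin

text \<open>A character of \<open>L\<close> is trivial on an open subgroup because the circle has no small subgroups;
  since each \<open>G\<^sub>p\<close> is its own annihilator, such a character is given by a point of the restricted
  product.  This yields the self-duality.

  If \<open>L\<close> were isomorphic to the product of \<open>A\<close> and its dual, the two projections of \<open>L\<close> would preserve
  the \<open>p\<close>-primary part \<open>L\<^sub>p\<close> for every \<open>p\<close>, and by continuity also \<open>G\<^sub>p\<close> for all but finitely many \<open>p\<close>.
  For such a \<open>p\<close> let \<open>P\<close> be the matrix of one of the projections on \<open>G\<^sub>p\<close>.  Because the gaps between the
  \<open>\<lambda>\<^sub>i\<close> are at least \<open>s\<close>, \<open>P\<close> is triangular modulo \<open>p ^ s\<close>, and the spans of the first row and of the first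
  two rows of \<open>\<alpha>\<close>, which describe the multiples of \<open>p ^ \<lambda>\<^sub>1\<close> and \<open>p ^ \<lambda>\<^sub>2\<close> in \<open>G\<^sub>p\<close> modulo \<open>p ^ s G\<^sub>p\<close>,
  are invariant.  Comparing coefficients, all diagonal entries of \<open>P\<close> or of \<open>1 - P\<close> vanish modulo \<open>p\<close>, so
  one of the two projections is zero on \<open>G\<^sub>p\<close>.  The two factors of \<open>L\<^sub>p\<close> have the same order and the order
  of \<open>L\<^sub>p\<close> is at most the square of that of \<open>G\<^sub>p\<close>, hence \<open>G\<^sub>p\<close> is a direct factor of \<open>L\<^sub>p\<close>.  This is
  impossible, since the first row of \<open>\<alpha>\<close> is a multiple of \<open>p ^ \<lambda>\<^sub>1\<close> in \<open>L\<^sub>p\<close> but not in \<open>G\<^sub>p\<close>.\<close>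

section \<open>Characters and maximal isotropic subgroups\<close>

text \<open>A finite group with a symplectic self-duality is always isomorphic to some B times its
  dual, so no \<open>L_p\<close> by itself is an obstacle. The obstruction lies in the position of
  \<open>G_p\<close> inside \<open>L_p\<close>, and only the topology of the restricted product ties
  a splitting to \<open>G_p\<close>, at all but finitely many primes; one such prime is enough. The
  precision p^s is chosen because the nonzero entries of \<alpha> are, up to sign, p^0, ...,
  p^(s-2): they remain visible modulo p^s, while every p^\<open>lam i\<close> vanishes. The last
  entry 1 of the first row makes its eigenvalue readable modulo p^s. The bound s >= 4 makes the
  entry p^(s-4) in position (2,3) available; it is what links the eigenvalue on the second row to
  the diagonal entry \<open>P 3 3\<close>, and so brings the remaining entry \<open>P 1 1\<close>
  under control. A projection whose matrix is triangular with zero diagonal modulo \<open>p\<close>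
  is nilpotent modulo \<open>p\<close>, and idempotence lifts this to vanishing on all of
  \<open>G_p\<close>.\<close>

lemma circle_no_small_subgroups:
  assumes S: "S \<subseteq> circle" and sq: "\<And>z. z \<in> S \<Longrightarrow> z * z \<in> S"
    and small: "\<And>z. z \<in> S \<Longrightarrow> norm (z - 1) < 1"
  shows "S \<subseteq> {1}"
proof
  fix z assume "z \<in> S"
  have unit: "(Re w)\<^sup>2 + (Im w)\<^sup>2 = 1" if "w \<in> S" for w
    using S that by (auto simp: circle_def cmod_def)
  have near: "1 - Re w < 1 / 2" if "w \<in> S" for w
  proof -
    have "(Re (w - 1))\<^sup>2 + (Im (w - 1))\<^sup>2 < 1"
      using small[OF that] by (simp add: cmod_def)
    then show ?thesis using unit[OF that] by (simp add: power2_eq_square algebra_simps)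
  qed
  have ge: "0 \<le> 1 - Re w" if "w \<in> S" for w
    using S that complex_Re_le_cmod[of w] by (auto simp: circle_def)
  \<comment> \<open>With d = 1 - Re w, squaring \<open>w\<close> replaces d by 4 d - 2 d^2, which is
    at least 3 d while d <= 1/2. So repeated squaring drives any point other than 1 out of the
    disc.\<close>
  have grow: "3 * (1 - Re w) \<le> 1 - Re (w * w)" if "w \<in> S" for w
  proof -
    define d where "d = 1 - Re w"
    have "Re (w * w) = 2 * (Re w)\<^sup>2 - 1"
      using unit[OF that] by (simp add: power2_eq_square algebra_simps)
    then have "1 - Re (w * w) = 3 * d + d * (1 - 2 * d)"
      by (simp add: d_def power2_eq_square algebra_simps)
    moreover have "0 \<le> d * (1 - 2 * d)"
      using near[OF that] ge[OF that] unfolding d_def by (intro mult_nonneg_nonneg) auto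
    ultimately show ?thesis by (simp add: d_def)
  qed
  have pow: "\<exists>w\<in>S. 3 ^ n * (1 - Re z) \<le> 1 - Re w" for n
  proof (induction n)
    case 0 then show ?case using \<open>z \<in> S\<close> by auto
  next
    case (Suc n)
    then obtain w where w: "w \<in> S" "3 ^ n * (1 - Re z) \<le> 1 - Re w" by blast
    show ?case by (rule bexI[of _ "w * w"]) (use w grow[OF w(1)] sq in auto)
  qed
  have "Re z = 1"
  proof (rule ccontr)
    assume "Re z \<noteq> 1"
    then have pos: "0 < 1 - Re z" using ge[OF \<open>z \<in> S\<close>] by simp
    obtain n where "1 / (1 - Re z) < 3 ^ n" using real_arch_pow[of 3] by auto
    then have "1 < 3 ^ n * (1 - Re z)" using pos by (simp add: field_simps)
    then show False using pow[of n] near by fastforce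
  qed
  then show "z \<in> {1}" using unit[OF \<open>z \<in> S\<close>] by (simp add: complex_eq_iff)
qed

text \<open>Continuity of \<open>nabla x\<close> and of the characters of \<open>A\<close>
  constructed later comes from here: they depend locally on finitely many discrete
  coordinates.\<close>

lemma continuous_map_locally_constant:
  assumes "\<And>x. x \<in> topspace S \<Longrightarrow> f x \<in> topspace T"
    and "\<And>x. x \<in> topspace S \<Longrightarrow> \<exists>U. openin S U \<and> x \<in> U \<and> (\<forall>y\<in>U. f y = f x)"
  shows "continuous_map S T f"
  unfolding continuous_map_def
proof (intro conjI allI impI)
  show "f \<in> topspace S \<rightarrow> topspace T" using assms(1) by auto
  fix V assume "openin T V"
  show "openin S {x \<in> topspace S. f x \<in> V}"
  proof (subst openin_subopen, intro ballI)
    fix x assume x: "x \<in> {x \<in> topspace S. f x \<in> V}"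
    then have xS: "x \<in> topspace S" and fx: "f x \<in> V" by auto
    obtain U where U: "openin S U" "x \<in> U" "\<forall>y\<in>U. f y = f x" using assms(2)[OF xS] by blast
    have "U \<subseteq> {x \<in> topspace S. f x \<in> V}"
      using openin_subset[OF U(1)] U(3) fx by force
    then show "\<exists>W. openin S W \<and> x \<in> W \<and> W \<subseteq> {x \<in> topspace S. f x \<in> V}"
      using U by blast
  qed
qed

section \<open>Characters and the dual group\<close>

lemma charactersI:
  assumes "ch \<in> extensional (carrier G)" "continuous_map T (top_of_set circle) ch"
    "\<And>x y. x \<in> carrier G \<Longrightarrow> y \<in> carrier G \<Longrightarrow> ch (x \<otimes>\<^bsub>G\<^esub> y) = ch x * ch y"
  shows "ch \<in> characters G T"
  using assms by (simp add: characters_def)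

lemma character_ext: "ch \<in> characters G T \<Longrightarrow> ch \<in> extensional (carrier G)"
  by (simp add: characters_def)

lemma character_mult:
  "ch \<in> characters G T \<Longrightarrow> x \<in> carrier G \<Longrightarrow> y \<in> carrier G \<Longrightarrow> ch (x \<otimes>\<^bsub>G\<^esub> y) = ch x * ch y"
  by (simp add: characters_def)

lemma character_in_circle:
  "ch \<in> characters G T \<Longrightarrow> x \<in> topspace T \<Longrightarrow> ch x \<in> circle"
  by (auto simp: characters_def continuous_map_def)

lemma norm_character:
  "ch \<in> characters G T \<Longrightarrow> x \<in> topspace T \<Longrightarrow> norm (ch x) = 1"
  using character_in_circle[of ch G T x] by (auto simp: circle_def)

lemma character_nonzero:
  "ch \<in> characters G T \<Longrightarrow> x \<in> topspace T \<Longrightarrow> ch x \<noteq> 0"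
  using norm_character[of ch G T x] by auto

lemma character_one:
  fixes G (structure)
  assumes "group G" "topspace T = carrier G" "ch \<in> characters G T"
  shows "ch \<one>\<^bsub>G\<^esub> = 1"
proof -
  interpret group G by fact
  have "ch \<one> * ch \<one> = ch \<one>" using character_mult[OF assms(3), of \<one> \<one>] by simp
  then show ?thesis using character_nonzero[OF assms(3), of \<one>] assms(2) by simp
qed

lemma character_pow:
  fixes G (structure)
  assumes "group G" "topspace T = carrier G" "ch \<in> characters G T" "x \<in> carrier G"
  shows "ch (x [^]\<^bsub>G\<^esub> (n::nat)) = ch x ^ n"
proof -
  interpret group G by fact
  show ?thesis
    by (induction n) (auto simp: character_one[OF assms(1-3)] character_mult[OF assms(3)] assms(4))
qed

lemma character_inv:
  fixes G (structure)
  assumes "group G" "topspace T = carrier G" "ch \<in> characters G T" "x \<in> carrier G"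
  shows "ch (inv\<^bsub>G\<^esub> x) = 1 / ch x"
proof -
  interpret group G by fact
  have "ch (inv x) * ch x = 1"
    using character_mult[OF assms(3), of "inv x" x] assms(4) character_one[OF assms(1-3)] by simp
  then show ?thesis using character_nonzero[OF assms(3), of x] assms by (simp add: field_simps)
qed

lemma character_eqI:
  assumes "ch \<in> characters G T" "ch' \<in> characters G T" "\<And>x. x \<in> carrier G \<Longrightarrow> ch x = ch' x"
  shows "ch = ch'"
  using assms character_ext by (blast intro: extensionalityI)

lemma discrete_character_iff:
  "ch \<in> characters G (discrete_topology (carrier G)) \<longleftrightarrow>
     ch \<in> extensional (carrier G) \<and> (\<forall>x\<in>carrier G. norm (ch x) = 1) \<and>
     (\<forall>x\<in>carrier G. \<forall>y\<in>carrier G. ch (x \<otimes>\<^bsub>G\<^esub> y) = ch x * ch y)"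
  by (auto simp: characters_def circle_def)

lemma continuous_map_circle_iff:
  "continuous_map T (top_of_set circle) f \<longleftrightarrow>
     continuous_map T euclidean f \<and> (\<forall>x\<in>topspace T. norm (f x) = 1)"
  by (auto simp: continuous_map_in_subtopology circle_def)

lemma continuous_map_complex_mult:
  fixes f g :: "'a \<Rightarrow> complex"
  assumes "continuous_map T euclidean f" "continuous_map T euclidean g"
  shows "continuous_map T euclidean (\<lambda>x. f x * g x)"
proof -
  have pair: "continuous_map T euclidean (\<lambda>x. (f x, g x))"
    using assms continuous_map_pairedI[of T euclidean f euclidean g] by simp
  have "continuous_map euclidean euclidean (\<lambda>z::complex \<times> complex. fst z * snd z)"
    by (simp add: continuous_on_mult continuous_on_fst continuous_on_snd continuous_on_id)
  from continuous_map_compose[OF pair this] show ?thesis by (simp add: o_def)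
qed

lemma continuous_map_complex_inverse:
  fixes f :: "'a \<Rightarrow> complex"
  assumes "continuous_map T euclidean f" "\<And>x. x \<in> topspace T \<Longrightarrow> norm (f x) = 1"
  shows "continuous_map T euclidean (\<lambda>x. inverse (f x))"
proof -
  have c: "continuous_map T (top_of_set (- {0})) f"
    using assms by (force simp: continuous_map_in_subtopology)
  have "continuous_map (top_of_set (- {0})) euclidean (inverse :: complex \<Rightarrow> complex)"
    by (simp add: continuous_on_inverse continuous_on_id)
  from continuous_map_compose[OF c this] show ?thesis by (simp add: o_def)
qed

lemma topspace_dual_top [simp]: "topspace (dual_top G T) = characters G T"
proof -
  \<comment> \<open>The subbasic set with empty \<open>K\<close> already contains all
    characters.\<close>
  have "{ch \<in> characters G T. ch ` {} \<subseteq> UNIV} \<in>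
      {{ch \<in> characters G T. ch ` K \<subseteq> U} | K U. compactin T K \<and> open U}"
    using compactin_empty[of T] open_UNIV by blast
  then show ?thesis unfolding dual_top_def topology_generated_by_topspace by auto
qed

lemma openin_dual_top:
  assumes "compactin T K" "open U"
  shows "openin (dual_top G T) {ch \<in> characters G T. ch ` K \<subseteq> U}"
  unfolding dual_top_def by (rule topology_generated_by_Basis) (use assms in blast)

lemma dual_simps [simp]:
  "carrier (dual G T) = characters G T"
  "ch \<otimes>\<^bsub>dual G T\<^esub> ps = restrict (\<lambda>x. ch x * ps x) (carrier G)"
  "\<one>\<^bsub>dual G T\<^esub> = restrict (\<lambda>x. 1) (carrier G)"
  by (simp_all add: dual_def)

lemma comm_group_dual:
  fixes G (structure)
  assumes G: "group G" and T: "topspace T = carrier G"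
  shows "comm_group (dual G T)"
proof (rule comm_groupI)
  interpret group G by fact
  have cont: "continuous_map T (top_of_set circle) f"
    if "continuous_map T (top_of_set circle) g" "\<And>x. x \<in> carrier G \<Longrightarrow> f x = g x" for f g
    using that(1) by (rule continuous_map_eq) (simp add: that(2) T)
  have "continuous_map T (top_of_set circle) (restrict (\<lambda>x. 1) (carrier G))"
    by (rule cont[of "\<lambda>_. 1"]) (auto simp: circle_def)
  then show "\<one>\<^bsub>dual G T\<^esub> \<in> carrier (dual G T)"
    unfolding dual_simps
    by (rule charactersI[rotated]) auto
  fix x assume x: "x \<in> carrier (dual G T)"
  have cx: "continuous_map T euclidean x" "\<And>a. a \<in> topspace T \<Longrightarrow> norm (x a) = 1"
    using x unfolding dual_simps characters_def continuous_map_circle_iff by auto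
  show "\<one>\<^bsub>dual G T\<^esub> \<otimes>\<^bsub>dual G T\<^esub> x = x"
    using x character_ext[of x G T] by (auto simp: extensional_def)
  have "restrict (\<lambda>a. inverse (x a)) (carrier G) \<in> characters G T"
  proof (rule charactersI)
    show "continuous_map T (top_of_set circle) (restrict (\<lambda>a. inverse (x a)) (carrier G))"
      by (rule cont[of "\<lambda>a. inverse (x a)"])
        (auto simp: continuous_map_circle_iff cx norm_inverse intro: continuous_map_complex_inverse)
  qed (use x in \<open>auto simp: character_mult\<close>)
  moreover have "restrict (\<lambda>a. inverse (x a)) (carrier G) \<otimes>\<^bsub>dual G T\<^esub> x = \<one>\<^bsub>dual G T\<^esub>"
    using x T by (auto simp: character_nonzero fun_eq_iff restrict_def)
  ultimately show "\<exists>y\<in>carrier (dual G T). y \<otimes>\<^bsub>dual G T\<^esub> x = \<one>\<^bsub>dual G T\<^esub>"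
    by (intro bexI[of _ "restrict (\<lambda>a. inverse (x a)) (carrier G)"]) simp_all
  fix y assume y: "y \<in> carrier (dual G T)"
  have cy: "continuous_map T euclidean y" "\<And>a. a \<in> topspace T \<Longrightarrow> norm (y a) = 1"
    using y unfolding dual_simps characters_def continuous_map_circle_iff by auto
  show "x \<otimes>\<^bsub>dual G T\<^esub> y \<in> carrier (dual G T)"
    unfolding dual_simps
  proof (rule charactersI)
    show "continuous_map T (top_of_set circle) (restrict (\<lambda>a. x a * y a) (carrier G))"
      by (rule cont[of "\<lambda>a. x a * y a"])
        (auto simp: continuous_map_circle_iff cx cy norm_mult intro: continuous_map_complex_mult)
  qed (use x y in \<open>auto simp: character_mult\<close>)
  show "x \<otimes>\<^bsub>dual G T\<^esub> y = y \<otimes>\<^bsub>dual G T\<^esub> x" by (auto simp: mult.commute fun_eq_iff restrict_def)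
  fix z
  show "x \<otimes>\<^bsub>dual G T\<^esub> y \<otimes>\<^bsub>dual G T\<^esub> z = x \<otimes>\<^bsub>dual G T\<^esub> (y \<otimes>\<^bsub>dual G T\<^esub> z)"
    by (auto simp: mult.assoc fun_eq_iff restrict_def)
qed

lemma dual_pow:
  assumes "group G" "topspace T = carrier G" "ch \<in> characters G T"
  shows "ch [^]\<^bsub>dual G T\<^esub> (n::nat) = restrict (\<lambda>x. ch x ^ n) (carrier G)"
proof -
  interpret D: comm_group "dual G T" using assms(1,2) by (rule comm_group_dual)
  show ?thesis by (induction n) (auto simp: fun_eq_iff restrict_def)
qed

section \<open>Counting the characters of a finite group\<close>

lemma sum_nontrivial_character:
  fixes G (structure)
  assumes G: "group G" and \<theta>: "\<And>x y. x \<in> carrier G \<Longrightarrow> y \<in> carrier G \<Longrightarrow> \<theta> (x \<otimes>\<^bsub>G\<^esub> y) = \<theta> x * (\<theta> y :: complex)"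
    and a: "a \<in> carrier G" "\<theta> a \<noteq> 1"
  shows "sum \<theta> (carrier G) = 0"
proof -
  interpret group G by fact
  have "bij_betw (\<lambda>x. a \<otimes> x) (carrier G) (carrier G)"
    by (rule bij_betwI[of _ _ _ "\<lambda>x. inv a \<otimes> x"]) (use a in \<open>auto simp: m_assoc[symmetric]\<close>)
  then have "sum \<theta> (carrier G) = (\<Sum>x\<in>carrier G. \<theta> (a \<otimes> x))"
    by (rule sum.reindex_bij_betw[symmetric])
  also have "\<dots> = \<theta> a * sum \<theta> (carrier G)"
    by (simp add: \<theta> a sum_distrib_left)
  finally show ?thesis using a(2) by (simp add: field_simps)
qed

text \<open>Bessel's inequality for the point mass at the identity: the sum \<open>F\<close> of the characters in a
  finite set \<open>S\<close> satisfies \<open>F \<one> = card S\<close> and, by orthogonality,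
  \<open>(\<Sum>x. (norm (F x))\<^sup>2) = card S * card G\<close>.\<close>

lemma card_characters_le:
  fixes G :: "('a, 'm) monoid_scheme" (structure)
  assumes G: "group G" "finite (carrier G)"
  defines "D \<equiv> characters G (discrete_topology (carrier G))"
  shows "finite D" "card D \<le> card (carrier G)"
proof -
  interpret group G by fact
  let ?n = "card (carrier G)"
  have bound: "card S \<le> ?n" if S: "S \<subseteq> D" "finite S" for S
  proof -
    have SD: "ch \<in> characters G (discrete_topology (carrier G))" if "ch \<in> S" for ch
      using that S(1) by (auto simp: D_def)
    have nrm: "norm (ch x) = 1" if "ch \<in> S" "x \<in> carrier G" for ch x
      using norm_character[OF SD[OF that(1)]] that(2) by simp
    have mult: "ch (x \<otimes> y) = ch x * ch y" if "ch \<in> S" "x \<in> carrier G" "y \<in> carrier G" for ch x y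
      using character_mult[OF SD] that by blast
    have cc: "z * cnj z = 1" if "norm z = 1" for z :: complex
      using that by (simp add: complex_norm_square[symmetric])
    have orth: "(\<Sum>x\<in>carrier G. ch x * cnj (ps x)) = (if ch = ps then of_nat ?n else 0)"
      if cs: "ch \<in> S" "ps \<in> S" for ch ps
    proof (cases "ch = ps")
      case True then show ?thesis using nrm[OF cs(1)] by (simp add: cc)
    next
      case False
      then obtain a where a: "a \<in> carrier G" "ch a \<noteq> ps a"
        using character_eqI[OF SD SD, OF cs] by blast
      have "ch a * cnj (ps a) \<noteq> 1"
      proof
        assume "ch a * cnj (ps a) = 1"
        then have "ch a * (ps a * cnj (ps a)) = ps a" by (simp add: ac_simps)
        then show False using cc[OF nrm[OF cs(2) a(1)]] a by simp
      qed
      then have "(\<Sum>x\<in>carrier G. ch x * cnj (ps x)) = 0"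
        by (intro sum_nontrivial_character[OF G(1) _ a(1)]) (auto simp: mult cs)
      with False show ?thesis by simp
    qed
    define F where "F x = (\<Sum>ch\<in>S. ch x)" for x
    have one: "ch \<one> = 1" if "ch \<in> S" for ch
      using character_one[OF G(1) _ SD[OF that]] by simp
    have "(\<Sum>x\<in>carrier G. F x * cnj (F x)) = (\<Sum>x\<in>carrier G. \<Sum>ch\<in>S. \<Sum>ps\<in>S. ch x * cnj (ps x))"
      by (simp add: F_def sum_product cnj_sum)
    also have "\<dots> = (\<Sum>ch\<in>S. \<Sum>x\<in>carrier G. \<Sum>ps\<in>S. ch x * cnj (ps x))" by (rule sum.swap)
    also have "\<dots> = (\<Sum>ch\<in>S. \<Sum>ps\<in>S. \<Sum>x\<in>carrier G. ch x * cnj (ps x))"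
      by (intro sum.cong refl sum.swap)
    also have "\<dots> = (\<Sum>ch\<in>S. \<Sum>ps\<in>S. if ch = ps then of_nat ?n else 0)"
      by (intro sum.cong refl orth)
    also have "\<dots> = of_nat (card S * ?n)" using S by simp
    finally have "complex_of_real (\<Sum>x\<in>carrier G. (norm (F x))\<^sup>2) = complex_of_real (real (card S * ?n))"
      by (simp only: of_real_sum complex_norm_square of_real_of_nat_eq)
    then have tot: "(\<Sum>x\<in>carrier G. (norm (F x))\<^sup>2) = real (card S * ?n)" by (simp only: of_real_eq_iff)
    have "(norm (F \<one>))\<^sup>2 \<le> (\<Sum>x\<in>carrier G. (norm (F x))\<^sup>2)"
      by (rule member_le_sum) (use G in auto)
    moreover have "F \<one> = of_nat (card S)" by (simp add: F_def one)
    ultimately have "real (card S) * real (card S) \<le> real (card S) * real ?n"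
      using tot by (simp add: power2_eq_square)
    then show ?thesis by (cases "card S = 0") auto
  qed
  show "finite D" by (rule finite_if_finite_subsets_card_bdd[of D ?n, THEN conjunct1]) (use bound in auto)
  with bound show "card D \<le> ?n" by blast
qed


section \<open>Alternating pairings and annihilators of isotropic subgroups\<close>

lemma symplectic_self_dualityD:
  assumes "symplectic_self_duality G T nb"
  shows "bij_betw nb (carrier G) (characters G T)"
    and "x \<in> carrier G \<Longrightarrow> nb x \<in> characters G T"
    and "\<lbrakk>x \<in> carrier G; y \<in> carrier G; z \<in> carrier G\<rbrakk> \<Longrightarrow> nb (x \<otimes>\<^bsub>G\<^esub> y) z = nb x z * nb y z"
    and "x \<in> carrier G \<Longrightarrow> nb x x = 1"
  using assms unfolding symplectic_self_duality_def top_group_iso_def iso_def hom_def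
  by (auto simp: bij_betw_def)

lemma symplectic_alternating:
  fixes G (structure)
  assumes G: "group G" and nb: "symplectic_self_duality G T nb" "x \<in> carrier G" "y \<in> carrier G"
  shows "nb x y * nb y x = 1"
proof -
  interpret group G by fact
  note D = symplectic_self_dualityD[OF nb(1)]
  have m: "nb u (v \<otimes> w) = nb u v * nb u w" if "u \<in> carrier G" "v \<in> carrier G" "w \<in> carrier G" for u v w
    using character_mult[OF D(2)] that by blast
  have "1 = nb (x \<otimes> y) (x \<otimes> y)" using D(4) nb by simp
  also have "\<dots> = nb x (x \<otimes> y) * nb y (x \<otimes> y)" by (rule D(3)) (use nb in auto)
  also have "nb x (x \<otimes> y) = nb x x * nb x y" by (rule m) (use nb in auto)
  also have "nb y (x \<otimes> y) = nb y x * nb y y" by (rule m) (use nb in auto)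
  finally show ?thesis using D(4)[OF nb(2)] D(4)[OF nb(3)] by simp
qed

text \<open>Adjoining to \<open>H\<close> the cyclic group generated by \<open>x\<close> keeps it
  isotropic because the pairing is alternating, so maximality puts \<open>x\<close> into
  \<open>H\<close>. Together with isotropy this makes \<open>H\<close> its own annihilator.\<close>

lemma max_isotropic_perp:
  fixes G (structure)
  assumes G: "comm_group G" and T: "topspace T = carrier G"
    and nb: "symplectic_self_duality G T nb" and H: "max_isotropic G nb H"
    and x: "x \<in> carrier G" "\<And>h. h \<in> H \<Longrightarrow> nb x h = 1"
  shows "x \<in> H"
proof -
  interpret comm_group G by fact
  note D = symplectic_self_dualityD[OF nb]
  have iso: "subgroup H G" "\<And>g h. g \<in> H \<Longrightarrow> h \<in> H \<Longrightarrow> nb g h = 1"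
    using H unfolding max_isotropic_def isotropic_def by auto
  have sub: "H \<subseteq> carrier G" using iso(1) by (rule subgroup.subset)
  define K where "K = range (\<lambda>n::int. x [^] n)"
  have KE: "\<exists>n::int. a = x [^] n" if "a \<in> K" for a
    using that unfolding K_def image_def by blast
  have K: "subgroup K G"
  proof (rule subgroupI)
    fix a b assume "a \<in> K" "b \<in> K"
    then obtain m n where "a = x [^] (m::int)" "b = x [^] (n::int)" using KE by meson
    then have "a \<otimes> b = x [^] (m + n)" "inv a = x [^] (- m)"
      using x by (simp_all add: int_pow_mult int_pow_neg)
    then show "a \<otimes> b \<in> K" "inv a \<in> K" by (simp_all only: K_def range_eqI)
  qed (use int_pow_closed[OF x(1)] in \<open>unfold K_def, blast+\<close>)
  have m: "nb u (v \<otimes> w) = nb u v * nb u w" if "u \<in> carrier G" "v \<in> carrier G" "w \<in> carrier G" for u v w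
    using character_mult[OF D(2)] that by blast
  have right: "nb u (v [^] (n::int)) = 1" if "u \<in> carrier G" "v \<in> carrier G" "nb u v = 1" for u v n
  proof -
    have p: "nb u (v [^] (k::nat)) = 1" for k
      using that character_pow[OF is_group T D(2)] by simp
    have q: "nb u (v [^] int k) = 1" for k
      using p[of k] by (simp only: int_pow_int)
    show ?thesis
    proof (cases n)
      case (nonneg k) then show ?thesis using q by simp
    next
      case (neg k)
      have "nb u (inv (v [^] int (Suc k))) = 1 / nb u (v [^] int (Suc k))"
        by (rule character_inv[OF is_group T D(2)[OF that(1)]]) (rule int_pow_closed[OF that(2)])
      then show ?thesis unfolding neg int_pow_neg[OF that(2)] by (simp only: q) simp
    qed
  qed
  have flip: "nb v u = 1" if "u \<in> carrier G" "v \<in> carrier G" "nb u v = 1" for u v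
    using symplectic_alternating[OF is_group nb that(1,2)] that(3) by simp
  have KH: "nb a h = 1" "nb h a = 1" if aK: "a \<in> K" "h \<in> H" for a h
  proof -
    obtain n :: int where n: "a = x [^] n" using KE[OF aK(1)] by blast
    have h: "h \<in> carrier G" using aK(2) sub by blast
    have a: "a \<in> carrier G" unfolding n by (rule int_pow_closed[OF x(1)])
    show "nb h a = 1" unfolding n by (rule right[OF h x(1)], rule flip[OF x(1) h], rule x(2)[OF aK(2)])
    then show "nb a h = 1" by (rule flip[OF h a])
  qed
  have KK: "nb a b = 1" if ab: "a \<in> K" "b \<in> K" for a b
  proof -
    obtain n :: int where n: "a = x [^] n" using KE[OF ab(1)] by blast
    obtain k :: int where k: "b = x [^] k" using KE[OF ab(2)] by blast
    have a: "a \<in> carrier G" unfolding n by (rule int_pow_closed[OF x(1)])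
    have "nb x a = 1" unfolding n by (rule right[OF x(1) x(1)], rule D(4)[OF x(1)])
    then show ?thesis unfolding k by (intro right[OF a x(1)] flip[OF x(1) a])
  qed
  have "isotropic G nb (H <#> K)"
    unfolding isotropic_def
  proof (intro conjI ballI mult_subgroups iso(1) K)
    fix u v assume "u \<in> H <#> K" "v \<in> H <#> K"
    then obtain g a h b where "g \<in> H" "a \<in> K" "h \<in> H" "b \<in> K" "u = g \<otimes> a" "v = h \<otimes> b"
      unfolding set_mult_def by blast
    moreover have "K \<subseteq> carrier G" using K by (rule subgroup.subset)
    ultimately show "nb u v = 1"
      using sub iso(2) KH KK by (auto simp: m D(3) subset_iff)
  qed
  moreover have "H \<subseteq> H <#> K"
    using subgroup.one_closed[OF K] sub by (force simp: set_mult_def)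
  ultimately have "H <#> K = H" using H unfolding max_isotropic_def by blast
  moreover have "x = x [^] (1::int)" by (rule int_pow_1[OF x(1), symmetric])
  then have "x \<in> K" unfolding K_def by (rule range_eqI)
  then have "\<one> \<otimes> x \<in> H <#> K"
    using subgroup.one_closed[OF iso(1)] unfolding set_mult_def by blast
  then have "x \<in> H <#> K" using x(1) by simp
  ultimately show ?thesis by simp
qed

lemma card_le_fibres:
  assumes "finite S" "\<And>x. x \<in> S \<Longrightarrow> card {y \<in> S. f y = f x} \<le> n"
  shows "card S \<le> card (f ` S) * n"
proof -
  have "card S = (\<Sum>b\<in>f ` S. card {y \<in> S. f y = b})"
    using sum.image_gen[OF assms(1), of "\<lambda>_. 1::nat" f] by simp
  also have "\<dots> \<le> (\<Sum>b\<in>f ` S. n)" by (rule sum_mono) (use assms(2) in auto)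
  finally show ?thesis by simp
qed

text \<open>Restricting \<open>nb x\<close> to \<open>H\<close> maps the group into the characters
  of \<open>H\<close>, of which there are at most \<open>card H\<close>; each fibre lies in a
  translate of the annihilator of \<open>H\<close>, that is, of \<open>H\<close> itself.\<close>

lemma card_le_max_isotropic:
  fixes G (structure)
  assumes G: "comm_group G" "finite (carrier G)"
    and nb: "symplectic_self_duality G (discrete_topology (carrier G)) nb" and H: "max_isotropic G nb H"
  shows "card (carrier G) \<le> card H * card H"
proof -
  interpret comm_group G by fact
  note D = symplectic_self_dualityD[OF nb]
  have H': "subgroup H G" using H unfolding max_isotropic_def isotropic_def by auto
  have sub: "H \<subseteq> carrier G" using H' by (rule subgroup.subset)
  let ?H = "G\<lparr>carrier := H\<rparr>"
  let ?f = "\<lambda>x. restrict (nb x) H"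
  interpret H: group ?H using H' by (rule subgroup.subgroup_is_group) (rule is_group)
  have finH: "finite H" using sub G(2) by (rule finite_subset)
  have img: "?f ` carrier G \<subseteq> characters ?H (discrete_topology (carrier ?H))"
  proof (rule image_subsetI)
    fix x assume x: "x \<in> carrier G"
    show "?f x \<in> characters ?H (discrete_topology (carrier ?H))"
      using D(2)[OF x] subsetD[OF sub] subgroup.m_closed[OF H'] unfolding discrete_character_iff by simp
  qed
  have ch: "finite (characters ?H (discrete_topology (carrier ?H)))"
    "card (characters ?H (discrete_topology (carrier ?H))) \<le> card H"
    using card_characters_le[OF H.is_group] finH by simp_all
  have "card (carrier G) \<le> card (?f ` carrier G) * card H"
  proof (rule card_le_fibres[OF G(2)])
    fix x assume x: "x \<in> carrier G"
    have "{y \<in> carrier G. ?f y = ?f x} \<subseteq> (\<lambda>h. h \<otimes> x) ` H"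
    proof
      fix y assume y: "y \<in> {y \<in> carrier G. ?f y = ?f x}"
      have "nb (y \<otimes> inv x) h = 1" if h: "h \<in> H" for h
      proof -
        have hc: "h \<in> carrier G" using h sub by auto
        have "nb y h = nb x h" using y h by (auto dest: fun_cong[of _ _ h])
        moreover have "nb x h * nb (inv x) h = 1"
          using D(3)[of x "inv x" h] x hc character_one[OF is_group _ D(2)]
            D(3)[of \<one> \<one> h] character_nonzero[OF D(2)[of \<one>], of h] by simp
        ultimately show ?thesis using D(3)[of y "inv x" h] x y hc by simp
      qed
      then have "y \<otimes> inv x \<in> H"
        using max_isotropic_perp[OF G(1) _ nb H, of "y \<otimes> inv x"] x y by simp
      moreover have "y = y \<otimes> inv x \<otimes> x" using x y by (simp add: m_assoc)
      ultimately show "y \<in> (\<lambda>h. h \<otimes> x) ` H" by blast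
    qed
    then show "card {y \<in> carrier G. ?f y = ?f x} \<le> card H"
      using finH by (meson card_image_le card_mono finite_imageI order_trans)
  qed
  also have "\<dots> \<le> card H * card H"
    using card_mono[OF ch(1) img] ch(2) by (intro mult_right_mono) auto
  finally show ?thesis .
qed

section \<open>The group \<open>L(\<alpha>)\<close> in coordinates\<close>

lemma Zl_simps [simp]:
  "carrier (Zl l) = vecs l" "u \<otimes>\<^bsub>Zl l\<^esub> v = (\<lambda>i. u i + v i)" "\<one>\<^bsub>Zl l\<^esub> = (\<lambda>i. 0)"
  by (simp_all add: Zl_def)

lemma vecs_intros [simp]:
  "(\<lambda>i. 0) \<in> vecs l"
  "u \<in> vecs l \<Longrightarrow> v \<in> vecs l \<Longrightarrow> (\<lambda>i. u i + v i) \<in> vecs l"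
  "u \<in> vecs l \<Longrightarrow> v \<in> vecs l \<Longrightarrow> (\<lambda>i. u i - v i) \<in> vecs l"
  "u \<in> vecs l \<Longrightarrow> (\<lambda>i. - u i) \<in> vecs l"
  "u \<in> vecs l \<Longrightarrow> (\<lambda>i. c * u i) \<in> vecs l"
  "u \<in> vecs l \<Longrightarrow> (\<lambda>i. d i * u i) \<in> vecs l"
  by (auto simp: vecs_def)

lemma comm_group_Zl: "comm_group (Zl l)"
proof (rule comm_groupI)
  fix u assume "u \<in> carrier (Zl l)"
  then show "\<exists>v\<in>carrier (Zl l). v \<otimes>\<^bsub>Zl l\<^esub> u = \<one>\<^bsub>Zl l\<^esub>"
    by (intro bexI[of _ "\<lambda>i. - u i"]) auto
qed (auto simp: add.assoc add.commute)

lemma inv_Zl: "u \<in> vecs l \<Longrightarrow> inv\<^bsub>Zl l\<^esub> u = (\<lambda>i. - u i)"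
  using comm_group.axioms(2)[OF comm_group_Zl] group.inv_equality[of "Zl l" "\<lambda>i. - u i" u] by simp

lemma subgroup_plam: "subgroup (plam p lam ` vecs l) (Zl l)"
proof (rule group.subgroupI[OF comm_group.axioms(2)[OF comm_group_Zl]])
  show "plam p lam ` vecs l \<subseteq> carrier (Zl l)" by (auto simp: plam_def)
  show "plam p lam ` vecs l \<noteq> {}" using vecs_intros(1) by blast
  fix a assume "a \<in> plam p lam ` vecs l"
  then obtain u where u: "u \<in> vecs l" "a = plam p lam u" by blast
  then show "inv\<^bsub>Zl l\<^esub> a \<in> plam p lam ` vecs l"
    by (intro image_eqI[of _ _ "\<lambda>i. - u i"]) (auto simp: inv_Zl plam_def)
  fix b assume "b \<in> plam p lam ` vecs l"
  then obtain v where v: "v \<in> vecs l" "b = plam p lam v" by blast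
  with u show "a \<otimes>\<^bsub>Zl l\<^esub> b \<in> plam p lam ` vecs l"
    by (intro image_eqI[of _ _ "\<lambda>i. u i + v i"]) (auto simp: plam_def algebra_simps)
qed

definition cl :: "nat \<Rightarrow> nat \<Rightarrow> (nat \<Rightarrow> nat) \<Rightarrow> (nat \<Rightarrow> int) \<Rightarrow> (nat \<Rightarrow> int) set" where
  "cl p l lam v = (plam p lam ` vecs l) #>\<^bsub>Zl l\<^esub> v"

text \<open>The product of the row vector \<open>x\<close> with a matrix: an integral lift of
  \<open>a_alpha\<close> when the matrix is \<alpha>, and later the action on \<open>G\<close> of an
  endomorphism with matrix \<open>P\<close>.\<close>

definition rowcomb :: "nat \<Rightarrow> (nat \<Rightarrow> nat \<Rightarrow> int) \<Rightarrow> (nat \<Rightarrow> int) \<Rightarrow> nat \<Rightarrow> int" where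
  "rowcomb l \<alpha> x = (\<lambda>j. if j \<in> {1..l} then (\<Sum>i=1..l. x i * \<alpha> i j) else 0)"

text \<open>The class [(v, x)] in L(\<alpha>), with both components represented by integer vectors;
  all calculations in L(\<alpha>) are done on such representatives.\<close>

definition qmap where
  "qmap p l lam \<alpha> v x = rel_alpha p l lam \<alpha> #>\<^bsub>Zmodplam p l lam \<times>\<times> Zl l\<^esub> (cl p l lam v, x)"

lemma rowcomb_vecs [simp]: "rowcomb l \<alpha> x \<in> vecs l"
  by (auto simp: rowcomb_def vecs_def)

lemma rowcomb_add: "rowcomb l \<alpha> (\<lambda>i. x i + y i) = (\<lambda>j. rowcomb l \<alpha> x j + rowcomb l \<alpha> y j)"
  by (auto simp: rowcomb_def algebra_simps sum.distrib)

lemma rowcomb_scale: "rowcomb l \<alpha> (\<lambda>i. c * x i) = (\<lambda>j. c * rowcomb l \<alpha> x j)"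
  by (auto simp: rowcomb_def sum_distrib_left mult.assoc)

lemma rowcomb_minus: "rowcomb l \<alpha> (\<lambda>i. - x i) = (\<lambda>j. - rowcomb l \<alpha> x j)"
  by (auto simp: rowcomb_def sum_negf)

lemma DirProd_comm_group:
  assumes "comm_group G" "comm_group H"
  shows "comm_group (G \<times>\<times> H)"
proof -
  interpret G: comm_group G by fact
  interpret H: comm_group H by fact
  show ?thesis
    by (rule group.group_comm_groupI) (auto intro: DirProd_group G.m_comm H.m_comm)
qed

lemma a_alpha_cl: "a_alpha p l lam \<alpha> x = cl p l lam (rowcomb l \<alpha> x)"
  by (simp add: a_alpha_def cl_def rowcomb_def)

context
  fixes p l :: nat and lam :: "nat \<Rightarrow> nat" and \<alpha> :: "nat \<Rightarrow> nat \<Rightarrow> int"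
begin

interpretation Z: comm_group "Zl l" by (rule comm_group_Zl)
interpretation N: normal "plam p lam ` vecs l" "Zl l"
  by (rule Z.subgroup_imp_normal[OF subgroup_plam])
interpretation M: comm_group "Zmodplam p l lam"
  unfolding Zmodplam_def by (rule Z.abelian_FactGroup[OF subgroup_plam])
interpretation MZ: comm_group "Zmodplam p l lam \<times>\<times> Zl l"
  by (rule DirProd_comm_group[OF M.comm_group_axioms Z.comm_group_axioms])

lemma cl_hom: "cl p l lam \<in> hom (Zl l) (Zmodplam p l lam)"
  using N.r_coset_hom_Mod unfolding Zmodplam_def cl_def by simp

lemma cl_add: "u \<in> vecs l \<Longrightarrow> v \<in> vecs l \<Longrightarrow>
    cl p l lam u \<otimes>\<^bsub>Zmodplam p l lam\<^esub> cl p l lam v = cl p l lam (\<lambda>i. u i + v i)"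
  using hom_mult[OF cl_hom, of u v] by simp

lemma cl_closed [simp]: "u \<in> vecs l \<Longrightarrow> cl p l lam u \<in> carrier (Zmodplam p l lam)"
  using hom_carrier[OF cl_hom] by auto

lemma cl_zero: "\<one>\<^bsub>Zmodplam p l lam\<^esub> = cl p l lam (\<lambda>i. 0)"
  using hom_one[OF cl_hom] Z.is_group M.is_group by simp

lemma carrier_Zmodplam: "carrier (Zmodplam p l lam) = cl p l lam ` vecs l"
  by (auto simp: Zmodplam_def FactGroup_def RCOSETS_def cl_def)

lemma cl_eq_iff:
  assumes "u \<in> vecs l" "v \<in> vecs l"
  shows "cl p l lam u = cl p l lam v \<longleftrightarrow> (\<forall>i\<in>{1..l}. int p ^ lam i dvd u i - v i)"
proof -
  have "cl p l lam u = cl p l lam v \<longleftrightarrow> u \<otimes>\<^bsub>Zl l\<^esub> inv\<^bsub>Zl l\<^esub> v \<in> plam p lam ` vecs l"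
  proof
    assume "cl p l lam u = cl p l lam v"
    then have "u \<in> plam p lam ` vecs l #>\<^bsub>Zl l\<^esub> v"
      using Z.rcos_self[OF _ subgroup_plam, of u] assms by (auto simp: cl_def)
    then show "u \<otimes>\<^bsub>Zl l\<^esub> inv\<^bsub>Zl l\<^esub> v \<in> plam p lam ` vecs l"
      using N.rcos_module_imp[of v u] Z.is_group assms by simp
  next
    assume "u \<otimes>\<^bsub>Zl l\<^esub> inv\<^bsub>Zl l\<^esub> v \<in> plam p lam ` vecs l"
    then have "u \<in> plam p lam ` vecs l #>\<^bsub>Zl l\<^esub> v"
      using N.rcos_module_rev[of v u] Z.is_group assms by simp
    then show "cl p l lam u = cl p l lam v"
      using Z.repr_independence[OF _ _ subgroup_plam, where x=v and y=u] assms by (simp add: cl_def)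
  qed
  also have "\<dots> \<longleftrightarrow> (\<lambda>i. u i - v i) \<in> plam p lam ` vecs l" using assms by (simp add: inv_Zl)
  also have "\<dots> \<longleftrightarrow> (\<forall>i\<in>{1..l}. int p ^ lam i dvd u i - v i)"
  proof
    assume "\<forall>i\<in>{1..l}. int p ^ lam i dvd u i - v i"
    then have "\<forall>i\<in>{1..l}. \<exists>k. u i - v i = int p ^ lam i * k" by (auto simp: dvd_def)
    then obtain w where w: "\<And>i. i \<in> {1..l} \<Longrightarrow> u i - v i = int p ^ lam i * w i" by metis
    have "(\<lambda>i. u i - v i) = plam p lam (\<lambda>i. if i \<in> {1..l} then w i else 0)"
      using w assms by (auto simp: plam_def fun_eq_iff vecs_def)
    then show "(\<lambda>i. u i - v i) \<in> plam p lam ` vecs l" by (auto simp: vecs_def)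
  next
    assume "(\<lambda>i. u i - v i) \<in> plam p lam ` vecs l"
    then obtain w where "(\<lambda>i. u i - v i) = plam p lam w" by blast
    then have "u i - v i = int p ^ lam i * w i" for i by (simp add: plam_def fun_eq_iff)
    then show "\<forall>i\<in>{1..l}. int p ^ lam i dvd u i - v i" by simp
  qed
  finally show ?thesis .
qed

lemma subgroup_rel: "subgroup (rel_alpha p l lam \<alpha>) (Zmodplam p l lam \<times>\<times> Zl l)"
proof (rule MZ.subgroupI)
  show "rel_alpha p l lam \<alpha> \<subseteq> carrier (Zmodplam p l lam \<times>\<times> Zl l)"
    by (auto simp: rel_alpha_def a_alpha_cl plam_def)
  show "rel_alpha p l lam \<alpha> \<noteq> {}" using vecs_intros(1) unfolding rel_alpha_def by blast
  fix a assume "a \<in> rel_alpha p l lam \<alpha>"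
  then obtain u where u: "u \<in> vecs l" "a = (cl p l lam (rowcomb l \<alpha> u), \<lambda>i. - plam p lam u i)"
    by (auto simp: rel_alpha_def a_alpha_cl)
  let ?a' = "(cl p l lam (rowcomb l \<alpha> (\<lambda>i. - u i)), \<lambda>i. - plam p lam (\<lambda>i. - u i) i)"
  have "?a' \<otimes>\<^bsub>Zmodplam p l lam \<times>\<times> Zl l\<^esub> a = \<one>\<^bsub>Zmodplam p l lam \<times>\<times> Zl l\<^esub>"
    unfolding u by (simp add: rowcomb_minus cl_add cl_zero plam_def)
  then have "inv\<^bsub>Zmodplam p l lam \<times>\<times> Zl l\<^esub> a = ?a'"
    by (rule MZ.inv_equality) (use u in \<open>auto simp: plam_def\<close>)
  then show "inv\<^bsub>Zmodplam p l lam \<times>\<times> Zl l\<^esub> a \<in> rel_alpha p l lam \<alpha>"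
    unfolding rel_alpha_def a_alpha_cl using vecs_intros(4)[OF u(1)] by blast
  fix b assume "b \<in> rel_alpha p l lam \<alpha>"
  then obtain v where v: "v \<in> vecs l" "b = (cl p l lam (rowcomb l \<alpha> v), \<lambda>i. - plam p lam v i)"
    by (auto simp: rel_alpha_def a_alpha_cl)
  have "a \<otimes>\<^bsub>Zmodplam p l lam \<times>\<times> Zl l\<^esub> b =
      (cl p l lam (rowcomb l \<alpha> (\<lambda>i. u i + v i)), \<lambda>i. - plam p lam (\<lambda>i. u i + v i) i)"
    unfolding u v by (simp add: cl_add rowcomb_add plam_def fun_eq_iff algebra_simps)
  then show "a \<otimes>\<^bsub>Zmodplam p l lam \<times>\<times> Zl l\<^esub> b \<in> rel_alpha p l lam \<alpha>"
    unfolding rel_alpha_def a_alpha_cl using vecs_intros(2)[OF u(1) v(1)] by blast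
qed

interpretation R: normal "rel_alpha p l lam \<alpha>" "Zmodplam p l lam \<times>\<times> Zl l"
  by (rule MZ.subgroup_imp_normal[OF subgroup_rel])

lemma comm_group_L_alpha: "comm_group (L_alpha p l lam \<alpha>)"
  unfolding L_alpha_def by (rule MZ.abelian_FactGroup[OF subgroup_rel])

lemma qmap_closed [simp]:
  "v \<in> vecs l \<Longrightarrow> x \<in> vecs l \<Longrightarrow> qmap p l lam \<alpha> v x \<in> carrier (L_alpha p l lam \<alpha>)"
  using hom_carrier[OF R.r_coset_hom_Mod] unfolding L_alpha_def qmap_def by auto

lemma qmap_surj:
  "z \<in> carrier (L_alpha p l lam \<alpha>) \<Longrightarrow> \<exists>v\<in>vecs l. \<exists>x\<in>vecs l. z = qmap p l lam \<alpha> v x"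
  by (auto simp: L_alpha_def FactGroup_def RCOSETS_def qmap_def carrier_Zmodplam)

lemma qmap_add:
  assumes "v \<in> vecs l" "x \<in> vecs l" "w \<in> vecs l" "y \<in> vecs l"
  shows "qmap p l lam \<alpha> v x \<otimes>\<^bsub>L_alpha p l lam \<alpha>\<^esub> qmap p l lam \<alpha> w y =
    qmap p l lam \<alpha> (\<lambda>i. v i + w i) (\<lambda>i. x i + y i)"
  using hom_mult[OF R.r_coset_hom_Mod, of "(cl p l lam v, x)" "(cl p l lam w, y)"] assms
  by (simp add: qmap_def L_alpha_def cl_add)

text \<open>Here \<open>y\<close> is the vector that produces the relation, and the minus sign comes
  from the second component of \<open>rel_alpha\<close>. This turns every identity in L(\<alpha>)
  into integer congruences.\<close>

lemma qmap_eq_one_iff: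
  assumes "v \<in> vecs l" "x \<in> vecs l"
  shows "qmap p l lam \<alpha> v x = \<one>\<^bsub>L_alpha p l lam \<alpha>\<^esub> \<longleftrightarrow>
    (\<exists>y\<in>vecs l. (\<forall>i. x i = - (int p ^ lam i * y i)) \<and>
       (\<forall>j\<in>{1..l}. int p ^ lam j dvd v j - rowcomb l \<alpha> y j))"
proof -
  have "qmap p l lam \<alpha> v x = \<one>\<^bsub>L_alpha p l lam \<alpha>\<^esub> \<longleftrightarrow> (cl p l lam v, x) \<in> rel_alpha p l lam \<alpha>"
    unfolding qmap_def L_alpha_def FactGroup_def
    using MZ.coset_join1[OF _ _ subgroup_rel, of "(cl p l lam v, x)"] MZ.coset_join2[OF _ subgroup_rel, of "(cl p l lam v, x)"]
      subgroup_rel assms by auto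
  also have "\<dots> \<longleftrightarrow> (\<exists>y\<in>vecs l. cl p l lam v = cl p l lam (rowcomb l \<alpha> y) \<and> x = (\<lambda>i. - plam p lam y i))"
    by (auto simp: rel_alpha_def a_alpha_cl)
  finally show ?thesis
    by (simp add: cl_eq_iff[OF assms(1)] plam_def fun_eq_iff conj_commute cong: conj_cong)
qed

lemma f_alpha_image: "f_alpha p l lam \<alpha> ` carrier (Zmodplam p l lam) = (\<lambda>v. qmap p l lam \<alpha> v (\<lambda>i. 0)) ` vecs l"
  by (simp add: f_alpha_def qmap_def carrier_Zmodplam image_image)

lemma subgroup_f_alpha: "subgroup (f_alpha p l lam \<alpha> ` carrier (Zmodplam p l lam)) (L_alpha p l lam \<alpha>)"
proof -
  interpret L: comm_group "L_alpha p l lam \<alpha>" by (rule comm_group_L_alpha)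
  show ?thesis
    unfolding f_alpha_image
  proof (rule L.subgroupI)
    fix a assume "a \<in> (\<lambda>v. qmap p l lam \<alpha> v (\<lambda>i. 0)) ` vecs l"
    then obtain u where u: "u \<in> vecs l" "a = qmap p l lam \<alpha> u (\<lambda>i. 0)" by blast
    have "qmap p l lam \<alpha> (\<lambda>i. - u i) (\<lambda>i. 0) \<otimes>\<^bsub>L_alpha p l lam \<alpha>\<^esub> a = \<one>\<^bsub>L_alpha p l lam \<alpha>\<^esub>"
      unfolding u by (simp add: qmap_add u qmap_eq_one_iff) (auto intro!: bexI[of _ "\<lambda>i. 0"] simp: rowcomb_def)
    then have "inv\<^bsub>L_alpha p l lam \<alpha>\<^esub> a = qmap p l lam \<alpha> (\<lambda>i. - u i) (\<lambda>i. 0)"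
      by (rule L.inv_equality) (use u in auto)
    then show "inv\<^bsub>L_alpha p l lam \<alpha>\<^esub> a \<in> (\<lambda>v. qmap p l lam \<alpha> v (\<lambda>i. 0)) ` vecs l"
      using vecs_intros(4)[OF u(1)] by blast
    fix b assume "b \<in> (\<lambda>v. qmap p l lam \<alpha> v (\<lambda>i. 0)) ` vecs l"
    then obtain v where v: "v \<in> vecs l" "b = qmap p l lam \<alpha> v (\<lambda>i. 0)" by blast
    then show "a \<otimes>\<^bsub>L_alpha p l lam \<alpha>\<^esub> b \<in> (\<lambda>v. qmap p l lam \<alpha> v (\<lambda>i. 0)) ` vecs l"
      unfolding u v using vecs_intros(2)[OF u(1) v(1)] by (simp add: qmap_add u)
  qed (auto intro: vecs_intros(1))
qed

lemma qmap_pow: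
  assumes "v \<in> vecs l" "x \<in> vecs l"
  shows "qmap p l lam \<alpha> v x [^]\<^bsub>L_alpha p l lam \<alpha>\<^esub> (n::nat) =
    qmap p l lam \<alpha> (\<lambda>i. int n * v i) (\<lambda>i. int n * x i)"
proof -
  interpret L: comm_group "L_alpha p l lam \<alpha>" by (rule comm_group_L_alpha)
  show ?thesis
  proof (induction n)
    case 0
    have "qmap p l lam \<alpha> (\<lambda>i. 0) (\<lambda>i. 0) = \<one>\<^bsub>L_alpha p l lam \<alpha>\<^esub>"
      by (simp add: qmap_eq_one_iff) (auto intro!: bexI[of _ "\<lambda>i. 0"] simp: rowcomb_def)
    then show ?case by simp
  next
    case (Suc n)
    then show ?case using assms by (simp add: qmap_add algebra_simps)
  qed
qed

lemma qmap_eq_iff: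
  assumes "v \<in> vecs l" "x \<in> vecs l" "w \<in> vecs l" "y \<in> vecs l"
  shows "qmap p l lam \<alpha> v x = qmap p l lam \<alpha> w y \<longleftrightarrow>
    qmap p l lam \<alpha> (\<lambda>i. v i - w i) (\<lambda>i. x i - y i) = \<one>\<^bsub>L_alpha p l lam \<alpha>\<^esub>"
proof -
  interpret L: comm_group "L_alpha p l lam \<alpha>" by (rule comm_group_L_alpha)
  have "qmap p l lam \<alpha> v x =
      qmap p l lam \<alpha> (\<lambda>i. v i - w i) (\<lambda>i. x i - y i) \<otimes>\<^bsub>L_alpha p l lam \<alpha>\<^esub> qmap p l lam \<alpha> w y"
    using assms by (simp add: qmap_add)
  then show ?thesis
    using L.r_cancel_one[OF qmap_closed[OF assms(3,4)] qmap_closed[OF vecs_intros(3)[OF assms(1,3)] vecs_intros(3)[OF assms(2,4)]]]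
    by simp
qed

text \<open>Raising to the power \<open>p ^ e\<close> first pushes everything into the image of
  \<open>f_alpha\<close>; doing so again kills that image.\<close>

lemma L_alpha_torsion:
  assumes e: "\<And>i. i \<in> {1..l} \<Longrightarrow> lam i \<le> e" and z: "z \<in> carrier (L_alpha p l lam \<alpha>)"
  shows "z [^]\<^bsub>L_alpha p l lam \<alpha>\<^esub> (p ^ (2 * e) :: nat) = \<one>\<^bsub>L_alpha p l lam \<alpha>\<^esub>"
proof -
  obtain v x where vx: "v \<in> vecs l" "x \<in> vecs l" "z = qmap p l lam \<alpha> v x" using qmap_surj[OF z] by blast
  define y where "y i = (if i \<in> {1..l} then - (int p ^ (2 * e - lam i) * x i) else 0)" for i
  have y: "y \<in> vecs l" by (auto simp: y_def vecs_def)
  have dvd_e: "int p ^ e dvd int p ^ (2 * e - lam i)" "int p ^ lam i dvd int p ^ e" if "i \<in> {1..l}" for i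
    using e[OF that] by (auto intro!: le_imp_power_dvd)
  have "int p ^ e dvd y i" for i
    unfolding y_def using dvd_e by (auto intro: dvd_mult2)
  then have row: "int p ^ e dvd rowcomb l \<alpha> y j" for j
    by (auto simp: rowcomb_def intro!: dvd_sum dvd_mult2)
  have "int p ^ lam i * y i = - (int (p ^ (2 * e)) * x i)" for i
  proof (cases "i \<in> {1..l}")
    case True
    then have "int p ^ lam i * int p ^ (2 * e - lam i) = int p ^ (2 * e)"
      using e[of i] by (simp flip: power_add)
    then show ?thesis using True by (simp add: y_def mult.assoc[symmetric])
  next
    case False then show ?thesis using vx(2) by (auto simp: y_def vecs_def)
  qed
  moreover have "int p ^ lam j dvd int (p ^ (2 * e)) * v j - rowcomb l \<alpha> y j" if "j \<in> {1..l}" for j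
  proof (rule dvd_trans[OF dvd_e(2)[OF that]], rule dvd_diff)
    show "int p ^ e dvd int (p ^ (2 * e)) * v j" by (simp add: le_imp_power_dvd)
  qed (rule row)
  ultimately show ?thesis
    unfolding vx(3) qmap_pow[OF vx(1,2)] using y vx by (subst qmap_eq_one_iff) (auto intro!: bexI[of _ y])
qed

text \<open>The power p^(2e) kills the group, so both representing vectors may be reduced modulo it,
  which leaves finitely many pairs.\<close>

lemma finite_L_alpha:
  assumes p: "p > 0"
  shows "finite (carrier (L_alpha p l lam \<alpha>))"
proof -
  interpret L: comm_group "L_alpha p l lam \<alpha>" by (rule comm_group_L_alpha)
  define e where "e = (\<Sum>i=1..l. lam i)"
  have e: "lam i \<le> e" if "i \<in> {1..l}" for i
    unfolding e_def by (rule member_le_sum) (use that in auto)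
  define m where "m = int (p ^ (2 * e))"
  have m: "m > 0" using p by (simp add: m_def)
  define W where "W = {v \<in> vecs l. \<forall>i. v i \<in> {0..<m}}"
  have "W \<subseteq> (\<lambda>f i. if i \<in> {1..l} then f i else 0) ` (PiE {1..l} (\<lambda>_. {0..<m}))"
  proof
    fix v assume v: "v \<in> W"
    then have "v = (\<lambda>i. if i \<in> {1..l} then restrict v {1..l} i else 0)"
      by (auto simp: W_def vecs_def fun_eq_iff)
    moreover have "restrict v {1..l} \<in> PiE {1..l} (\<lambda>_. {0..<m})" using v by (auto simp: W_def)
    ultimately show "v \<in> (\<lambda>f i. if i \<in> {1..l} then f i else 0) ` (PiE {1..l} (\<lambda>_. {0..<m}))" by blast
  qed
  then have fin: "finite W" by (rule finite_subset) (auto intro!: finite_PiE)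
  have "carrier (L_alpha p l lam \<alpha>) \<subseteq> (\<lambda>(v, x). qmap p l lam \<alpha> v x) ` (W \<times> W)"
  proof
    fix z assume "z \<in> carrier (L_alpha p l lam \<alpha>)"
    then obtain v x where vx: "v \<in> vecs l" "x \<in> vecs l" "z = qmap p l lam \<alpha> v x" using qmap_surj by blast
    have D: "(\<lambda>i. f i div m) \<in> vecs l" "(\<lambda>i. f i mod m) \<in> vecs l" if "f \<in> vecs l" for f
      using that by (auto simp: vecs_def)
    have "qmap p l lam \<alpha> (\<lambda>i. m * (v i div m)) (\<lambda>i. m * (x i div m)) = \<one>\<^bsub>L_alpha p l lam \<alpha>\<^esub>"
      using L_alpha_torsion[OF e qmap_closed[OF D(1)[OF vx(1)] D(1)[OF vx(2)]]]
      unfolding qmap_pow[OF D(1)[OF vx(1)] D(1)[OF vx(2)]] by (simp only: m_def)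
    moreover have "z = qmap p l lam \<alpha> (\<lambda>i. m * (v i div m)) (\<lambda>i. m * (x i div m)) \<otimes>\<^bsub>L_alpha p l lam \<alpha>\<^esub>
        qmap p l lam \<alpha> (\<lambda>i. v i mod m) (\<lambda>i. x i mod m)"
      by (subst qmap_add) (auto simp: vx D)
    ultimately have "z = qmap p l lam \<alpha> (\<lambda>i. v i mod m) (\<lambda>i. x i mod m)" using vx D by simp
    moreover have "(\<lambda>i. v i mod m) \<in> W" "(\<lambda>i. x i mod m) \<in> W" using D vx m by (auto simp: W_def)
    ultimately show "z \<in> (\<lambda>(v, x). qmap p l lam \<alpha> v x) ` (W \<times> W)" by force
  qed
  then show ?thesis by (rule finite_subset) (use fin in auto)
qed

end

section \<open>The local obstruction\<close>

text \<open>Triangularity and the zero diagonal make \<open>P\<close> nilpotent modulo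
  \<open>p\<close>, and an idempotent nilpotent matrix is zero. Column \<open>k\<close> has its own
  modulus because the \<open>k\<close>-th coordinate of \<open>G\<close> lives in
  Z/p^\<open>lam k\<close>.\<close>

lemma idempotent_matrix_vanishes:
  fixes P :: "nat \<Rightarrow> nat \<Rightarrow> int" and p :: int and lam :: "nat \<Rightarrow> nat"
  assumes low: "\<And>j k. j \<in> {1..s} \<Longrightarrow> k \<in> {1..s} \<Longrightarrow> k < j \<Longrightarrow> p dvd P j k"
    and diag: "\<And>j. j \<in> {1..s} \<Longrightarrow> p dvd P j j"
    and lam: "\<And>k. k \<in> {1..s} \<Longrightarrow> 1 \<le> lam k"
    and idem: "\<And>j k. j \<in> {1..s} \<Longrightarrow> k \<in> {1..s} \<Longrightarrow> p ^ lam k dvd (\<Sum>m=1..s. P j m * P m k) - P j k"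
    and jk: "j \<in> {1..s}" "k \<in> {1..s}"
  shows "p ^ lam k dvd P j k"
proof -
  \<comment> \<open>Downward induction on the row: in the sum of \<open>P j m * P m k\<close>, the
    first factor vanishes modulo \<open>p\<close> for m <= j, the second one by induction for m >
    j.\<close>
  have nil: "p dvd P j k" if "j \<in> {1..s}" "k \<in> {1..s}" for j k
    using that
  proof (induction "s - j" arbitrary: j rule: less_induct)
    case less
    have "p dvd P j m * P m k" if m: "m \<in> {1..s}" for m
    proof (cases "m < j \<or> m = j")
      case True then show ?thesis using low[of j m] diag[of j] less.prems m by (auto intro: dvd_mult2)
    next
      case False
      then have "p dvd P m k" using less.hyps[of m] less.prems m by auto
      then show ?thesis by simp
    qed
    then have "p dvd (\<Sum>m=1..s. P j m * P m k)" by (intro dvd_sum) auto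
    moreover have "p dvd (\<Sum>m=1..s. P j m * P m k) - P j k"
      using dvd_trans[OF _ idem[OF less.prems], of p] lam[OF less.prems(2)] by simp
    ultimately show ?case using dvd_diff[of p "\<Sum>m=1..s. P j m * P m k" "(\<Sum>m=1..s. P j m * P m k) - P j k"] by simp
  qed
  \<comment> \<open>All entries are divisible by \<open>p\<close>, so each use of P = P^2 gains one
    more factor \<open>p\<close>, until the modulus of column \<open>k\<close> is reached.\<close>
  have "p ^ min n (lam k) dvd P j k" if "j \<in> {1..s}" "k \<in> {1..s}" for n j k
    using that
  proof (induction n arbitrary: j k)
    case (Suc n)
    have "p ^ min (Suc n) (lam k) dvd P j m * P m k" if m: "m \<in> {1..s}" for m
    proof -
      have "p * p ^ min n (lam k) dvd P j m * P m k"
        using nil[OF Suc.prems(1) m] Suc.IH[OF m Suc.prems(2)] by (rule mult_dvd_mono)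
      moreover have "p ^ min (Suc n) (lam k) dvd p ^ Suc (min n (lam k))" by (rule le_imp_power_dvd) auto
      ultimately show ?thesis by (metis dvd_trans power_Suc)
    qed
    then have "p ^ min (Suc n) (lam k) dvd (\<Sum>m=1..s. P j m * P m k)" by (intro dvd_sum) auto
    moreover have "p ^ min (Suc n) (lam k) dvd (\<Sum>m=1..s. P j m * P m k) - P j k"
      using idem[OF Suc.prems] le_imp_power_dvd[of "min (Suc n) (lam k)" "lam k" p] by (meson dvd_trans min.cobounded2)
    ultimately show ?case
      using dvd_diff[of _ "\<Sum>m=1..s. P j m * P m k" "(\<Sum>m=1..s. P j m * P m k) - P j k"] by simp
  qed simp
  from this[of j k "lam k"] show ?thesis using jk by simp
qed

lemma dvd_pivot:
  fixes f :: "nat \<Rightarrow> int"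
  assumes "finite I" "i \<in> I" "d dvd sum f I" "\<And>k. k \<in> I \<Longrightarrow> k \<noteq> i \<Longrightarrow> d dvd f k"
  shows "d dvd f i"
proof -
  have "sum f I = f i + sum f (I - {i})" using assms by (simp add: sum.remove)
  moreover have "d dvd sum f (I - {i})" using assms by (intro dvd_sum) auto
  ultimately show ?thesis using assms(3) dvd_add_left_iff by metis
qed

lemma alpha_ex_diag: "alpha_ex p s i i = 0"
  by (simp add: alpha_ex_def)

text \<open>\<open>P\<close> is the matrix of an endomorphism: \<open>row1\<close> says that it kills the first row of \<open>\<alpha>\<close>, \<open>row2\<close>
  that it maps the second row into the span of the first two.  Column \<open>j\<close> of \<open>row1\<close> gives \<open>p dvd P j j\<close>
  for \<open>j \<ge> 2\<close>; columns 1 and 3 of \<open>row2\<close> give \<open>P 1 1 = z\<close> and \<open>P 3 3 = z\<close> modulo \<open>p\<close>.\<close>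

lemma alpha_ex_dvd_diag:
  fixes P :: "nat \<Rightarrow> nat \<Rightarrow> int" and p s :: nat
  assumes p: "p > 0" and s: "s \<ge> 4"
    and low: "\<And>j k. j \<in> {1..s} \<Longrightarrow> k \<in> {1..s} \<Longrightarrow> k < j \<Longrightarrow> int p ^ s dvd P j k"
    and row1: "\<And>j. j \<in> {1..s} \<Longrightarrow> int p ^ s dvd (\<Sum>k=1..s. alpha_ex p s 1 k * P k j)"
    and row2: "\<And>j. j \<in> {1..s} \<Longrightarrow> int p ^ s dvd
      (\<Sum>k=1..s. alpha_ex p s 2 k * P k j) - (y * alpha_ex p s 1 j + z * alpha_ex p s 2 j)"
    and j: "j \<in> {1..s}"
  shows "int p dvd P j j"
proof -
  have ge2: "int p dvd P j j" if j: "j \<in> {2..s}" for j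
  proof -
    \<comment> \<open>The exponent is one more than that of the entry p^(s-j) in position (1,j). For
      k < j the entry of the first row is 0 or has a higher power of \<open>p\<close>, for k > j
      triangularity applies, so only the term k = j is left.\<close>
    have "int p ^ (s - j + 1) dvd alpha_ex p s 1 j * P j j"
    proof (rule dvd_pivot[where I = "{1..s}" and f = "\<lambda>k. alpha_ex p s 1 k * P k j"])
      show "int p ^ (s - j + 1) dvd (\<Sum>k = 1..s. alpha_ex p s 1 k * P k j)"
        using row1[of j] j le_imp_power_dvd[of "s - j + 1" s "int p"] by (auto intro: dvd_trans)
      fix k assume k: "k \<in> {1..s}" "k \<noteq> j"
      show "int p ^ (s - j + 1) dvd alpha_ex p s 1 k * P k j"
      proof (cases "j < k")
        case True
        then have "int p ^ s dvd P k j" using low[of k j] k j by auto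
        then show ?thesis using j le_imp_power_dvd[of "s - j + 1" s "int p"] by (auto intro: dvd_trans dvd_mult)
      next
        case False
        then have "s - j + 1 \<le> s - k" if "k \<noteq> 1" using k j that by auto
        then have "int p ^ (s - j + 1) dvd alpha_ex p s 1 k"
          using k le_imp_power_dvd[of "s - j + 1" "s - k" "int p"] by (auto simp: alpha_ex_def)
        then show ?thesis by simp
      qed
    qed (use j in auto)
    moreover have "alpha_ex p s 1 j = int p ^ (s - j)" using j by (auto simp: alpha_ex_def)
    ultimately show ?thesis using p by simp
  qed
  have a21: "alpha_ex p s 2 1 = - (int p ^ (s - 2))" and a23: "alpha_ex p s 2 3 = int p ^ (s - 4)"
    and a13: "alpha_ex p s 1 3 = int p ^ (s - 3)" and a11: "alpha_ex p s 1 1 = 0"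
    using s by (auto simp: alpha_ex_def numeral_2_eq_2)
  \<comment> \<open>In column 1 triangularity removes all terms but the first, and the unknown
    \<open>y\<close> disappears because \<alpha> has zero diagonal.\<close>
  have col1: "int p ^ s dvd alpha_ex p s 2 1 * P 1 1 - (y * alpha_ex p s 1 1 + z * alpha_ex p s 2 1)"
  proof -
    have "int p ^ s dvd (\<Sum>k=2..s. alpha_ex p s 2 k * P k 1)"
      using low by (intro dvd_sum) auto
    moreover have "(\<Sum>k=1..s. alpha_ex p s 2 k * P k 1) = alpha_ex p s 2 1 * P 1 1 + (\<Sum>k=2..s. alpha_ex p s 2 k * P k 1)"
      using s by (subst sum.atLeast_Suc_atMost) (auto simp: numeral_2_eq_2)
    ultimately show ?thesis
      using row2[of 1] s dvd_diff[of "int p ^ s" _ "\<Sum>k=2..s. alpha_ex p s 2 k * P k 1"]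
      by (fastforce simp: algebra_simps)
  qed
  moreover have "2 \<le> s" using s by simp
  then have "int p ^ s = int p ^ (s - 2) * int p ^ 2" by (metis le_add_diff_inverse2 power_add)
  moreover have "alpha_ex p s 2 1 * P 1 1 - (y * alpha_ex p s 1 1 + z * alpha_ex p s 2 1) =
      int p ^ (s - 2) * (z - P 1 1)"
    unfolding a21 a11 by (simp add: algebra_simps)
  ultimately have "int p ^ (s - 2) * int p ^ 2 dvd int p ^ (s - 2) * (z - P 1 1)" by metis
  then have pz: "int p dvd z - P 1 1" using p by (auto simp: power2_eq_square dest: dvd_mult_left)
  \<comment> \<open>Modulo p^(s-3) the unknown \<open>y\<close> drops out, its coefficient in column
    3 being p^(s-3) itself, whereas the coefficient p^(s-4) of \<open>z\<close> leaves exactly one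
    factor \<open>p\<close> to be gained. Since \<open>p\<close> divides \<open>P 3 3\<close>, it
    then divides \<open>z\<close>.\<close>
  have "int p ^ (s - 3) dvd (\<Sum>k=1..s. alpha_ex p s 2 k * P k 3) - (y * alpha_ex p s 1 3 + z * alpha_ex p s 2 3)"
    using row2[of 3] s le_imp_power_dvd[of "s - 3" s "int p"] by (auto intro: dvd_trans)
  then have "int p ^ (s - 3) dvd (\<Sum>k=1..s. alpha_ex p s 2 k * P k 3) - (y * alpha_ex p s 1 3 + z * alpha_ex p s 2 3)
      + y * alpha_ex p s 1 3"
    unfolding a13 by (rule dvd_add) simp
  then have d3: "int p ^ (s - 3) dvd (\<Sum>k=1..s. alpha_ex p s 2 k * P k 3) - z * alpha_ex p s 2 3" by simp
  have "int p dvd P 3 3" using ge2[of 3] s by simp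
  moreover have p3: "int p ^ (s - 3) = int p ^ (s - 4) * int p"
  proof -
    have "s - 3 = Suc (s - 4)" using s by simp
    then show ?thesis by (simp only: power_Suc2)
  qed
  ultimately have "int p ^ (s - 3) dvd alpha_ex p s 2 3 * P 3 3"
    unfolding a23 by (simp add: mult_dvd_mono)
  have "int p ^ (s - 3) dvd alpha_ex p s 2 k * P k 3" if k: "k \<in> {1..s}" for k
  proof -
    consider "k = 1" | "k = 2" | "k = 3" | "k > 3" using k by fastforce
    then show ?thesis
    proof cases
      case 1 then show ?thesis unfolding 1 a21 by (simp add: le_imp_power_dvd dvd_mult2)
    next
      case 2 then show ?thesis by (simp add: alpha_ex_diag)
    next
      case 3 then show ?thesis using \<open>int p ^ (s - 3) dvd alpha_ex p s 2 3 * P 3 3\<close> by simp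
    next
      case 4
      then have "int p ^ s dvd P k 3" using low[of k 3] k s by auto
      then show ?thesis using le_imp_power_dvd[of "s - 3" s "int p"] by (auto intro: dvd_trans dvd_mult)
    qed
  qed
  then have "int p ^ (s - 3) dvd (\<Sum>k=1..s. alpha_ex p s 2 k * P k 3)" by (intro dvd_sum) auto
  with d3 have "int p ^ (s - 3) dvd z * alpha_ex p s 2 3" by (simp add: dvd_diff_right_iff)
  then have "int p dvd z" using p unfolding a23 p3 by (simp add: mult.commute)
  with pz have p1: "int p dvd P 1 1" using dvd_diff[of "int p" z "z - P 1 1"] by simp
  show ?thesis using ge2[of j] p1 j by (cases "j = 1") auto
qed

lemma lam_ex_ge:
  assumes "p \<ge> 2" "s \<le> N" "1 \<le> i" "i \<le> s"
  shows "s \<le> lam_ex p s N i"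
proof -
  have "s \<le> N" by fact
  also have "N < 2 ^ N" by (rule less_exp)
  also have "(2::nat) ^ N \<le> p ^ N" using assms by (simp add: power_mono)
  also have "p ^ N \<le> p ^ ((s + 1 - i) * N)" using assms by (intro power_increasing) auto
  finally show ?thesis by (simp add: lam_ex_def)
qed

text \<open>Lowering the index multiplies \<open>lam_ex\<close> by at least p^N >= 2, and adding
  \<open>s\<close> to a number that is at least \<open>s\<close> does not exceed doubling
  it.\<close>

lemma lam_ex_gap:
  assumes p: "p \<ge> 2" and sN: "s \<le> N" and ij: "1 \<le> i" "i < j" "j \<le> s"
  shows "lam_ex p s N j + s \<le> lam_ex p s N i"
proof -
  have N: "N \<ge> 1" using assms by auto
  have "lam_ex p s N j + s \<le> 2 * lam_ex p s N j" using lam_ex_ge[OF p sN, of j] ij by simp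
  also have "\<dots> \<le> p ^ 1 * p ^ ((s + 1 - j) * N)" using p by (simp add: lam_ex_def)
  also have "\<dots> \<le> p ^ N * p ^ ((s + 1 - j) * N)" using p N by (intro mult_right_mono power_increasing) auto
  also have "\<dots> = p ^ ((s + 1 - j + 1) * N)" by (simp add: power_add[symmetric] algebra_simps)
  also have "\<dots> \<le> p ^ ((s + 1 - i) * N)" using p ij by (intro power_increasing mult_right_mono) auto
  finally show ?thesis by (simp add: lam_ex_def)
qed

section \<open>Endomorphisms of a single L_p that preserve G_p\<close>

locale local_example =
  fixes p s N :: nat
  assumes p: "Factorial_Ring.prime p" and s: "4 \<le> s" and sN: "s \<le> N"
begin

abbreviation "lam \<equiv> lam_ex p s N"
abbreviation "\<alpha> \<equiv> alpha_ex p s"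
definition "L = L_alpha p s lam \<alpha>"
definition "G = f_alpha p s lam \<alpha> ` carrier (Zmodplam p s lam)"
text \<open>Coordinates on \<open>G\<close>: the \<open>j\<close>-th entry of \<open>v\<close>
  counts modulo p^\<open>lam j\<close>.\<close>

definition "g v = qmap p s lam \<alpha> v (\<lambda>i. 0)"

lemma p2: "p \<ge> 2" using p by (rule prime_ge_2_nat)

sublocale L: comm_group L unfolding L_def by (rule comm_group_L_alpha)

lemma finite_L: "finite (carrier L)" unfolding L_def by (rule finite_L_alpha) (use p2 in auto)

lemma G_eq: "G = g ` vecs s" unfolding G_def g_def by (rule f_alpha_image)

lemma subgroup_G: "subgroup G L" unfolding G_def L_def by (rule subgroup_f_alpha)

lemma lam_ge: "i \<in> {1..s} \<Longrightarrow> s \<le> lam i"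
  using lam_ex_ge[OF p2 sN] by auto

lemma lam_gap: "i \<in> {1..s} \<Longrightarrow> j \<in> {1..s} \<Longrightarrow> i < j \<Longrightarrow> lam j + s \<le> lam i"
  using lam_ex_gap[OF p2 sN] by auto

lemma lam_le: "i \<in> {1..s} \<Longrightarrow> lam i \<le> lam 1"
  using lam_gap[of 1 i] by (cases "i = 1") auto

lemma L_torsion: "x \<in> carrier L \<Longrightarrow> x [^]\<^bsub>L\<^esub> (p ^ (2 * lam 1) :: nat) = \<one>\<^bsub>L\<^esub>"
  unfolding L_def by (rule L_alpha_torsion[OF lam_le])

lemma g_closed [simp]: "v \<in> vecs s \<Longrightarrow> g v \<in> carrier L"
  by (simp add: g_def L_def)

lemma g_add: "v \<in> vecs s \<Longrightarrow> w \<in> vecs s \<Longrightarrow> g v \<otimes>\<^bsub>L\<^esub> g w = g (\<lambda>i. v i + w i)"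
  by (simp add: g_def L_def qmap_add)

lemma g_pow: "v \<in> vecs s \<Longrightarrow> g v [^]\<^bsub>L\<^esub> (n::nat) = g (\<lambda>i. int n * v i)"
  by (simp add: g_def L_def qmap_pow)

lemma dvd_pow_s: "i \<in> {1..s} \<Longrightarrow> int p ^ s dvd int p ^ lam i"
  using lam_ge by (rule le_imp_power_dvd)

lemma g_eq_one_iff:
  assumes "v \<in> vecs s"
  shows "g v = \<one>\<^bsub>L\<^esub> \<longleftrightarrow> (\<forall>j\<in>{1..s}. int p ^ lam j dvd v j)"
proof
  assume "g v = \<one>\<^bsub>L\<^esub>"
  then obtain y where y: "\<forall>i. (0::int) = - (int p ^ lam i * y i)"
      "\<forall>j\<in>{1..s}. int p ^ lam j dvd v j - rowcomb s \<alpha> y j"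
    unfolding g_def L_def qmap_eq_one_iff[OF assms vecs_intros(1)] by blast
  then have "y i = 0" for i using p2 by auto
  then have "rowcomb s \<alpha> y j = 0" for j by (simp add: rowcomb_def)
  with y show "\<forall>j\<in>{1..s}. int p ^ lam j dvd v j" by simp
next
  assume "\<forall>j\<in>{1..s}. int p ^ lam j dvd v j"
  then show "g v = \<one>\<^bsub>L\<^esub>"
    unfolding g_def L_def qmap_eq_one_iff[OF assms vecs_intros(1)]
    by (intro bexI[of _ "\<lambda>i. 0"]) (auto simp: rowcomb_def)
qed

lemma g_eq_iff:
  assumes "v \<in> vecs s" "w \<in> vecs s"
  shows "g v = g w \<longleftrightarrow> (\<forall>j\<in>{1..s}. int p ^ lam j dvd v j - w j)"
proof -
  have "g v = g w \<longleftrightarrow> g (\<lambda>i. v i - w i) = \<one>\<^bsub>L\<^esub>"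
    unfolding g_def L_def qmap_eq_iff[OF assms(1) vecs_intros(1) assms(2) vecs_intros(1)] by simp
  then show ?thesis using assms by (simp add: g_eq_one_iff)
qed

definition unit :: "nat \<Rightarrow> nat \<Rightarrow> int" where "unit i = (\<lambda>j. if j = i then 1 else 0)"

definition row :: "nat \<Rightarrow> nat \<Rightarrow> int" where "row i = (\<lambda>j. if j \<in> {1..s} then \<alpha> i j else 0)"

text \<open>Together with \<open>G\<close> the elements \<open>e i\<close> generate
  \<open>L\<close>. Each \<open>e i\<close> is a p^\<open>lam i\<close>-th root of the
  \<open>i\<close>-th row of \<alpha>, which is how the rows enter the arguments about
  endomorphisms.\<close>

definition e :: "nat \<Rightarrow> ((nat \<Rightarrow> int) set \<times> (nat \<Rightarrow> int)) set" where
  "e i = qmap p s lam \<alpha> (\<lambda>j. 0) (unit i)"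

lemma unit_vecs [simp]: "i \<in> {1..s} \<Longrightarrow> unit i \<in> vecs s"
  by (auto simp: unit_def vecs_def)

lemma row_vecs [simp]: "row i \<in> vecs s"
  by (auto simp: row_def vecs_def)

lemma e_closed [simp]: "i \<in> {1..s} \<Longrightarrow> e i \<in> carrier L"
  by (simp add: e_def L_def)

lemma rowcomb_unit: "i \<in> {1..s} \<Longrightarrow> rowcomb s M (unit i) = (\<lambda>j. if j \<in> {1..s} then M i j else 0)"
  by (auto simp: rowcomb_def unit_def fun_eq_iff if_distrib[of "\<lambda>x. x * _"] cong: if_cong)

lemma e_pow:
  assumes i: "i \<in> {1..s}"
  shows "e i [^]\<^bsub>L\<^esub> (p ^ lam i :: nat) = g (row i)"
proof -
  have "qmap p s lam \<alpha> (\<lambda>j. 0 - row i j) (\<lambda>j. int (p ^ lam i) * unit i j - 0) = \<one>\<^bsub>L\<^esub>"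
    unfolding L_def
  proof (subst qmap_eq_one_iff)
    show "\<exists>y\<in>vecs s. (\<forall>j. int (p ^ lam i) * unit i j - 0 = - (int p ^ lam j * y j)) \<and>
        (\<forall>j\<in>{1..s}. int p ^ lam j dvd 0 - row i j - rowcomb s \<alpha> y j)"
    \<comment> \<open>The witness is negated because the second component of the defining relation
      is.\<close>
    proof (intro bexI[of _ "\<lambda>j. - unit i j"] conjI allI ballI)
      show "int (p ^ lam i) * unit i j - 0 = - (int p ^ lam j * - unit i j)" for j
        by (simp add: unit_def)
      show "int p ^ lam j dvd 0 - row i j - rowcomb s \<alpha> (\<lambda>j. - unit i j) j" for j
        using i by (simp add: rowcomb_minus rowcomb_unit row_def)
    qed (use i in simp)
  qed (use i in auto)
  then have "qmap p s lam \<alpha> (\<lambda>j. 0) (\<lambda>j. int (p ^ lam i) * unit i j) = qmap p s lam \<alpha> (row i) (\<lambda>j. 0)"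
    unfolding L_def by (subst qmap_eq_iff) (use i in auto)
  then show ?thesis unfolding e_def g_def L_def
    by (subst qmap_pow) (use i in auto)
qed

text \<open>In the relation that witnesses the equation, the coefficient of row \<open>i\<close> for
  i > m is, up to sign, a multiple of p^(\<open>lam m\<close> - \<open>lam i\<close>), hence of p^s
  by the gaps; so only the first \<open>m\<close> rows survive. The part of \<open>x\<close> coming
  from \<open>G\<close> is multiplied by p^\<open>lam m\<close> and vanishes modulo p^s as
  well.\<close>

lemma pow_in_G:
  assumes x: "x \<in> carrier L" and w: "w \<in> vecs s" and m: "m \<in> {1..s}"
    and eq: "x [^]\<^bsub>L\<^esub> (p ^ lam m :: nat) = g w"
  shows "\<exists>y. \<forall>j\<in>{1..s}. int p ^ s dvd w j - (\<Sum>i=1..m. y i * \<alpha> i j)"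
proof -
  obtain v u where vu: "v \<in> vecs s" "u \<in> vecs s" "x = qmap p s lam \<alpha> v u"
    using qmap_surj x unfolding L_def by blast
  have "qmap p s lam \<alpha> (\<lambda>i. int (p ^ lam m) * v i - w i) (\<lambda>i. int (p ^ lam m) * u i - 0) = \<one>\<^bsub>L_alpha p s lam \<alpha>\<^esub>"
    using eq unfolding vu(3) L_def qmap_pow[OF vu(1,2)] g_def
    by (subst qmap_eq_iff[symmetric]) (use vu w in auto)
  then have "\<exists>y\<in>vecs s. (\<forall>i. int (p ^ lam m) * u i - 0 = - (int p ^ lam i * y i)) \<and>
      (\<forall>j\<in>{1..s}. int p ^ lam j dvd int (p ^ lam m) * v j - w j - rowcomb s \<alpha> y j)"
    by (rule qmap_eq_one_iff[THEN iffD1, rotated 2]) (use vu(1,2) w in auto)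
  then obtain y where y: "\<And>i. int (p ^ lam m) * u i - 0 = - (int p ^ lam i * y i)"
      "\<And>j. j \<in> {1..s} \<Longrightarrow> int p ^ lam j dvd int (p ^ lam m) * v j - w j - rowcomb s \<alpha> y j"
    by blast
  have high: "int p ^ s dvd y i" if i: "i \<in> {m<..s}" for i
  proof -
    have gap: "lam i + s \<le> lam m" using lam_gap[of m i] m i by auto
    then have "int p ^ lam m = int p ^ lam i * int p ^ (lam m - lam i)" by (simp flip: power_add)
    then have "int p ^ lam i * (int p ^ (lam m - lam i) * u i) = int p ^ lam i * (- y i)"
      using y(1)[of i] by simp
    then have "int p ^ (lam m - lam i) * u i = - y i" using p2 by (subst (asm) mult_left_cancel) auto
    then have "int p ^ (lam m - lam i) dvd y i" by (metis dvd_minus_iff dvd_triv_left)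
    then show ?thesis using le_imp_power_dvd[of s "lam m - lam i" "int p"] gap by (auto intro: dvd_trans)
  qed
  have "int p ^ s dvd w j - (\<Sum>i=1..m. (- y i) * \<alpha> i j)" if j: "j \<in> {1..s}" for j
  proof -
    have a: "int p ^ s dvd int (p ^ lam m) * v j - w j - rowcomb s \<alpha> y j"
      using y(2)[OF j] dvd_pow_s[OF j] by (rule dvd_trans[rotated])
    have b: "int p ^ s dvd int (p ^ lam m) * v j" using dvd_pow_s[OF m] by simp
    have r: "rowcomb s \<alpha> y j = (\<Sum>i=1..m. y i * \<alpha> i j) + (\<Sum>i\<in>{m<..s}. y i * \<alpha> i j)"
    proof -
      have "{1..s} = {1..m} \<union> {m<..s}" using m by auto
      then show ?thesis using j by (simp add: rowcomb_def) (subst sum.union_disjoint, auto)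
    qed
    have c: "int p ^ s dvd (\<Sum>i\<in>{m<..s}. y i * \<alpha> i j)" using high by (intro dvd_sum) auto
    have eq: "w j - (\<Sum>i=1..m. (- y i) * \<alpha> i j) =
        (int (p ^ lam m) * v j - (int (p ^ lam m) * v j - w j - rowcomb s \<alpha> y j)) - (\<Sum>i\<in>{m<..s}. y i * \<alpha> i j)"
      unfolding r by (simp add: sum_negf)
    show ?thesis by (subst eq) (rule dvd_diff[OF dvd_diff[OF b a] c])
  qed
  then show ?thesis by (intro exI[of _ "\<lambda>i. - y i"] ballI)
qed

text \<open>The set \<open>S\<close> of vectors satisfying the formula contains the unit vectors and
  is closed under sums and differences. Row \<open>j\<close> of \<open>P\<close> is the image of the
  \<open>j\<close>-th unit vector, so \<open>P\<close> acts on row vectors from the right.\<close>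

lemma hom_matrix:
  assumes f: "f \<in> hom L L" and P: "\<And>j. j \<in> {1..s} \<Longrightarrow> f (g (unit j)) = g (\<lambda>k. if k \<in> {1..s} then P j k else 0)"
    and v: "v \<in> vecs s"
  shows "f (g v) = g (rowcomb s P v)"
proof -
  define S where "S = {v \<in> vecs s. f (g v) = g (rowcomb s P v)}"
  have fc: "f x \<in> carrier L" if "x \<in> carrier L" for x using f that by (auto simp: hom_def)
  have add: "(\<lambda>i. v i + w i) \<in> S" if "v \<in> S" "w \<in> S" for v w
  proof -
    have "f (g (\<lambda>i. v i + w i)) = f (g v) \<otimes>\<^bsub>L\<^esub> f (g w)"
      using that hom_mult[OF f, of "g v" "g w"] by (simp add: S_def g_add)
    with that show ?thesis by (simp add: S_def g_add rowcomb_add)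
  qed
  have diff: "(\<lambda>i. v i - w i) \<in> S" if "v \<in> S" "w \<in> S" for v w
  proof -
    have vw: "v \<in> vecs s" "w \<in> vecs s" "(\<lambda>i. v i - w i) \<in> vecs s" using that by (auto simp: S_def)
    have "f (g (\<lambda>i. v i - w i)) \<otimes>\<^bsub>L\<^esub> f (g w) = f (g v)"
      using vw hom_mult[OF f, of "g (\<lambda>i. v i - w i)" "g w"] by (simp add: g_add)
    also have "\<dots> = g (rowcomb s P v)" using that by (simp add: S_def)
    also have "\<dots> = g (rowcomb s P (\<lambda>i. v i - w i)) \<otimes>\<^bsub>L\<^esub> g (rowcomb s P w)"
      by (simp add: g_add rowcomb_add[symmetric])
    also have "g (rowcomb s P w) = f (g w)" using that by (simp add: S_def)
    finally show ?thesis using vw fc by (simp add: S_def)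
  qed
  have unit: "unit j \<in> S" if "j \<in> {1..s}" for j
    using P[OF that] that by (simp add: S_def rowcomb_unit)
  have zero: "(\<lambda>i. 0) \<in> S" using diff[OF unit unit, of 1 1] s by simp
  have mult: "(\<lambda>i. c * unit j i) \<in> S" if j: "j \<in> {1..s}" for c j
  proof (induction c rule: int_induct[where k = 0])
    case base then show ?case using zero by simp
  next
    case (step1 c) then show ?case using add[OF step1(2) unit[OF j]] by (simp add: algebra_simps)
  next
    case (step2 c) then show ?case using diff[OF step2(2) unit[OF j]] by (simp add: algebra_simps)
  qed
  have "(\<lambda>i. if i \<le> m then v i else 0) \<in> S" if "m \<le> s" for m
    using that
  proof (induction m)
    case 0
    have "(\<lambda>i. if i \<le> 0 then v i else 0) = (\<lambda>i. 0)" using v by (auto simp: vecs_def)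
    then show ?case using zero by simp
  next
    case (Suc m)
    have "(\<lambda>i. if i \<le> Suc m then v i else 0) = (\<lambda>i. (if i \<le> m then v i else 0) + v (Suc m) * unit (Suc m) i)"
      by (auto simp: unit_def fun_eq_iff le_Suc_eq)
    then show ?case using add[OF Suc.IH mult[of "Suc m" "v (Suc m)"]] Suc.prems by simp
  qed
  moreover have "(\<lambda>i. if i \<le> s then v i else 0) = v" using v by (auto simp: vecs_def fun_eq_iff)
  ultimately show ?thesis by (force simp: S_def)
qed


lemma hom_matrixE:
  assumes f: "f \<in> hom L L" and fG: "f ` G \<subseteq> G"
  obtains P where "\<And>j. j \<in> {1..s} \<Longrightarrow> P j \<in> vecs s"
    "\<And>j. j \<in> {1..s} \<Longrightarrow> f (g (unit j)) = g (P j)"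
    "\<And>v. v \<in> vecs s \<Longrightarrow> f (g v) = g (rowcomb s P v)"
proof -
  have "\<exists>v\<in>vecs s. f (g (unit j)) = g v" if "j \<in> {1..s}" for j
    using fG unit_vecs[OF that] unfolding G_eq by auto
  then obtain P where P: "\<And>j. j \<in> {1..s} \<Longrightarrow> P j \<in> vecs s"
      "\<And>j. j \<in> {1..s} \<Longrightarrow> f (g (unit j)) = g (P j)" by metis
  have "f (g v) = g (rowcomb s P v)" if "v \<in> vecs s" for v
  proof (rule hom_matrix[OF f _ that])
    fix j assume j: "j \<in> {1..s}"
    then have "P j = (\<lambda>k. if k \<in> {1..s} then P j k else 0)" using P(1) by (auto simp: vecs_def fun_eq_iff)
    then show "f (g (unit j)) = g (\<lambda>k. if k \<in> {1..s} then P j k else 0)" using P(2)[OF j] by simp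
  qed
  with P show thesis by (rule that)
qed

lemma row1_not_one: "\<not> int p ^ lam s dvd row 1 s"
proof -
  have "row 1 s = 1" using s by (simp add: row_def alpha_ex_def)
  moreover have "int p dvd int p ^ lam s" using lam_ge[of s] s by (intro dvd_power) auto
  then have "\<not> int p ^ lam s dvd 1" using p2 by (auto dest: dvd_trans)
  ultimately show ?thesis by simp
qed

text \<open>The first row of \<open>\<alpha>\<close>, which spans \<open>p ^ lam 1 L\<close> modulo \<open>p ^ s G\<close>, is an eigenvector of every
  endomorphism preserving \<open>G\<close>; here its eigenvalue is zero.\<close>

lemma idempotent_vanishes:
  assumes f: "f \<in> hom L L" and fG: "f ` G \<subseteq> G" and idem: "\<And>x. x \<in> carrier L \<Longrightarrow> f (f x) = f x"
    and w: "w \<in> vecs s" "f (g (row 1)) = g w" "\<And>j. j \<in> {1..s} \<Longrightarrow> int p ^ s dvd w j"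
    and x: "x \<in> G"
  shows "f x = \<one>\<^bsub>L\<^esub>"
proof -
  obtain P where P: "\<And>j. j \<in> {1..s} \<Longrightarrow> P j \<in> vecs s"
      "\<And>j. j \<in> {1..s} \<Longrightarrow> f (g (unit j)) = g (P j)"
    and fv: "\<And>v. v \<in> vecs s \<Longrightarrow> f (g v) = g (rowcomb s P v)"
    by (rule hom_matrixE[OF f fG]) blast
  have f1: "f \<one>\<^bsub>L\<^esub> = \<one>\<^bsub>L\<^esub>" using hom_one[OF f] L.is_group by simp
  \<comment> \<open>The power p^\<open>lam j\<close> kills \<open>g (unit j)\<close> and therefore
    its image; for k < j the larger modulus of column \<open>k\<close> forces a factor
    p^(\<open>lam k\<close> - \<open>lam j\<close>) into \<open>P j k\<close>.\<close>
  have low: "int p ^ s dvd P j k" if jk: "j \<in> {1..s}" "k \<in> {1..s}" "k < j" for j k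
  proof -
    let ?v = "\<lambda>i. int (p ^ lam j) * unit j i"
    have "g ?v = \<one>\<^bsub>L\<^esub>"
      using jk by (subst g_eq_one_iff) (auto simp: unit_def vecs_def)
    then have "g (rowcomb s P ?v) = \<one>\<^bsub>L\<^esub>" using fv[of ?v] f1 jk by simp
    then have "int p ^ lam k dvd int p ^ lam j * P j k"
      using g_eq_one_iff[of "rowcomb s P ?v"] jk by (auto simp: rowcomb_scale rowcomb_unit)
    moreover have gap: "lam j + s \<le> lam k" using lam_gap[OF jk(2,1,3)] .
    then have "int p ^ lam k = int p ^ lam j * int p ^ (lam k - lam j)" by (simp flip: power_add)
    ultimately have "int p ^ (lam k - lam j) dvd P j k" using p2 by simp
    then show ?thesis using le_imp_power_dvd[of s "lam k - lam j" "int p"] gap by (auto intro: dvd_trans)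
  qed
  have row1: "int p ^ s dvd (\<Sum>k=1..s. \<alpha> 1 k * P k j)" if j: "j \<in> {1..s}" for j
  proof -
    have "g (rowcomb s P (row 1)) = g w" using fv w by simp
    then have "int p ^ lam j dvd rowcomb s P (row 1) j - w j" using j w by (simp add: g_eq_iff)
    then have "int p ^ s dvd rowcomb s P (row 1) j - w j" using dvd_pow_s[OF j] by (rule dvd_trans[rotated])
    then have "int p ^ s dvd rowcomb s P (row 1) j" using w(3)[OF j] by (simp add: dvd_diff_left_iff)
    then show ?thesis using j by (simp add: rowcomb_def row_def)
  qed
  \<comment> \<open>The image of row 2 has the p^\<open>lam 2\<close>-th root
    \<open>f (e 2)\<close>, so it lies in the span of the first two rows modulo p^s.\<close>
  obtain y z where row2: "\<And>j. j \<in> {1..s} \<Longrightarrow> int p ^ s dvd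
      (\<Sum>k=1..s. \<alpha> 2 k * P k j) - (y * \<alpha> 1 j + z * \<alpha> 2 j)"
  proof -
    have "f (e 2) [^]\<^bsub>L\<^esub> (p ^ lam 2 :: nat) = f (e 2 [^]\<^bsub>L\<^esub> (p ^ lam 2 :: nat))"
      using group_hom.hom_nat_pow[of L L f "e 2"] f L.is_group s by (auto simp: group_hom_def group_hom_axioms_def)
    also have "\<dots> = g (rowcomb s P (row 2))" using s by (simp add: e_pow fv)
    finally have "\<exists>t. \<forall>j\<in>{1..s}. int p ^ s dvd rowcomb s P (row 2) j - (\<Sum>i=1..2. t i * \<alpha> i j)"
      by (rule pow_in_G[rotated 3]) (use f s in \<open>auto intro: hom_in_carrier\<close>)
    then obtain t where t: "\<And>j. j \<in> {1..s} \<Longrightarrow>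
        int p ^ s dvd rowcomb s P (row 2) j - (\<Sum>i=1..2. t i * \<alpha> i j)" by blast
    show thesis
      by (rule that[of "t 1" "t 2"]) (use t in \<open>auto simp: rowcomb_def row_def numeral_2_eq_2\<close>)
  qed
  have P0: "int p ^ lam k dvd P j k" if jk: "j \<in> {1..s}" "k \<in> {1..s}" for j k
  proof (rule idempotent_matrix_vanishes[where s = s and P = P])
    fix j k assume jk: "j \<in> {1..s}" "k \<in> {1..s}"
    show "int p dvd P j k" if "k < j" using low[OF jk that] s by (meson dvd_power dvd_trans less_le_trans zero_less_numeral)
    have "g (rowcomb s P (P j)) = g (P j)"
      using idem[of "g (unit j)"] P jk fv by simp
    then have "int p ^ lam k dvd rowcomb s P (P j) k - P j k"
      using jk P by (simp add: g_eq_iff)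
    then show "int p ^ lam k dvd (\<Sum>m=1..s. P j m * P m k) - P j k"
      using jk by (simp add: rowcomb_def)
  next
    fix j assume "j \<in> {1..s}"
    then show "int p dvd P j j"
      using p2 by (intro alpha_ex_dvd_diag[OF _ s low row1 row2]) auto
  next
    fix k assume "k \<in> {1..s}"
    then show "1 \<le> lam k" using lam_ge[of k] s by simp
  qed (use jk in auto)
  obtain v where v: "v \<in> vecs s" "x = g v" using x G_eq by auto
  have "g (rowcomb s P v) = \<one>\<^bsub>L\<^esub>"
    by (intro g_eq_one_iff[OF rowcomb_vecs, THEN iffD2] ballI) (auto simp: rowcomb_def intro!: dvd_sum dvd_mult P0)
  then show ?thesis using fv v by simp
qed

text \<open>The eigenvalue y of \<open>f\<close> on the first row satisfies y(y - 1) = 0 modulo p^s.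
  As \<open>p\<close> cannot divide both factors, y is 0 or 1 modulo p^s, and the eigenvalue of
  \<open>h\<close> is 1 - y. The map with eigenvalue 0 is the one that vanishes on
  \<open>G\<close>.\<close>

lemma complementary_idempotents:
  assumes f: "f \<in> hom L L" "f ` G \<subseteq> G" "\<And>x. x \<in> carrier L \<Longrightarrow> f (f x) = f x"
    and h: "h \<in> hom L L" "h ` G \<subseteq> G" "\<And>x. x \<in> carrier L \<Longrightarrow> h (h x) = h x"
    and fh: "\<And>x. x \<in> carrier L \<Longrightarrow> f x \<otimes>\<^bsub>L\<^esub> h x = x"
  shows "(\<forall>x\<in>G. f x = \<one>\<^bsub>L\<^esub>) \<or> (\<forall>x\<in>G. h x = \<one>\<^bsub>L\<^esub>)"
proof -
  have eig: "\<exists>y w. w \<in> vecs s \<and> f (g (row 1)) = g w \<and> (\<forall>j\<in>{1..s}. int p ^ s dvd w j - y * \<alpha> 1 j)"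
    if f: "f \<in> hom L L" "f ` G \<subseteq> G" for f
  proof -
    have "g (row 1) \<in> G" by (simp add: G_eq)
    then have "f (g (row 1)) \<in> G" using f(2) by (rule subsetD[rotated, OF imageI])
    then obtain w where w: "w \<in> vecs s" "f (g (row 1)) = g w" by (auto simp: G_eq)
    have "f (e 1) [^]\<^bsub>L\<^esub> (p ^ lam 1 :: nat) = f (e 1 [^]\<^bsub>L\<^esub> (p ^ lam 1 :: nat))"
      using group_hom.hom_nat_pow[of L L f "e 1"] f(1) L.is_group s by (auto simp: group_hom_def group_hom_axioms_def)
    also have "\<dots> = g w" using s w by (simp add: e_pow)
    finally have "\<exists>t. \<forall>j\<in>{1..s}. int p ^ s dvd w j - (\<Sum>i=1..1. t i * \<alpha> i j)"
      by (rule pow_in_G[rotated 3]) (use f(1) s w in \<open>auto intro: hom_in_carrier\<close>)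
    then obtain t where "\<forall>j\<in>{1..s}. int p ^ s dvd w j - (\<Sum>i=1..1. t i * \<alpha> i j)" by blast
    with w show ?thesis by (intro exI[of _ "t 1"] exI[of _ w]) auto
  qed
  obtain y w where w: "w \<in> vecs s" "f (g (row 1)) = g w" "\<And>j. j \<in> {1..s} \<Longrightarrow> int p ^ s dvd w j - y * \<alpha> 1 j"
    using eig[OF f(1,2)] by blast
  obtain y' w' where w': "w' \<in> vecs s" "h (g (row 1)) = g w'" "\<And>j. j \<in> {1..s} \<Longrightarrow> int p ^ s dvd w' j - y' * \<alpha> 1 j"
    using eig[OF h(1,2)] by blast
  have fw: "f (g w) = g w" using f(3)[of "g (row 1)"] w by simp
  \<comment> \<open>The first row ends in 1, so the last coordinate of a multiple of it reads off
    the factor.\<close>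
  have as: "\<alpha> 1 s = 1" using s by (simp add: alpha_ex_def)
  have sum: "int p ^ s dvd w j + w' j - \<alpha> 1 j" if j: "j \<in> {1..s}" for j
  proof -
    have "g (\<lambda>i. w i + w' i) = g (row 1)"
      using fh[of "g (row 1)"] w w' by (simp add: g_add)
    then have "int p ^ lam j dvd w j + w' j - row 1 j" using j w w' by (simp add: g_eq_iff)
    then show ?thesis using dvd_pow_s[OF j] j by (auto simp: row_def intro: dvd_trans)
  qed
  obtain P where fv: "\<And>v. v \<in> vecs s \<Longrightarrow> f (g v) = g (rowcomb s P v)"
    using hom_matrixE[OF f(1,2)] by metis
  have s1: "s \<in> {1..s}" using s by simp
  have cong: "int p ^ s dvd a s - b s" if "a \<in> vecs s" "b \<in> vecs s" "g a = g b" for a b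
    using that s1 dvd_pow_s[OF s1] by (auto simp: g_eq_iff intro: dvd_trans)
  have "int p ^ s dvd y * (y - 1)"
  proof -
    have "int p ^ s dvd rowcomb s P (\<lambda>j. w j - y * row 1 j) s"
      using w(3) s1 by (auto simp: rowcomb_def row_def intro!: dvd_sum dvd_mult2)
    moreover have "rowcomb s P (\<lambda>j. w j - y * row 1 j) s = rowcomb s P w s - y * rowcomb s P (row 1) s"
      using s by (simp add: rowcomb_def sum_subtractf sum_distrib_left algebra_simps)
    ultimately have d1: "int p ^ s dvd rowcomb s P w s - y * rowcomb s P (row 1) s" by simp
    have d2: "int p ^ s dvd rowcomb s P w s - w s"
      by (rule cong[OF rowcomb_vecs w(1)]) (simp add: fv[OF w(1), symmetric] fw)
    have d3: "int p ^ s dvd rowcomb s P (row 1) s - w s"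
      by (rule cong[OF rowcomb_vecs w(1)]) (rule trans[OF fv[OF row_vecs, symmetric] w(2)])
    have d4: "int p ^ s dvd w s - y" using w(3)[OF s1] as by simp
    \<comment> \<open>The map \<open>f\<close> sends the first row to \<open>w\<close> and fixes
      \<open>w\<close>. Since \<open>w\<close> is y times the first row modulo p^s, the last
      coordinate yields y = y^2; the identity assembles this from \<open>d1\<close> to
      \<open>d4\<close>.\<close>
    have eq: "y * (y - 1) = (rowcomb s P w s - w s) - (rowcomb s P w s - y * rowcomb s P (row 1) s)
        - y * (rowcomb s P (row 1) s - w s) - y * (w s - y) + (w s - y)"
      by (simp add: algebra_simps)
    show ?thesis unfolding eq by (intro d1 d2 d3 d4 dvd_add dvd_diff dvd_mult)
  qed
  moreover have "int p ^ s dvd y \<or> int p ^ s dvd y - 1" if "int p ^ s dvd y * (y - 1)"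
  proof (cases "int p dvd y")
    case True
    have "\<not> int p dvd y - 1"
      using dvd_diff[OF True, of "y - 1"] p2 by auto
    then have "coprime (int p ^ s) (y - 1)" using p by (intro coprime_power_left_iff[THEN iffD2] disjI1) (simp add: prime_imp_coprime)
    with that show ?thesis by (simp add: coprime_dvd_mult_left_iff)
  next
    case False
    then have "coprime (int p ^ s) y" using p by (intro coprime_power_left_iff[THEN iffD2] disjI1) (simp add: prime_imp_coprime)
    with that show ?thesis by (simp add: coprime_dvd_mult_right_iff)
  qed
  ultimately consider "int p ^ s dvd y" | "int p ^ s dvd y - 1" by blast
  then show ?thesis
  proof cases
    case 1
    have "int p ^ s dvd w j" if "j \<in> {1..s}" for j
    proof -
      have "int p ^ s dvd (w j - y * \<alpha> 1 j) + y * \<alpha> 1 j" using w(3)[OF that] 1 by (intro dvd_add) auto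
      then show ?thesis by simp
    qed
    then show ?thesis using idempotent_vanishes[OF f w(1,2)] by blast
  next
    case 2
    have "int p ^ s dvd y'"
    proof -
      have "int p ^ s dvd (w s + w' s - \<alpha> 1 s) - (w s - y * \<alpha> 1 s) - (w' s - y' * \<alpha> 1 s) - (y - 1)"
        by (intro sum[OF s1] w(3)[OF s1] w'(3)[OF s1] 2 dvd_diff)
      then show ?thesis unfolding as by simp
    qed
    have "int p ^ s dvd w' j" if "j \<in> {1..s}" for j
    proof -
      have "int p ^ s dvd (w' j - y' * \<alpha> 1 j) + y' * \<alpha> 1 j"
        using w'(3)[OF that] \<open>int p ^ s dvd y'\<close> by (intro dvd_add) auto
      then show ?thesis by simp
    qed
    then show ?thesis using idempotent_vanishes[OF h w'(1,2)] by blast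
  qed
qed

text \<open>The first row has the p^\<open>lam 1\<close>-th root \<open>e 1\<close> in
  \<open>L\<close>. A retraction onto \<open>G\<close> would carry this root into \<open>G\<close>,
  where p^\<open>lam 1\<close> kills everything since \<open>lam 1\<close> is the largest exponent;
  but the last entry 1 of the row makes it nontrivial.\<close>

lemma no_complement:
  assumes f: "f \<in> hom L L" and im: "f ` carrier L \<subseteq> G" and id: "\<And>x. x \<in> G \<Longrightarrow> f x = x"
  shows False
proof -
  have s1: "1 \<in> {1..s}" using s by simp
  have "f (e 1) \<in> G" using im by (rule subsetD) (rule imageI, rule e_closed[OF s1])
  then obtain v where v: "v \<in> vecs s" "f (e 1) = g v" by (auto simp: G_eq)
  have "g (row 1) = f (g (row 1))" using id[of "g (row 1)"] unfolding G_eq by simp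
  also have "\<dots> = f (e 1 [^]\<^bsub>L\<^esub> (p ^ lam 1 :: nat))" using e_pow[OF s1] by simp
  also have "\<dots> = f (e 1) [^]\<^bsub>L\<^esub> (p ^ lam 1 :: nat)"
    using group_hom.hom_nat_pow[of L L f "e 1"] f L.is_group s by (auto simp: group_hom_def group_hom_axioms_def)
  also have "\<dots> = g (\<lambda>i. int (p ^ lam 1) * v i)" unfolding v(2) by (rule g_pow[OF v(1)])
  also have "\<dots> = \<one>\<^bsub>L\<^esub>"
    using v lam_le by (auto simp: g_eq_one_iff intro!: dvd_mult2 le_imp_power_dvd)
  finally show False using row1_not_one s by (simp add: g_eq_one_iff)
qed

end

section \<open>Restricted products\<close>

locale restricted_product =
  fixes LL :: "nat \<Rightarrow> Lelem monoid" and GG :: "nat \<Rightarrow> Lelem set"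
  assumes LL: "odd_prime p \<Longrightarrow> comm_group (LL p)"
    and fin: "odd_prime p \<Longrightarrow> finite (carrier (LL p))"
    and GG: "odd_prime p \<Longrightarrow> subgroup (GG p) (LL p)"
begin

abbreviation "R \<equiv> resprod LL GG"
abbreviation "T \<equiv> resprod_top LL GG"

definition bad :: "(nat \<Rightarrow> Lelem) \<Rightarrow> nat set" where
  "bad x = {p. odd_prime p \<and> x p \<notin> GG p}"

definition prime_set :: "nat set \<Rightarrow> bool" where
  "prime_set F \<longleftrightarrow> finite F \<and> (\<forall>p\<in>F. odd_prime p)"

lemma LL_group: "odd_prime p \<Longrightarrow> group (LL p)"
  using LL by (rule comm_group.axioms(2))

lemma GG_subset: "odd_prime p \<Longrightarrow> z \<in> GG p \<Longrightarrow> z \<in> carrier (LL p)"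
  using subgroup.subset[OF GG] by blast

lemma R_carrier: "x \<in> carrier R \<longleftrightarrow> (\<forall>p. odd_prime p \<longrightarrow> x p \<in> carrier (LL p)) \<and>
    (\<forall>p. \<not> odd_prime p \<longrightarrow> x p = undefined) \<and> finite (bad x)"
  by (simp add: resprod_def bad_def)

lemma R_comp: "x \<in> carrier R \<Longrightarrow> odd_prime p \<Longrightarrow> x p \<in> carrier (LL p)"
  by (simp add: R_carrier)

lemma prime_set_bad: "x \<in> carrier R \<Longrightarrow> prime_set (bad x)"
  by (simp add: R_carrier prime_set_def bad_def)

lemma R_mult: "(x \<otimes>\<^bsub>R\<^esub> y) p = (if odd_prime p then x p \<otimes>\<^bsub>LL p\<^esub> y p else undefined)"
  by (simp add: resprod_def)

lemma R_one: "\<one>\<^bsub>R\<^esub> p = (if odd_prime p then \<one>\<^bsub>LL p\<^esub> else undefined)"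
  by (simp add: resprod_def)

lemma R_eqI:
  assumes "x \<in> carrier R" "y \<in> carrier R" "\<And>p. odd_prime p \<Longrightarrow> x p = y p"
  shows "x = y"
proof
  fix p show "x p = y p" using assms by (cases "odd_prime p") (auto simp: R_carrier)
qed

lemma comm_group_R: "comm_group R"
proof (rule comm_groupI)
  show one: "\<one>\<^bsub>R\<^esub> \<in> carrier R"
    using group.is_monoid[OF LL_group, THEN monoid.one_closed] subgroup.one_closed[OF GG]
    by (auto simp: R_carrier R_one bad_def)
  fix x assume x: "x \<in> carrier R"
  show "\<one>\<^bsub>R\<^esub> \<otimes>\<^bsub>R\<^esub> x = x"
    using x R_comp[OF x] group.is_monoid[OF LL_group, THEN monoid.l_one]
    by (auto simp: fun_eq_iff R_mult R_one R_carrier)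
  define x' where "x' p = (if odd_prime p then inv\<^bsub>LL p\<^esub> (x p) else undefined)" for p
  have "bad x' \<subseteq> bad x"
    using subgroup.m_inv_closed[OF GG] by (auto simp: bad_def x'_def)
  then have "x' \<in> carrier R"
    using x group.inv_closed[OF LL_group] by (auto simp: R_carrier x'_def dest: finite_subset)
  moreover have "x' \<otimes>\<^bsub>R\<^esub> x = \<one>\<^bsub>R\<^esub>"
    using R_comp[OF x] group.l_inv[OF LL_group] by (auto simp: fun_eq_iff R_mult R_one x'_def)
  ultimately show "\<exists>y\<in>carrier R. y \<otimes>\<^bsub>R\<^esub> x = \<one>\<^bsub>R\<^esub>" by blast
  fix y assume y: "y \<in> carrier R"
  have "bad (x \<otimes>\<^bsub>R\<^esub> y) \<subseteq> bad x \<union> bad y"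
    using subgroup.m_closed[OF GG] by (auto simp: bad_def R_mult)
  then show "x \<otimes>\<^bsub>R\<^esub> y \<in> carrier R"
    using x y group.is_monoid[OF LL_group, THEN monoid.m_closed]
    by (auto simp: R_carrier R_mult dest: finite_subset)
  show "x \<otimes>\<^bsub>R\<^esub> y = y \<otimes>\<^bsub>R\<^esub> x"
    using R_comp[OF x] R_comp[OF y] comm_monoid.m_comm[OF comm_group.axioms(1)[OF LL]]
    by (auto simp: fun_eq_iff R_mult)
  fix z assume z: "z \<in> carrier R"
  show "x \<otimes>\<^bsub>R\<^esub> y \<otimes>\<^bsub>R\<^esub> z = x \<otimes>\<^bsub>R\<^esub> (y \<otimes>\<^bsub>R\<^esub> z)"
    using R_comp[OF x] R_comp[OF y] R_comp[OF z] group.is_monoid[OF LL_group, THEN monoid.m_assoc]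
    by (auto simp: fun_eq_iff R_mult)
qed

sublocale R: comm_group R by (rule comm_group_R)

lemma R_pow:
  assumes "odd_prime p"
  shows "(x [^]\<^bsub>R\<^esub> (n::nat)) p = x p [^]\<^bsub>LL p\<^esub> n"
proof (induction n)
  case 0 then show ?case using assms by (simp add: R_one nat_pow_def)
next
  case (Suc n) then show ?case using assms by (simp add: R_mult nat_pow_def)
qed

text \<open>When \<open>bad x\<close> is contained in \<open>F\<close>, this is the coset of
  \<open>x\<close> under the product of the G_p with p outside \<open>F\<close>; these cosets form a
  neighbourhood base.\<close>

definition nbhd :: "nat set \<Rightarrow> (nat \<Rightarrow> Lelem) \<Rightarrow> (nat \<Rightarrow> Lelem) set" where
  "nbhd F x = {y \<in> carrier R. (\<forall>p\<in>F. y p = x p) \<and> (\<forall>p. odd_prime p \<longrightarrow> p \<notin> F \<longrightarrow> y p \<in> GG p)}"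

lemma nbhd_mono: "bad x \<subseteq> F \<Longrightarrow> F \<subseteq> F' \<Longrightarrow> nbhd F' x \<subseteq> nbhd F x"
  unfolding nbhd_def bad_def by (smt (verit, best) Collect_mono mem_Collect_eq subset_eq)

lemma nbhd_self: "x \<in> carrier R \<Longrightarrow> bad x \<subseteq> F \<Longrightarrow> x \<in> nbhd F x"
  by (auto simp: nbhd_def bad_def)

lemma nbhd_trans: "y \<in> nbhd F x \<Longrightarrow> bad y \<subseteq> F \<and> nbhd F y = nbhd F x"
  by (auto simp: nbhd_def bad_def)

lemma openin_nbhd_gen:
  assumes F: "prime_set F" and x: "x \<in> carrier R"
  shows "openin T (nbhd F x)"
proof -
  define U where "U p = (if p \<in> F then {x p} else GG p)" for p
  have "nbhd F x = {y \<in> carrier R. \<forall>p. odd_prime p \<longrightarrow> y p \<in> U p}"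
    using F by (auto simp: nbhd_def U_def prime_set_def)
  moreover have "\<forall>p. odd_prime p \<longrightarrow> U p \<subseteq> carrier (LL p)"
    using R_comp[OF x] GG_subset by (auto simp: U_def)
  moreover have "finite {p. odd_prime p \<and> U p \<noteq> GG p}"
    by (rule finite_subset[of _ F]) (use F in \<open>auto simp: U_def prime_set_def\<close>)
  ultimately show ?thesis unfolding resprod_top_def by (intro topology_generated_by_Basis) blast
qed

text \<open>Cosets shrink when \<open>F\<close> grows, so the union of two sets \<open>F\<close>
  handles an intersection, and openness can be tested on the sets \<open>nbhd F x\<close>
  alone.\<close>

lemma openin_resprod_iff:
  "openin T W \<longleftrightarrow> W \<subseteq> carrier R \<and> (\<forall>x\<in>W. \<exists>F. prime_set F \<and> bad x \<subseteq> F \<and> nbhd F x \<subseteq> W)"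
proof
  assume "openin T W"
  then have "generate_topology_on {{x \<in> carrier R. \<forall>p. odd_prime p \<longrightarrow> x p \<in> U p} | U.
        (\<forall>p. odd_prime p \<longrightarrow> U p \<subseteq> carrier (LL p))
        \<and> finite {p. odd_prime p \<and> U p \<noteq> GG p}} W"
    unfolding resprod_top_def openin_topology_generated_by_iff .
  then show "W \<subseteq> carrier R \<and> (\<forall>x\<in>W. \<exists>F. prime_set F \<and> bad x \<subseteq> F \<and> nbhd F x \<subseteq> W)"
  proof induction
    case (Int a b)
    have "\<exists>F. prime_set F \<and> bad x \<subseteq> F \<and> nbhd F x \<subseteq> a \<inter> b" if "x \<in> a \<inter> b" for x
    proof -
      obtain F1 where F1: "prime_set F1" "bad x \<subseteq> F1" "nbhd F1 x \<subseteq> a" using Int.IH(1) \<open>x \<in> a \<inter> b\<close> by blast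
      obtain F2 where F2: "prime_set F2" "bad x \<subseteq> F2" "nbhd F2 x \<subseteq> b" using Int.IH(2) \<open>x \<in> a \<inter> b\<close> by blast
      show ?thesis
        using F1 F2 nbhd_mono[of x F1 "F1 \<union> F2"] nbhd_mono[of x F2 "F1 \<union> F2"]
        by (intro exI[of _ "F1 \<union> F2"]) (auto simp: prime_set_def)
    qed
    then show ?case using Int.IH by blast
  next
    case (UN K)
    then show ?case by (meson Sup_least UnionE Union_upper subset_trans)
  next
    case (Basis W)
    then obtain U where U: "W = {x \<in> carrier R. \<forall>p. odd_prime p \<longrightarrow> x p \<in> U p}"
      "finite {p. odd_prime p \<and> U p \<noteq> GG p}" by blast
    let ?F = "{p. odd_prime p \<and> U p \<noteq> GG p}"
    have "prime_set ?F \<and> bad x \<subseteq> ?F \<and> nbhd ?F x \<subseteq> W" if "x \<in> W" for x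
      using that U by (auto simp: prime_set_def bad_def nbhd_def)
    then show ?case using U by blast
  qed simp
next
  assume W: "W \<subseteq> carrier R \<and> (\<forall>x\<in>W. \<exists>F. prime_set F \<and> bad x \<subseteq> F \<and> nbhd F x \<subseteq> W)"
  show "openin T W"
  proof (subst openin_subopen, intro ballI)
    fix x assume "x \<in> W"
    then obtain F where F: "prime_set F" "bad x \<subseteq> F" "nbhd F x \<subseteq> W" "x \<in> carrier R" using W by blast
    then show "\<exists>V. openin T V \<and> x \<in> V \<and> V \<subseteq> W"
      using openin_nbhd_gen nbhd_self by (intro exI[of _ "nbhd F x"]) auto
  qed
qed

lemma topspace_T [simp]: "topspace T = carrier R"
proof
  show "topspace T \<subseteq> carrier R" using openin_resprod_iff[of "topspace T"] by simp
  have "\<exists>F. prime_set F \<and> bad x \<subseteq> F \<and> nbhd F x \<subseteq> carrier R" if "x \<in> carrier R" for x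
    using prime_set_bad[OF that] by (intro exI[of _ "bad x"]) (auto simp: nbhd_def)
  then have "openin T (carrier R)" by (simp add: openin_resprod_iff)
  then show "carrier R \<subseteq> topspace T" by (rule openin_subset)
qed

text \<open>The open compact subgroup with factor L_p for p in \<open>F\<close> and G_p elsewhere,
  for \<open>F\<close> a finite set of odd primes. These subgroups exhaust the restricted
  product.\<close>

definition box :: "nat set \<Rightarrow> (nat \<Rightarrow> Lelem) set" where
  "box F = {y \<in> carrier R. \<forall>p. odd_prime p \<longrightarrow> p \<notin> F \<longrightarrow> y p \<in> GG p}"

lemma box_iff_bad: "y \<in> box F \<longleftrightarrow> y \<in> carrier R \<and> bad y \<subseteq> F"
  by (auto simp: box_def bad_def)

lemma openin_box: "prime_set F \<Longrightarrow> openin T (box F)"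
  unfolding openin_resprod_iff by (auto simp: box_def nbhd_def bad_def intro!: exI[of _ F])

text \<open>Tychonoff: as a set, \<open>box F\<close> is a full product of finite discrete spaces,
  and the identity from the product topology into the restricted product is continuous.\<close>

lemma compactin_box:
  assumes F: "prime_set F"
  shows "compactin T (box F)"
proof -
  define Y where "Y p = (if p \<in> F then carrier (LL p) else GG p)" for p
  define Q where "Q = product_topology (\<lambda>p. discrete_topology (Y p)) (Collect odd_prime)"
  have Ysub: "Y p \<subseteq> carrier (LL p)" if "odd_prime p" for p
    using that GG_subset by (auto simp: Y_def)
  have tQ: "topspace Q = PiE (Collect odd_prime) Y" by (simp add: Q_def)
  have eq: "PiE (Collect odd_prime) Y = box F"
  proof (intro equalityI subsetI)
    fix y assume y: "y \<in> PiE (Collect odd_prime) Y"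
    have yY: "y q \<in> Y q" if "odd_prime q" for q using y that by (auto simp: PiE_def)
    have "bad y \<subseteq> F"
    proof
      fix q assume "q \<in> bad y"
      then show "q \<in> F" using yY[of q] by (cases "q \<in> F") (auto simp: bad_def Y_def)
    qed
    then have "finite (bad y)" using F by (auto simp: prime_set_def dest: finite_subset)
    moreover have "y p = undefined" if "\<not> odd_prime p" for p using y that by (auto simp: PiE_def extensional_def)
    moreover have "y p \<in> carrier (LL p)" if "odd_prime p" for p using y Ysub[OF that] that by (auto simp: PiE_def)
    ultimately show "y \<in> box F" using \<open>bad y \<subseteq> F\<close> by (simp add: box_iff_bad R_carrier)
  next
    fix y assume "y \<in> box F"
    then show "y \<in> PiE (Collect odd_prime) Y"
      by (auto simp: box_def PiE_def extensional_def Y_def R_carrier)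
  qed
  have "compact_space Q"
    unfolding Q_def compact_space_product_topology
    using finite_subset[OF Ysub fin] by (auto simp: compact_space_discrete_topology)
  then have "compactin Q (box F)" by (simp add: compact_space_def tQ eq)
  moreover have "continuous_map Q T (\<lambda>y. y)"
    unfolding continuous_map_def
  proof (intro conjI allI impI)
    show "(\<lambda>y. y) \<in> topspace Q \<rightarrow> topspace T" by (auto simp: tQ eq box_def)
    fix W assume W: "openin T W"
    have "\<exists>U. finite {p \<in> Collect odd_prime. U p \<noteq> topspace (discrete_topology (Y p))} \<and>
        (\<forall>p\<in>Collect odd_prime. openin (discrete_topology (Y p)) (U p)) \<and>
        x \<in> PiE (Collect odd_prime) U \<and> PiE (Collect odd_prime) U \<subseteq> {y \<in> topspace Q. y \<in> W}"
      if x: "x \<in> {y \<in> topspace Q. y \<in> W}" for x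
    proof -
      obtain F' where F': "prime_set F'" "bad x \<subseteq> F'" "nbhd F' x \<subseteq> W"
        using W x unfolding openin_resprod_iff by blast
      \<comment> \<open>Coordinates in \<open>F\<close> are frozen too, so that all free coordinates
        have \<open>Y p = GG p\<close>, as membership in \<open>nbhd\<close> demands.\<close>
      define U where "U p = (if p \<in> F \<union> F' then {x p} else Y p)" for p
      have xY: "x p \<in> Y p" if "odd_prime p" for p using x that by (auto simp: tQ)
      have sub: "PiE (Collect odd_prime) U \<subseteq> PiE (Collect odd_prime) Y"
        by (rule PiE_mono) (use xY in \<open>auto simp: U_def\<close>)
      show ?thesis
      proof (intro exI[of _ U] conjI ballI)
        show "finite {p \<in> Collect odd_prime. U p \<noteq> topspace (discrete_topology (Y p))}"
          by (rule finite_subset[of _ "F \<union> F'"]) (use F F' in \<open>auto simp: U_def prime_set_def\<close>)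
        show "openin (discrete_topology (Y p)) (U p)" if "p \<in> Collect odd_prime" for p
          using xY that by (auto simp: U_def)
        show "x \<in> PiE (Collect odd_prime) U" using x by (auto simp: U_def tQ PiE_def)
        have "y \<in> W" if y: "y \<in> PiE (Collect odd_prime) U" for y
        proof -
          have "y \<in> carrier R" using y sub by (auto simp: eq box_def)
          moreover have "y p = x p" if "p \<in> F \<union> F'" for p
            using y that F F' by (auto simp: U_def prime_set_def PiE_def Pi_def)
          moreover have "y p \<in> GG p" if "odd_prime p" "p \<notin> F \<union> F'" for p
            using y that by (auto simp: U_def Y_def PiE_def Pi_def)
          ultimately have "y \<in> nbhd (F' \<union> F) x" by (auto simp: nbhd_def)
          then show ?thesis using nbhd_mono[OF F'(2), of "F' \<union> F"] F'(3) by blast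
        qed
        then show "PiE (Collect odd_prime) U \<subseteq> {y \<in> topspace Q. y \<in> W}" using sub by (auto simp: tQ)
      qed
    qed
    then show "openin Q {x \<in> topspace Q. x \<in> W}"
      unfolding Q_def openin_product_topology_alt by (auto simp: Q_def)
  qed
  ultimately show ?thesis using image_compactin[of Q "box F" T "\<lambda>y. y"] by simp
qed

text \<open>The boxes form an open cover that is directed: finitely many of them lie in the box of
  the union of their index sets.\<close>

lemma compactin_subset_box:
  assumes K: "compactin T K"
  obtains F where "prime_set F" "K \<subseteq> box F"
proof -
  have "K \<subseteq> \<Union>(box ` Collect prime_set)"
  proof
    fix y assume "y \<in> K"
    then have "y \<in> carrier R" using compactin_subset_topspace[OF K] by auto
    then have "y \<in> box (bad y)" "bad y \<in> Collect prime_set" by (simp_all add: box_iff_bad prime_set_bad)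
    then show "y \<in> \<Union>(box ` Collect prime_set)" by (rule UN_I[rotated])
  qed
  then obtain \<F> where \<F>: "finite \<F>" "\<F> \<subseteq> box ` Collect prime_set" "K \<subseteq> \<Union>\<F>"
    using compactinD[OF K, of "box ` Collect prime_set"] openin_box by auto
  obtain \<G> where \<G>: "\<G> \<subseteq> Collect prime_set" "finite \<G>" "\<F> = box ` \<G>"
    using finite_subset_image[OF \<F>(1,2)] by auto
  have "prime_set F" if "F \<in> \<G>" for F using \<G>(1) that by blast
  then have "prime_set (\<Union>\<G>)" using \<G>(2) unfolding prime_set_def by (meson UnionE finite_Union)
  moreover have "box F \<subseteq> box (\<Union>\<G>)" if "F \<in> \<G>" for F using that by (auto simp: box_def)
  then have "K \<subseteq> box (\<Union>\<G>)"
    by (intro subset_trans[OF \<F>(3)[unfolded \<G>(3)] UN_least])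
  ultimately show thesis by (rule that)
qed

section \<open>Single coordinates, and characters near the identity\<close>

definition embed :: "nat \<Rightarrow> Lelem \<Rightarrow> nat \<Rightarrow> Lelem" where
  "embed p z = (\<lambda>q. if odd_prime q then if q = p then z else \<one>\<^bsub>LL q\<^esub> else undefined)"

lemma embed_same [simp]: "odd_prime p \<Longrightarrow> embed p z p = z"
  by (simp add: embed_def)

lemma bad_embed: "bad (embed p z) \<subseteq> {p}"
  using subgroup.one_closed[OF GG] by (auto simp: bad_def embed_def split: if_splits)

lemma embed_closed:
  assumes "odd_prime p" "z \<in> carrier (LL p)"
  shows "embed p z \<in> carrier R"
proof -
  have "embed p z q \<in> carrier (LL q)" if "odd_prime q" for q
    using assms that group.is_monoid[OF LL_group, THEN monoid.one_closed] by (auto simp: embed_def)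
  moreover have "finite (bad (embed p z))" using bad_embed by (rule finite_subset) simp
  ultimately show ?thesis by (auto simp: R_carrier embed_def)
qed

lemma embed_mult:
  assumes "odd_prime p" "z \<in> carrier (LL p)" "w \<in> carrier (LL p)"
  shows "embed p (z \<otimes>\<^bsub>LL p\<^esub> w) = embed p z \<otimes>\<^bsub>R\<^esub> embed p w"
  using group.is_monoid[OF LL_group, THEN monoid.l_one[OF _ monoid.one_closed]] group.is_monoid[OF LL_group]
  by (auto simp: embed_def R_mult fun_eq_iff)

lemma embed_one: "odd_prime p \<Longrightarrow> embed p \<one>\<^bsub>LL p\<^esub> = \<one>\<^bsub>R\<^esub>"
  by (auto simp: embed_def R_one fun_eq_iff)

definition off :: "nat set \<Rightarrow> (nat \<Rightarrow> Lelem) \<Rightarrow> nat \<Rightarrow> Lelem" where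
  "off F y = (\<lambda>q. if odd_prime q then if q \<in> F then \<one>\<^bsub>LL q\<^esub> else y q else undefined)"

lemma off_closed:
  assumes y: "y \<in> carrier R"
  shows "off F y \<in> carrier R"
proof -
  have "off F y q \<in> carrier (LL q)" if "odd_prime q" for q
    using that R_comp[OF y] group.is_monoid[OF LL_group, THEN monoid.one_closed] by (auto simp: off_def)
  moreover have "bad (off F y) \<subseteq> bad y"
    using subgroup.one_closed[OF GG] by (auto simp: bad_def off_def)
  then have "finite (bad (off F y))" using y by (auto simp: R_carrier dest: finite_subset)
  ultimately show ?thesis by (auto simp: R_carrier off_def)
qed

lemma off_insert:
  assumes "odd_prime p" "p \<notin> F" "y \<in> carrier R"
  shows "off F y = embed p (y p) \<otimes>\<^bsub>R\<^esub> off (insert p F) y"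
  using group.is_monoid[OF LL_group, THEN monoid.l_one[OF _ monoid.one_closed]] group.is_monoid[OF LL_group, THEN monoid.l_one]
    group.is_monoid[OF LL_group, THEN monoid.r_one] R_comp[OF assms(3)] assms group.is_monoid[OF LL_group]
  by (auto simp: off_def embed_def R_mult fun_eq_iff)

lemma off_empty: "y \<in> carrier R \<Longrightarrow> off {} y = y"
  by (auto simp: off_def R_carrier fun_eq_iff)

lemma character_split:
  assumes ch: "ch \<in> characters R T" and F: "prime_set F" and y: "y \<in> carrier R"
  shows "ch y = (\<Prod>p\<in>F. ch (embed p (y p))) * ch (off F y)"
proof -
  have "finite F" "\<forall>p\<in>F. odd_prime p" using F by (auto simp: prime_set_def)
  then show ?thesis
  proof (induction F)
    case empty then show ?case using y by (simp add: off_empty)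
  next
    case (insert p F)
    then have "ch (off F y) = ch (embed p (y p)) * ch (off (insert p F) y)"
      using off_insert[of p F y] y character_mult[OF ch embed_closed off_closed] R_comp[OF y] by auto
    then show ?case using insert by (simp add: ac_simps)
  qed
qed

lemma character_trivial_nbhd:
  assumes ch: "ch \<in> characters R T"
  obtains F where "prime_set F" "\<And>y. y \<in> nbhd F \<one>\<^bsub>R\<^esub> \<Longrightarrow> ch y = 1"
proof -
  have one: "ch \<one>\<^bsub>R\<^esub> = 1" by (rule character_one[OF R.is_group _ ch]) simp
  have "continuous_map T euclidean ch"
    using ch by (simp add: characters_def continuous_map_circle_iff)
  then have "openin T {y \<in> topspace T. ch y \<in> ball 1 1}"
    by (rule openin_continuous_map_preimage) (simp add: open_ball)
  then obtain F where F: "prime_set F" "nbhd F \<one>\<^bsub>R\<^esub> \<subseteq> {y \<in> topspace T. ch y \<in> ball 1 1}"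
    using one unfolding openin_resprod_iff by force
  have "ch ` nbhd F \<one>\<^bsub>R\<^esub> \<subseteq> {1}"
  proof (rule circle_no_small_subgroups)
    show "ch ` nbhd F \<one>\<^bsub>R\<^esub> \<subseteq> circle"
      using character_in_circle[OF ch] by (auto simp: nbhd_def)
    show "norm (z - 1) < 1" if "z \<in> ch ` nbhd F \<one>\<^bsub>R\<^esub>" for z
      using that F(2) by (auto simp: dist_norm norm_minus_commute)
    show "z * z \<in> ch ` nbhd F \<one>\<^bsub>R\<^esub>" if z: "z \<in> ch ` nbhd F \<one>\<^bsub>R\<^esub>" for z
    proof -
      obtain y where y: "y \<in> nbhd F \<one>\<^bsub>R\<^esub>" "z = ch y" using z by blast
      then have yR: "y \<in> carrier R" by (simp add: nbhd_def)
      have "y \<otimes>\<^bsub>R\<^esub> y \<in> nbhd F \<one>\<^bsub>R\<^esub>"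
        using y(1) yR F(1) subgroup.m_closed[OF GG] group.is_monoid[OF LL_group]
        by (auto simp: nbhd_def R_mult R_one prime_set_def monoid.l_one monoid.one_closed)
      moreover have "ch (y \<otimes>\<^bsub>R\<^esub> y) = z * z" using character_mult[OF ch yR yR] y(2) by simp
      ultimately show ?thesis by (metis image_eqI)
    qed
  qed
  with F(1) show thesis by (intro that) auto
qed

end

section \<open>Self-duality of the restricted product\<close>

locale restricted_duality = restricted_product +
  fixes nb :: "nat \<Rightarrow> Lelem \<Rightarrow> Lelem \<Rightarrow> complex"
  assumes duality: "odd_prime p \<Longrightarrow> symplectic_self_duality (LL p) (discrete_topology (carrier (LL p))) (nb p)"
    and maxi: "odd_prime p \<Longrightarrow> max_isotropic (LL p) (nb p) (GG p)"
begin

abbreviation "nabla \<equiv> resprod_nabla LL GG nb"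

lemma nb_GG: "odd_prime p \<Longrightarrow> x \<in> GG p \<Longrightarrow> y \<in> GG p \<Longrightarrow> nb p x y = 1"
  using maxi unfolding max_isotropic_def isotropic_def by blast

lemma nb_char: "odd_prime p \<Longrightarrow> x \<in> carrier (LL p) \<Longrightarrow> nb p x \<in> characters (LL p) (discrete_topology (carrier (LL p)))"
  using symplectic_self_dualityD(2)[OF duality] .

lemma norm_nb: "odd_prime p \<Longrightarrow> x \<in> carrier (LL p) \<Longrightarrow> y \<in> carrier (LL p) \<Longrightarrow> norm (nb p x y) = 1"
  using norm_character[OF nb_char] by simp

lemma nb_one: "odd_prime p \<Longrightarrow> x \<in> carrier (LL p) \<Longrightarrow> nb p x \<one>\<^bsub>LL p\<^esub> = 1"
  using character_one[OF LL_group _ nb_char] by simp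

lemma nb_eqI:
  assumes "odd_prime p" "x \<in> carrier (LL p)" "y \<in> carrier (LL p)"
    "\<And>z. z \<in> carrier (LL p) \<Longrightarrow> nb p x z = nb p y z"
  shows "x = y"
proof -
  have "nb p x = nb p y" by (rule character_eqI[OF nb_char nb_char]) (use assms in auto)
  then show ?thesis
    using symplectic_self_dualityD(1)[OF duality[OF assms(1)]] assms by (auto simp: bij_betw_def inj_on_def)
qed

lemma nb_mult_right: "odd_prime p \<Longrightarrow> x \<in> carrier (LL p) \<Longrightarrow> y \<in> carrier (LL p) \<Longrightarrow> z \<in> carrier (LL p) \<Longrightarrow>
    nb p x (y \<otimes>\<^bsub>LL p\<^esub> z) = nb p x y * nb p x z"
  using character_mult[OF nb_char] .

text \<open>Outside \<open>F\<close> both arguments lie in the isotropic subgroup G_p, so every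
  nontrivial factor belongs to a prime in \<open>F\<close>.\<close>

lemma nabla_eq:
  assumes "x \<in> box F" "y \<in> box F" "prime_set F"
  shows "nabla x y = (\<Prod>p\<in>F. nb p (x p) (y p))"
proof -
  have "nabla x y = (\<Prod>p \<in> {p. odd_prime p \<and> nb p (x p) (y p) \<noteq> 1}. nb p (x p) (y p))"
    using assms by (simp add: resprod_nabla_def box_def)
  also have "\<dots> = (\<Prod>p\<in>F. nb p (x p) (y p))"
  proof (rule prod.mono_neutral_left)
    have "nb p (x p) (y p) = 1" if "odd_prime p" "p \<notin> F" for p
      using assms that by (intro nb_GG) (simp_all add: box_def)
    then show "{p. odd_prime p \<and> nb p (x p) (y p) \<noteq> 1} \<subseteq> F" by blast
  qed (use assms in \<open>auto simp: prime_set_def\<close>)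
  finally show ?thesis .
qed

lemma common_box:
  assumes "x \<in> carrier R" "y \<in> carrier R" "z \<in> carrier R"
  obtains F where "prime_set F" "x \<in> box F" "y \<in> box F" "z \<in> box F"
proof (rule that[of "bad x \<union> bad y \<union> bad z"])
  show "prime_set (bad x \<union> bad y \<union> bad z)"
    using prime_set_bad assms by (auto simp: prime_set_def)
qed (use assms in \<open>auto simp: box_iff_bad\<close>)

lemma box_mult: "x \<in> box F \<Longrightarrow> y \<in> box F \<Longrightarrow> x \<otimes>\<^bsub>R\<^esub> y \<in> box F"
  using subgroup.m_closed[OF GG] by (auto simp: box_def R_mult)

lemma box_comp: "x \<in> box F \<Longrightarrow> odd_prime p \<Longrightarrow> x p \<in> carrier (LL p)"
  by (simp add: box_def R_comp)

lemma nabla_mult_left: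
  assumes "x \<in> carrier R" "x' \<in> carrier R" "y \<in> carrier R"
  shows "nabla (x \<otimes>\<^bsub>R\<^esub> x') y = nabla x y * nabla x' y"
proof -
  obtain F where F: "prime_set F" "x \<in> box F" "x' \<in> box F" "y \<in> box F" using common_box[OF assms] .
  have "nabla (x \<otimes>\<^bsub>R\<^esub> x') y = (\<Prod>p\<in>F. nb p (x p) (y p) * nb p (x' p) (y p))"
    using F nabla_eq[OF box_mult[OF F(2,3)] F(4,1)] box_comp symplectic_self_dualityD(3)[OF duality]
    by (simp, intro prod.cong) (auto simp: R_mult prime_set_def)
  then show ?thesis using F by (simp add: nabla_eq prod.distrib)
qed

lemma nabla_mult_right:
  assumes "x \<in> carrier R" "y \<in> carrier R" "y' \<in> carrier R"
  shows "nabla x (y \<otimes>\<^bsub>R\<^esub> y') = nabla x y * nabla x y'"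
proof -
  obtain F where F: "prime_set F" "x \<in> box F" "y \<in> box F" "y' \<in> box F" using common_box[OF assms] .
  have "nabla x (y \<otimes>\<^bsub>R\<^esub> y') = (\<Prod>p\<in>F. nb p (x p) (y p) * nb p (x p) (y' p))"
    using F nabla_eq[OF F(2) box_mult[OF F(3,4)] F(1)] box_comp nb_mult_right
    by (simp, intro prod.cong) (auto simp: R_mult prime_set_def)
  then show ?thesis using F by (simp add: nabla_eq prod.distrib)
qed

lemma nabla_self: "x \<in> carrier R \<Longrightarrow> nabla x x = 1"
  using nabla_eq[of x "bad x" x] prime_set_bad[of x] symplectic_self_dualityD(4)[OF duality] R_comp
  by (simp add: box_iff_bad prime_set_def)

lemma norm_nabla:
  assumes "x \<in> carrier R" "y \<in> carrier R"
  shows "norm (nabla x y) = 1"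
proof -
  obtain F where F: "prime_set F" "x \<in> box F" "y \<in> box F" using common_box[OF assms assms(1)] .
  then show ?thesis
    using norm_nb box_comp by (simp add: nabla_eq prod_norm[symmetric] prime_set_def)
qed

lemma nabla_nbhd:
  assumes "x \<in> carrier R" "y \<in> carrier R" "prime_set F" "bad x \<subseteq> F" "bad y \<subseteq> F" "y' \<in> nbhd F y"
  shows "nabla x y' = nabla x y"
proof -
  have "x \<in> box F" "y \<in> box F" "y' \<in> box F"
    using assms nbhd_trans[of y' F y] by (auto simp: box_iff_bad nbhd_def)
  then show ?thesis using assms by (simp add: nabla_eq nbhd_def)
qed

lemma nabla_character:
  assumes x: "x \<in> carrier R"
  shows "nabla x \<in> characters R T"
proof (rule charactersI)
  show "nabla x \<in> extensional (carrier R)" by (simp add: resprod_nabla_def)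
  show "continuous_map T (top_of_set circle) (nabla x)"
  proof (rule continuous_map_locally_constant)
    show "nabla x y \<in> topspace (top_of_set circle)" if "y \<in> topspace T" for y
      using norm_nabla[OF x] that by (simp add: circle_def)
    fix y assume "y \<in> topspace T"
    then have y: "y \<in> carrier R" by simp
    define F where "F = bad x \<union> bad y"
    have F: "prime_set F" "bad x \<subseteq> F" "bad y \<subseteq> F"
      using prime_set_bad x y by (auto simp: F_def prime_set_def)
    have "\<forall>z\<in>nbhd F y. nabla x z = nabla x y"
      by (intro ballI nabla_nbhd[OF x y F])
    then show "\<exists>U. openin T U \<and> y \<in> U \<and> (\<forall>z\<in>U. nabla x z = nabla x y)"
      using openin_nbhd_gen[OF F(1) y] nbhd_self[OF y F(3)] by blast
  qed
qed (rule nabla_mult_right[OF x])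

lemma nabla_embed:
  assumes x: "x \<in> carrier R" and p: "odd_prime p" and z: "z \<in> carrier (LL p)"
  shows "nabla x (embed p z) = nb p (x p) z"
proof -
  let ?F = "insert p (bad x)"
  have F: "prime_set ?F" using prime_set_bad[OF x] p by (auto simp: prime_set_def)
  have "nabla x (embed p z) = (\<Prod>q\<in>?F. nb q (x q) (embed p z q))"
    using bad_embed[of p z] x embed_closed[OF p z] by (intro nabla_eq F) (auto simp: box_iff_bad)
  also have "\<dots> = (\<Prod>q\<in>?F. if q = p then nb p (x p) z else 1)"
    using F R_comp[OF x] nb_one by (intro prod.cong) (auto simp: prime_set_def embed_def)
  also have "\<dots> = nb p (x p) z" using F by (simp add: prime_set_def)
  finally show ?thesis .
qed

lemma nabla_inj:
  assumes "x \<in> carrier R" "y \<in> carrier R" "nabla x = nabla y"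
  shows "x = y"
proof (rule R_eqI[OF assms(1,2)])
  fix p assume p: "odd_prime p"
  show "x p = y p"
  proof (rule nb_eqI[OF p R_comp[OF assms(1) p] R_comp[OF assms(2) p]])
    fix z assume z: "z \<in> carrier (LL p)"
    show "nb p (x p) z = nb p (y p) z"
      using nabla_embed[OF assms(1) p z] nabla_embed[OF assms(2) p z] assms(3) by simp
  qed
qed

lemma nabla_surj:
  assumes ch: "ch \<in> characters R T"
  obtains x where "x \<in> carrier R" "ch = nabla x"
proof -
  have "\<exists>x\<in>carrier (LL p). \<forall>z\<in>carrier (LL p). nb p x z = ch (embed p z)" if p: "odd_prime p" for p
  proof -
    define r where "r = restrict (\<lambda>z. ch (embed p z)) (carrier (LL p))"
    interpret Lp: comm_group "LL p" using p by (rule LL)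
    have "r \<in> characters (LL p) (discrete_topology (carrier (LL p)))"
      unfolding discrete_character_iff
    proof (intro conjI ballI)
      fix z w assume z: "z \<in> carrier (LL p)" and w: "w \<in> carrier (LL p)"
      show "norm (r z) = 1" using norm_character[OF ch] embed_closed[OF p z] z by (simp add: r_def)
      show "r (z \<otimes>\<^bsub>LL p\<^esub> w) = r z * r w"
        using character_mult[OF ch embed_closed[OF p z] embed_closed[OF p w]] z w
        by (simp add: r_def embed_mult[OF p])
    qed (simp add: r_def)
    then have "r \<in> nb p ` carrier (LL p)"
      using symplectic_self_dualityD(1)[OF duality[OF p]] by (simp add: bij_betw_def)
    then obtain x where "x \<in> carrier (LL p)" "r = nb p x" by blast
    then show ?thesis unfolding r_def by (metis restrict_apply')
  qed
  then obtain x0 where x0: "\<And>p. odd_prime p \<Longrightarrow> x0 p \<in> carrier (LL p)"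
      "\<And>p z. odd_prime p \<Longrightarrow> z \<in> carrier (LL p) \<Longrightarrow> nb p (x0 p) z = ch (embed p z)" by metis
  define x where "x p = (if odd_prime p then x0 p else undefined)" for p
  obtain F where F: "prime_set F" and triv: "\<And>y. y \<in> nbhd F \<one>\<^bsub>R\<^esub> \<Longrightarrow> ch y = 1"
    using character_trivial_nbhd[OF ch] by blast
  \<comment> \<open>The character is trivial on the embedded copy of G_p for p outside
    \<open>F\<close>, so \<open>x p\<close> annihilates G_p.\<close>
  have "x p \<in> GG p" if p: "odd_prime p" "p \<notin> F" for p
  proof (rule max_isotropic_perp[OF LL[OF p(1)] _ duality[OF p(1)] maxi[OF p(1)]])
    show "x p \<in> carrier (LL p)" using x0 p by (simp add: x_def)
    fix h assume h: "h \<in> GG p"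
    have "embed p h \<in> nbhd F \<one>\<^bsub>R\<^esub>"
      using p h F embed_closed[OF p(1) GG_subset[OF p(1) h]] subgroup.one_closed[OF GG]
      by (auto simp: nbhd_def embed_def R_one prime_set_def)
    then show "nb p (x p) h = 1" using triv x0(2)[OF p(1) GG_subset[OF p(1) h]] p by (simp add: x_def)
  qed simp
  then have badx: "bad x \<subseteq> F" by (auto simp: bad_def)
  then have "finite (bad x)" using F by (auto simp: prime_set_def dest: finite_subset)
  then have x: "x \<in> carrier R" using x0 by (auto simp: R_carrier x_def)
  have "ch y = nabla x y" if y: "y \<in> carrier R" for y
  proof -
    define F' where "F' = F \<union> bad y"
    have F': "prime_set F'" using F prime_set_bad[OF y] by (auto simp: F'_def prime_set_def)
    \<comment> \<open>Removing the coordinates in \<open>F\<close> and the bad coordinates of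
      \<open>y\<close> leaves an element of the neighbourhood on which \<open>ch\<close> is
      trivial.\<close>
    have "off F' y \<in> nbhd F \<one>\<^bsub>R\<^esub>"
      using off_closed[OF y] subgroup.one_closed[OF GG] F
      by (auto simp: nbhd_def off_def R_one F'_def bad_def prime_set_def)
    then have "ch y = (\<Prod>p\<in>F'. ch (embed p (y p)))"
      using character_split[OF ch F' y] triv by simp
    also have "\<dots> = (\<Prod>p\<in>F'. nb p (x p) (y p))"
      using x0(2) R_comp[OF y] F' by (intro prod.cong) (auto simp: x_def prime_set_def)
    also have "\<dots> = nabla x y"
      using x y badx by (intro nabla_eq[symmetric] F') (auto simp: box_iff_bad F'_def)
    finally show ?thesis .
  qed
  then have "ch = nabla x" by (rule character_eqI[OF ch nabla_character[OF x]])
  with x show thesis by (rule that)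
qed

text \<open>A compact set lies in some \<open>box F\<close>, where pairing with \<open>x\<close>
  involves only the coordinates in \<open>F\<close> and \<open>bad x\<close>. Hence all points close
  to \<open>x\<close> induce the very same function on the compact set.\<close>

lemma continuous_nabla: "continuous_map T (dual_top R T) nabla"
  unfolding dual_top_def
proof (rule continuous_on_generated_topo)
  fix V assume "V \<in> {{ch \<in> characters R T. ch ` K \<subseteq> U} | K U. compactin T K \<and> open U}"
  then obtain K U where KU: "V = {ch \<in> characters R T. ch ` K \<subseteq> U}" "compactin T K" by blast
  obtain F where F: "prime_set F" "K \<subseteq> box F" using compactin_subset_box[OF KU(2)] .
  show "openin T (nabla -` V \<inter> topspace T)"
    unfolding openin_resprod_iff
  proof (intro conjI ballI)
    fix x assume x: "x \<in> nabla -` V \<inter> topspace T"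
    then have xR: "x \<in> carrier R" by simp
    define F' where "F' = F \<union> bad x"
    have F': "prime_set F'" using F prime_set_bad[OF xR] by (auto simp: F'_def prime_set_def)
    have "nbhd F' x \<subseteq> nabla -` V \<inter> topspace T"
    proof
      fix y assume y: "y \<in> nbhd F' x"
      have "nabla y k = nabla x k" if k: "k \<in> K" for k
      proof -
        have "k \<in> box F" using F(2) k by (rule subsetD)
        then have "k \<in> box F'" "x \<in> box F'" "y \<in> box F'"
          using xR y nbhd_trans[OF y] by (auto simp: box_iff_bad F'_def nbhd_def)
        then show ?thesis using y F' by (simp add: nabla_eq nbhd_def)
      qed
      then have "nabla y ` K = nabla x ` K" by (rule image_cong[OF refl])
      moreover have "y \<in> carrier R" using y by (simp add: nbhd_def)
      ultimately show "y \<in> nabla -` V \<inter> topspace T" using x nabla_character by (auto simp: KU(1))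
    qed
    then show "\<exists>F. prime_set F \<and> bad x \<subseteq> F \<and> nbhd F x \<subseteq> nabla -` V \<inter> topspace T"
      using F' by (auto simp: F'_def)
  qed auto
next
  have "nabla ` topspace T \<subseteq> topspace (dual_top R T)" using nabla_character by auto
  then show "nabla ` topspace T \<subseteq> \<Union> {{ch \<in> characters R T. ch ` K \<subseteq> U} | K U. compactin T K \<and> open U}"
    unfolding dual_top_def topology_generated_by_topspace .
qed

text \<open>A character within distance 1 of \<open>nabla x\<close> on all of \<open>box F\<close>
  agrees with it there, since the quotient maps the group \<open>box F\<close> to values near 1.
  Such a character then comes from a point of \<open>nbhd F x\<close>.\<close>

lemma open_map_nabla: "open_map T (dual_top R T) nabla"
  unfolding open_map_def
proof (intro allI impI)
  fix W assume W: "openin T W"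
  show "openin (dual_top R T) (nabla ` W)"
  proof (subst openin_subopen, intro ballI)
    fix ch assume "ch \<in> nabla ` W"
    then obtain x where x: "x \<in> W" "ch = nabla x" by blast
    then obtain F where F: "prime_set F" "bad x \<subseteq> F" "nbhd F x \<subseteq> W" and xR: "x \<in> carrier R"
      using W unfolding openin_resprod_iff by blast
    have xF: "x \<in> box F" using xR F by (simp add: box_iff_bad)
    \<comment> \<open>On \<open>box F\<close> the value of \<open>nabla x\<close> depends only on
      the coordinates in \<open>F\<close>, which range over finite groups; so there are finitely
      many values.\<close>
    define E where "E = nabla x ` box F"
    have "E \<subseteq> (\<lambda>f. \<Prod>p\<in>F. nb p (x p) (f p)) ` PiE F (\<lambda>p. carrier (LL p))"
    proof
      fix v assume "v \<in> E"
      then obtain y where y: "y \<in> box F" "v = nabla x y" by (auto simp: E_def)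
      then have "v = (\<Prod>p\<in>F. nb p (x p) (restrict y F p))" using xF F by (simp add: nabla_eq)
      moreover have "restrict y F \<in> PiE F (\<lambda>p. carrier (LL p))"
        using box_comp[OF y(1)] F(1) by (auto simp: prime_set_def)
      ultimately show "v \<in> (\<lambda>f. \<Prod>p\<in>F. nb p (x p) (f p)) ` PiE F (\<lambda>p. carrier (LL p))" by blast
    qed
    moreover have "finite (PiE F (\<lambda>p. carrier (LL p)))"
      using F(1) fin by (intro finite_PiE) (auto simp: prime_set_def)
    ultimately have finE: "finite E" by (meson finite_imageI finite_subset)
    \<comment> \<open>A subbasic set of the compact-open topology tests against one fixed open set.
      Nearness to the nonconstant function \<open>nabla x\<close> is therefore imposed on each of
      its finitely many level sets separately.\<close>
    define C where "C v = {y \<in> topspace T. nabla x y \<in> {v}} \<inter> box F" for v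
    have compC: "compactin T (C v)" for v
    proof -
      have "continuous_map T euclidean (nabla x)"
        using nabla_character[OF xR] by (simp add: characters_def continuous_map_circle_iff)
      then have "closedin T {y \<in> topspace T. nabla x y \<in> {v}}"
        by (rule closedin_continuous_map_preimage) simp
      then show ?thesis unfolding C_def by (rule closed_Int_compactin) (rule compactin_box[OF F(1)])
    qed
    define V where "V v = {ch \<in> characters R T. ch ` C v \<subseteq> ball v 1}" for v
    define O' where "O' = \<Inter>(V ` E)"
    have xE: "nabla x x \<in> E" using xF by (simp add: E_def)
    have "openin (dual_top R T) (V v)" for v
      unfolding V_def by (rule openin_dual_top[OF compC open_ball])
    then have "openin (dual_top R T) O'"
      unfolding O'_def using finE xE by (intro openin_Inter) auto
    moreover have "nabla x \<in> O'"
      using nabla_character[OF xR] by (auto simp: O'_def V_def C_def)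
    moreover have "O' \<subseteq> nabla ` W"
    proof
      fix ps assume ps: "ps \<in> O'"
      then have psc: "ps \<in> characters R T" using xE by (auto simp: O'_def V_def)
      obtain z where z: "z \<in> carrier R" "ps = nabla z" using nabla_surj[OF psc] .
      define Q where "Q = (\<lambda>y. nabla z y / nabla x y) ` box F"
      have boxR: "y \<in> carrier R" if "y \<in> box F" for y using that by (simp add: box_def)
      have "Q \<subseteq> {1}"
      proof (rule circle_no_small_subgroups)
        show "Q \<subseteq> circle" using norm_nabla z xR boxR by (auto simp: Q_def circle_def norm_divide)
        fix t assume "t \<in> Q"
        then obtain y where y: "y \<in> box F" "t = nabla z y / nabla x y" by (auto simp: Q_def)
        have tt: "nabla z (y \<otimes>\<^bsub>R\<^esub> y) / nabla x (y \<otimes>\<^bsub>R\<^esub> y) = t * t"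
          using y boxR xR z by (simp add: nabla_mult_right)
        show "t * t \<in> Q" unfolding Q_def by (rule image_eqI[where x = "y \<otimes>\<^bsub>R\<^esub> y"]) (simp_all only: tt box_mult[OF y(1) y(1)])
        have yC: "y \<in> C (nabla x y)" using y boxR by (simp add: C_def)
        have "nabla x y \<in> E" unfolding E_def using y(1) by (rule imageI)
        then have "ps \<in> V (nabla x y)" using ps unfolding O'_def by (rule INT_D[rotated])
        then have "ps ` C (nabla x y) \<subseteq> ball (nabla x y) 1" by (simp add: V_def)
        then have "ps y \<in> ball (nabla x y) 1" using imageI[OF yC] by (rule subsetD)
        then have d: "dist (nabla x y) (nabla z y) < 1" by (simp add: z(2))
        have n: "norm (nabla x y) = 1" using norm_nabla xR boxR y by simp
        then have "nabla x y \<noteq> 0" by auto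
        then have "t - 1 = (nabla z y - nabla x y) / nabla x y" by (simp add: y(2) diff_divide_distrib)
        then show "norm (t - 1) < 1" using d n by (simp add: norm_divide dist_norm norm_minus_commute)
      qed
      have eq: "nabla z y = nabla x y" if y: "y \<in> box F" for y
      proof -
        have "nabla z y / nabla x y \<in> Q" unfolding Q_def using y by (rule imageI)
        with \<open>Q \<subseteq> {1}\<close> have "nabla z y / nabla x y = 1" by blast
        then show ?thesis by (simp add: divide_eq_1_iff)
      qed
      have emb: "nb p (z p) h = nb p (x p) h" if p: "odd_prime p" and h: "h \<in> carrier (LL p)" "embed p h \<in> box F" for p h
        using eq[OF h(2)] nabla_embed[OF z(1) p h(1)] nabla_embed[OF xR p h(1)] by simp
      have embF: "embed p h \<in> box F" if "odd_prime p" "h \<in> carrier (LL p)" "p \<in> F \<or> h \<in> GG p" for p h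
        using that embed_closed[OF that(1,2)] subgroup.one_closed[OF GG] by (auto simp: box_def embed_def)
      have "z \<in> nbhd F x"
        unfolding nbhd_def
      proof (intro CollectI conjI ballI allI impI z(1))
        fix p assume p: "p \<in> F"
        then have op: "odd_prime p" using F(1) by (simp add: prime_set_def)
        show "z p = x p" using p by (intro nb_eqI[OF op R_comp[OF z(1) op] R_comp[OF xR op]] emb[OF op] embF[OF op]) auto
      next
        fix p assume p: "odd_prime p" "p \<notin> F"
        have xp: "x p \<in> GG p" using p F(2) by (auto simp: bad_def)
        \<comment> \<open>Pairing \<open>z p\<close> with an element of G_p gives the same value as
          pairing \<open>x p\<close> with it, which is 1 by isotropy; so \<open>z p\<close>
          annihilates G_p.\<close>
        show "z p \<in> GG p"
        proof (rule max_isotropic_perp[OF LL[OF p(1)] _ duality[OF p(1)] maxi[OF p(1)]])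
          fix h assume h: "h \<in> GG p"
          then show "nb p (z p) h = 1"
            using emb[OF p(1) GG_subset[OF p(1) h] embF] p GG_subset nb_GG[OF p(1) xp h] by auto
        qed (use R_comp z p in auto)
      qed
      then show "ps \<in> nabla ` W" using F(3) z by blast
    qed
    ultimately show "\<exists>V. openin (dual_top R T) V \<and> ch \<in> V \<and> V \<subseteq> nabla ` W" unfolding x(2) by blast
  qed
qed

lemma symplectic_nabla: "symplectic_self_duality R T nabla"
proof -
  have surj: "nabla ` carrier R = characters R T"
  proof
    show "nabla ` carrier R \<subseteq> characters R T" by (rule image_subsetI) (rule nabla_character)
    show "characters R T \<subseteq> nabla ` carrier R"
    proof
      fix ch assume "ch \<in> characters R T"
      then obtain x where "x \<in> carrier R" "ch = nabla x" by (rule nabla_surj)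
      then show "ch \<in> nabla ` carrier R" by blast
    qed
  qed
  have inj: "inj_on nabla (carrier R)" using nabla_inj by (auto intro: inj_onI)
  have "nabla \<in> hom R (dual R T)"
  proof (rule homI)
    fix x y assume xy: "x \<in> carrier R" "y \<in> carrier R"
    show "nabla (x \<otimes>\<^bsub>R\<^esub> y) = nabla x \<otimes>\<^bsub>dual R T\<^esub> nabla y"
    proof
      fix z
      show "nabla (x \<otimes>\<^bsub>R\<^esub> y) z = (nabla x \<otimes>\<^bsub>dual R T\<^esub> nabla y) z"
      proof (cases "z \<in> carrier R")
        case True then show ?thesis by (simp add: nabla_mult_left[OF xy True])
      next
        case False then show ?thesis by (simp add: resprod_nabla_def)
      qed
    qed
  qed (simp add: nabla_character)
  then have "nabla \<in> iso R (dual R T)" using inj surj by (simp add: iso_def bij_betw_def)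
  moreover have "homeomorphic_map T (dual_top R T) nabla"
    by (rule bijective_open_imp_homeomorphic_map[OF continuous_nabla open_map_nabla]) (use inj surj in auto)
  ultimately show ?thesis unfolding symplectic_self_duality_def top_group_iso_def using nabla_self by blast
qed

end

section \<open>Splittings of the restricted product\<close>

lemma (in group) coprime_pow_one:
  assumes "x \<in> carrier G" "x [^] (m::nat) = \<one>" "x [^] (n::nat) = \<one>" "coprime m n"
  shows "x = \<one>"
proof -
  have "ord x dvd m" "ord x dvd n" using assms pow_eq_id by auto
  then have "ord x dvd gcd m n" by simp
  then have "ord x = 1" using assms(4) by simp
  then show ?thesis using ord_eq_1 assms(1) by simp
qed

text \<open>Bezout inverts the \<open>m\<close>-th power map on \<open>n\<close>-torsion. The root
  is a power of \<open>x\<close>, so it stays in every subgroup that contains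
  \<open>x\<close>.\<close>

lemma (in group) coprime_root:
  assumes x: "x \<in> carrier G" "x [^] (n::nat) = \<one>" and m: "coprime m n" "m \<noteq> 0"
  shows "\<exists>j::nat. (x [^] j) [^] m = x"
proof -
  obtain j i where "m * j = n * i + 1" using bezout_nat[OF m(2), of n] m(1) by auto
  then have "x [^] (j * m) = (x [^] n) [^] i \<otimes> x"
    using x(1) by (simp add: nat_pow_pow nat_pow_mult mult.commute)
  then have "(x [^] j) [^] m = x" using x by (simp add: nat_pow_pow)
  then show ?thesis ..
qed

text \<open>The pairing embeds \<open>H\<close> into the characters of \<open>K\<close>. It is
  applied in both directions to compare the p-parts of \<open>A\<close> and of its dual.\<close>

lemma card_le_pairing:
  fixes K (structure)
  assumes K: "group K" "finite (carrier K)"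
    and unit: "\<And>h k. h \<in> H \<Longrightarrow> k \<in> carrier K \<Longrightarrow> norm (\<beta> h k) = 1"
    and mult: "\<And>h k l. h \<in> H \<Longrightarrow> k \<in> carrier K \<Longrightarrow> l \<in> carrier K \<Longrightarrow> \<beta> h (k \<otimes> l) = \<beta> h k * (\<beta> h l :: complex)"
    and inj: "\<And>h h'. h \<in> H \<Longrightarrow> h' \<in> H \<Longrightarrow> (\<And>k. k \<in> carrier K \<Longrightarrow> \<beta> h k = \<beta> h' k) \<Longrightarrow> h = h'"
  shows "card H \<le> card (carrier K)"
proof -
  interpret group K by fact
  let ?X = "characters K (discrete_topology (carrier K))"
  have "inj_on (\<lambda>h. restrict (\<beta> h) (carrier K)) H"
  proof (rule inj_onI)
    fix h h' assume h: "h \<in> H" "h' \<in> H" "restrict (\<beta> h) (carrier K) = restrict (\<beta> h') (carrier K)"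
    show "h = h'"
    proof (rule inj[OF h(1,2)])
      fix k assume "k \<in> carrier K"
      then show "\<beta> h k = \<beta> h' k" using fun_cong[OF h(3), of k] by simp
    qed
  qed
  moreover have "(\<lambda>h. restrict (\<beta> h) (carrier K)) ` H \<subseteq> ?X"
    using unit mult by (auto simp: discrete_character_iff)
  ultimately have "card H \<le> card ?X" using card_characters_le(1)[OF K] by (rule card_inj_on_le)
  then show ?thesis using card_characters_le(2)[OF K] by simp
qed

lemma (in local_example) no_balanced_splitting:
  assumes f: "f \<in> hom L L" "f ` G \<subseteq> G" "\<And>x. x \<in> carrier L \<Longrightarrow> f (f x) = f x"
    and h: "h \<in> hom L L" "h ` G \<subseteq> G" "\<And>x. x \<in> carrier L \<Longrightarrow> h (h x) = h x"
    and fh: "\<And>x. x \<in> carrier L \<Longrightarrow> f x \<otimes>\<^bsub>L\<^esub> h x = x"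
    and card: "card {x \<in> carrier L. f x = x} = card {x \<in> carrier L. h x = x}" "card (carrier L) \<le> card G * card G"
  shows False
proof -
  \<comment> \<open>This treats the case in which \<open>f\<close> dies on \<open>G\<close>;
    exchanging \<open>f\<close> and \<open>h\<close> gives the other one.\<close>
  have key: False
    if f: "f \<in> hom L L" "\<And>x. x \<in> carrier L \<Longrightarrow> f (f x) = f x"
      and h: "h \<in> hom L L" "\<And>x. x \<in> carrier L \<Longrightarrow> h (h x) = h x"
      and fh: "\<And>x. x \<in> carrier L \<Longrightarrow> f x \<otimes>\<^bsub>L\<^esub> h x = x"
      and card: "card {x \<in> carrier L. f x = x} = card {x \<in> carrier L. h x = x}"
      and triv: "\<And>x. x \<in> G \<Longrightarrow> f x = \<one>\<^bsub>L\<^esub>" for f h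
  proof -
    let ?A = "{x \<in> carrier L. f x = x}" and ?B = "{x \<in> carrier L. h x = x}"
    have fc: "f x \<in> carrier L" "h x \<in> carrier L" if "x \<in> carrier L" for x
      using that f(1) h(1) by (auto simp: hom_def)
    have fB: "f b = \<one>\<^bsub>L\<^esub>" if b: "b \<in> ?B" for b
      using fh[of b] fc[of b] b by simp
    have inj: "inj_on (\<lambda>(a, b). a \<otimes>\<^bsub>L\<^esub> b) (?A \<times> ?B)"
    proof (rule inj_onI)
      fix u v assume u: "u \<in> ?A \<times> ?B" and v: "v \<in> ?A \<times> ?B"
        and eq: "(\<lambda>(a, b). a \<otimes>\<^bsub>L\<^esub> b) u = (\<lambda>(a, b). a \<otimes>\<^bsub>L\<^esub> b) v"
      obtain a b a' b' where ab: "u = (a, b)" "v = (a', b')" by (meson surj_pair)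
      have "f (a \<otimes>\<^bsub>L\<^esub> b) = a" "f (a' \<otimes>\<^bsub>L\<^esub> b') = a'"
        using u v hom_mult[OF f(1), of a b] hom_mult[OF f(1), of a' b'] fB[of b] fB[of b'] by (simp_all add: ab)
      then have "a = a'" using eq by (simp add: ab)
      then show "u = v" using eq u v by (simp add: ab)
    qed
    \<comment> \<open>With equal orders of the two factors this yields (card B)^2 <= card L <= (card
      G)^2. As \<open>h\<close> fixes \<open>G\<close> pointwise, \<open>G\<close> lies in
      \<open>?B\<close> and must equal it, so \<open>h\<close> is a retraction onto
      \<open>G\<close>.\<close>
    have "card (?A \<times> ?B) \<le> card (carrier L)"
      by (rule card_inj_on_le[OF inj _ finite_L]) auto
    then have "card ?B * card ?B \<le> card G * card G" using card \<open>card (carrier L) \<le> _\<close> by (simp add: card_cartesian_product)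
    then have le: "card ?B \<le> card G" by (simp add: power2_eq_square[symmetric] power2_nat_le_eq_le)
    have "h x = x" if "x \<in> G" for x
      using fh[of x] triv[OF that] fc[of x] that subgroup.subset[OF subgroup_G] by auto
    moreover have "G \<subseteq> ?B" using calculation subgroup.subset[OF subgroup_G] by auto
    then have "G = ?B" using finite_L le by (intro card_seteq) auto
    then have "h ` carrier L \<subseteq> G" using h(2) fc by auto
    ultimately show False using no_complement[OF h(1)] by blast
  qed
  consider "\<forall>x\<in>G. f x = \<one>\<^bsub>L\<^esub>" | "\<forall>x\<in>G. h x = \<one>\<^bsub>L\<^esub>"
    using complementary_idempotents[OF f h fh] by blast
  then show False
  proof cases
    case 1 then show False using key[OF f(1,3) h(1,3) fh card(1)] by blast
  next
    case 2
    have hf: "h x \<otimes>\<^bsub>L\<^esub> f x = x" if "x \<in> carrier L" for x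
      using fh[OF that] L.m_comm[OF hom_in_carrier[OF h(1) that] hom_in_carrier[OF f(1) that]] by simp
    from 2 show False using key[OF h(1,3) f(1,3) hf card(1)[symmetric]] by blast
  qed
qed

section \<open>Primary components under group homomorphisms\<close>

locale primary_restricted_product = restricted_product +
  assumes torsion: "odd_prime p \<Longrightarrow> \<exists>k. \<forall>z\<in>carrier (LL p). z [^]\<^bsub>LL p\<^esub> (p ^ k :: nat) = \<one>\<^bsub>LL p\<^esub>"
begin

lemma coprime_odd_primes: "odd_prime p \<Longrightarrow> odd_prime q \<Longrightarrow> p \<noteq> q \<Longrightarrow> coprime (p ^ k) (q ^ m)"
  by (simp add: odd_prime_def primes_coprime)

text \<open>At a prime q other than p, the coordinate is killed both by a power of p and by a power
  of q.\<close>

lemma torsion_embed: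
  assumes p: "odd_prime p" and w: "w \<in> carrier R" "w [^]\<^bsub>R\<^esub> (p ^ k :: nat) = \<one>\<^bsub>R\<^esub>"
  shows "w = embed p (w p)"
proof (rule R_eqI[OF w(1) embed_closed[OF p R_comp[OF w(1) p]]])
  fix q assume q: "odd_prime q"
  show "w q = embed p (w p) q"
  proof (cases "q = p")
    case True then show ?thesis using p by simp
  next
    case False
    obtain m where "\<forall>z\<in>carrier (LL q). z [^]\<^bsub>LL q\<^esub> (q ^ m :: nat) = \<one>\<^bsub>LL q\<^esub>" using torsion[OF q] by blast
    then have "w q [^]\<^bsub>LL q\<^esub> (q ^ m :: nat) = \<one>\<^bsub>LL q\<^esub>" using R_comp[OF w(1) q] by blast
    moreover have "w q [^]\<^bsub>LL q\<^esub> (p ^ k :: nat) = \<one>\<^bsub>LL q\<^esub>"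
      using fun_cong[OF w(2), of q] q by (simp add: R_pow R_one)
    ultimately have "w q = \<one>\<^bsub>LL q\<^esub>"
      using group.coprime_pow_one[OF LL_group[OF q] R_comp[OF w(1) q]] coprime_odd_primes[OF p q] False by metis
    then show ?thesis using q False by (simp add: embed_def)
  qed
qed

lemma embed_pow:
  assumes p: "odd_prime p" and z: "z \<in> carrier (LL p)"
  shows "embed p z [^]\<^bsub>R\<^esub> (n::nat) = embed p (z [^]\<^bsub>LL p\<^esub> n)"
proof -
  interpret Lp: comm_group "LL p" using p by (rule LL)
  show ?thesis by (induction n) (simp_all add: embed_one[OF p] embed_mult[OF p] z)
qed

lemma hom_pow: "f \<in> hom R R \<Longrightarrow> x \<in> carrier R \<Longrightarrow> f (x [^]\<^bsub>R\<^esub> (n::nat)) = f x [^]\<^bsub>R\<^esub> n"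
  using group_hom.hom_nat_pow[of R R f x n] R.is_group by (simp add: group_hom_def group_hom_axioms_def)

lemma hom_embed:
  assumes f: "f \<in> hom R R" and p: "odd_prime p" and z: "z \<in> carrier (LL p)"
  shows "f (embed p z) = embed p (f (embed p z) p)"
proof -
  obtain k where "\<forall>z\<in>carrier (LL p). z [^]\<^bsub>LL p\<^esub> (p ^ k :: nat) = \<one>\<^bsub>LL p\<^esub>" using torsion[OF p] by blast
  then have "embed p z [^]\<^bsub>R\<^esub> (p ^ k :: nat) = \<one>\<^bsub>R\<^esub>"
    using z by (simp add: embed_pow[OF p z] embed_one[OF p])
  then have "f (embed p z) [^]\<^bsub>R\<^esub> (p ^ k :: nat) = \<one>\<^bsub>R\<^esub>"
    using hom_pow[OF f embed_closed[OF p z], of "p ^ k"] hom_one[OF f R.is_group R.is_group] by simp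
  then show ?thesis by (rule torsion_embed[OF p hom_in_carrier[OF f embed_closed[OF p z]]])
qed

text \<open>Away from \<open>p\<close> each coordinate has a p^k-th root. Choosing the root at q
  among the powers of \<open>y q\<close> keeps it in G_q whenever \<open>y q\<close> is, so the
  roots assemble to an element of the restricted product.\<close>

lemma off_root:
  assumes p: "odd_prime p" and y: "y \<in> carrier R"
  shows "\<exists>u\<in>carrier R. off {p} y = u [^]\<^bsub>R\<^esub> (p ^ k :: nat)"
proof -
  have "\<exists>j::nat. (y q [^]\<^bsub>LL q\<^esub> j) [^]\<^bsub>LL q\<^esub> (p ^ k :: nat) = y q" if q: "odd_prime q" "q \<noteq> p" for q
  proof -
    obtain m where "\<forall>z\<in>carrier (LL q). z [^]\<^bsub>LL q\<^esub> (q ^ m :: nat) = \<one>\<^bsub>LL q\<^esub>" using torsion[OF q(1)] by blast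
    then have "y q [^]\<^bsub>LL q\<^esub> (q ^ m :: nat) = \<one>\<^bsub>LL q\<^esub>" using R_comp[OF y q(1)] by blast
    then show ?thesis
      using group.coprime_root[OF LL_group[OF q(1)] R_comp[OF y q(1)]] coprime_odd_primes[OF p q(1)] q(2) p
      by (metis odd_prime_def power_not_zero not_prime_0)
  qed
  then obtain j :: "nat \<Rightarrow> nat" where j: "\<And>q. odd_prime q \<Longrightarrow> q \<noteq> p \<Longrightarrow>
      (y q [^]\<^bsub>LL q\<^esub> j q) [^]\<^bsub>LL q\<^esub> (p ^ k :: nat) = y q" by metis
  define u where "u q = (if odd_prime q then if q = p then \<one>\<^bsub>LL q\<^esub> else y q [^]\<^bsub>LL q\<^esub> j q else undefined)" for q
  have uc: "u q \<in> carrier (LL q)" if q: "odd_prime q" for q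
  proof -
    interpret Lq: group "LL q" using q by (rule LL_group)
    show ?thesis using R_comp[OF y q] q Lq.one_closed by (cases "q = p") (auto simp: u_def)
  qed
  have "u q \<in> GG q" if q: "odd_prime q" and yq: "y q \<in> GG q" for q
  proof -
    interpret Lq: group "LL q" using q by (rule LL_group)
    have "y q [^]\<^bsub>LL q\<^esub> i \<in> GG q" for i :: nat
      by (induction i) (auto intro: subgroup.one_closed[OF GG[OF q]] subgroup.m_closed[OF GG[OF q]] yq)
    then show ?thesis using q subgroup.one_closed[OF GG[OF q]] by (cases "q = p") (auto simp: u_def)
  qed
  then have "bad u \<subseteq> bad y" by (auto simp: bad_def)
  then have "finite (bad u)" using y finite_subset by (auto simp: R_carrier)
  then have u: "u \<in> carrier R" using uc by (auto simp: R_carrier u_def)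
  moreover have "off {p} y = u [^]\<^bsub>R\<^esub> (p ^ k :: nat)"
  proof (rule R_eqI[OF off_closed[OF y] R.nat_pow_closed[OF u]])
    fix q assume q: "odd_prime q"
    interpret Lq: group "LL q" using q by (rule LL_group)
    show "off {p} y q = (u [^]\<^bsub>R\<^esub> (p ^ k :: nat)) q"
      using q j[of q] Lq.nat_pow_one by (cases "q = p") (auto simp: R_pow off_def u_def)
  qed
  ultimately show ?thesis by blast
qed

lemma decompose:
  assumes p: "odd_prime p" and y: "y \<in> carrier R"
  obtains u where "u \<in> carrier R" "y = embed p (y p) \<otimes>\<^bsub>R\<^esub> u [^]\<^bsub>R\<^esub> (p ^ k :: nat)"
proof -
  obtain u where "u \<in> carrier R" "off {p} y = u [^]\<^bsub>R\<^esub> (p ^ k :: nat)" using off_root[OF p y] by blast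
  then show thesis using off_insert[OF p _ y, of "{}"] off_empty[OF y] that by simp
qed

text \<open>Up to its embedded p-coordinate, \<open>y\<close> is a p^k-th power, where p^k kills
  L_p; the image of such a power has trivial p-coordinate.\<close>

lemma hom_comp:
  assumes f: "f \<in> hom R R" and p: "odd_prime p" and y: "y \<in> carrier R"
  shows "f y p = f (embed p (y p)) p"
proof -
  interpret Lp: comm_group "LL p" using p by (rule LL)
  obtain k where k: "\<forall>z\<in>carrier (LL p). z [^]\<^bsub>LL p\<^esub> (p ^ k :: nat) = \<one>\<^bsub>LL p\<^esub>" using torsion[OF p] by blast
  obtain u where u: "u \<in> carrier R" "y = embed p (y p) \<otimes>\<^bsub>R\<^esub> u [^]\<^bsub>R\<^esub> (p ^ k :: nat)"
    using decompose[OF p y] .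
  note ec = embed_closed[OF p R_comp[OF y p]]
  have "f y = f (embed p (y p)) \<otimes>\<^bsub>R\<^esub> f u [^]\<^bsub>R\<^esub> (p ^ k :: nat)"
    by (subst u(2)) (simp only: hom_mult[OF f ec R.nat_pow_closed[OF u(1)]] hom_pow[OF f u(1)])
  then have "f y p = f (embed p (y p)) p \<otimes>\<^bsub>LL p\<^esub> (f u p) [^]\<^bsub>LL p\<^esub> (p ^ k :: nat)"
    using p by (simp add: R_mult R_pow)
  also have "(f u p) [^]\<^bsub>LL p\<^esub> (p ^ k :: nat) = \<one>\<^bsub>LL p\<^esub>"
    using k R_comp[OF hom_in_carrier[OF f u(1)] p] by blast
  finally show ?thesis using R_comp[OF hom_in_carrier[OF f ec] p] by simp
qed

end

section \<open>The two factors of a decomposition, prime by prime\<close>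

locale primary_restricted_duality = restricted_duality + primary_restricted_product
begin

text \<open>\<open>f\<close> and \<open>h\<close> are the projections of \<open>R\<close> to the two factors.  Evaluation pairs the \<open>p\<close>-parts of
  \<open>A\<close> and its dual; every character of the \<open>p\<close>-part of \<open>A\<close> extends to \<open>A\<close> and so comes from the \<open>p\<close>-part
  of the dual.  Together with the characters \<open>nb p z\<close>, which separate points, this makes the pairing
  nondegenerate on both sides, so the two \<open>p\<close>-parts have the same cardinality.\<close>

lemma topological_splitting:
  fixes A :: "'b monoid"
  assumes A: "LCA A TA" and \<phi>: "top_group_iso (A \<times>\<times> dual A TA) (prod_topology TA (dual_top A TA)) R T \<phi>"
  obtains F f h where "prime_set F" "f \<in> hom R R" "h \<in> hom R R"
    "\<And>x. x \<in> carrier R \<Longrightarrow> f (f x) = f x" "\<And>x. x \<in> carrier R \<Longrightarrow> h (h x) = h x"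
    "\<And>x. x \<in> carrier R \<Longrightarrow> f x \<otimes>\<^bsub>R\<^esub> h x = x"
    "\<And>p z. odd_prime p \<Longrightarrow> p \<notin> F \<Longrightarrow> z \<in> GG p \<Longrightarrow> f (embed p z) p \<in> GG p"
    "\<And>p z. odd_prime p \<Longrightarrow> p \<notin> F \<Longrightarrow> z \<in> GG p \<Longrightarrow> h (embed p z) p \<in> GG p"
    "\<And>p. odd_prime p \<Longrightarrow> card {z \<in> carrier (LL p). f (embed p z) p = z} = card {z \<in> carrier (LL p). h (embed p z) p = z}"
proof -
  have tA: "topspace TA = carrier A" and "comm_group A" using A by (auto simp: LCA_def)
  interpret A: comm_group A by fact
  interpret D: comm_group "dual A TA" by (rule comm_group_dual[OF A.is_group tA])
  let ?P = "A \<times>\<times> dual A TA" and ?TP = "prod_topology TA (dual_top A TA)"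
  interpret P: comm_group ?P by (rule DirProd_comm_group[OF A.comm_group_axioms D.comm_group_axioms])
  have hom\<phi>: "\<phi> \<in> hom ?P R" and homeo: "homeomorphic_map ?TP T \<phi>"
    using \<phi> by (auto simp: top_group_iso_def iso_def)
  obtain \<psi> where "homeomorphic_maps ?TP T \<phi> \<psi>" using homeo homeomorphic_map_maps by blast
  then have c\<phi>: "continuous_map ?TP T \<phi>" and c\<psi>: "continuous_map T ?TP \<psi>"
    and \<psi>\<phi>: "\<And>u. u \<in> carrier ?P \<Longrightarrow> \<psi> (\<phi> u) = u" and \<phi>\<psi>: "\<And>x. x \<in> carrier R \<Longrightarrow> \<phi> (\<psi> x) = x"
    by (auto simp: homeomorphic_maps_def tA)
  have \<psi>c: "\<psi> x \<in> carrier ?P" if "x \<in> carrier R" for x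
    using continuous_map_image_subset_topspace[OF c\<psi>] that by (auto simp: tA)
  have hom\<psi>: "\<psi> \<in> hom R ?P"
  proof (rule homI)
    fix x y assume x: "x \<in> carrier R" and y: "y \<in> carrier R"
    have "\<phi> (\<psi> x \<otimes>\<^bsub>?P\<^esub> \<psi> y) = x \<otimes>\<^bsub>R\<^esub> y"
      using hom_mult[OF hom\<phi> \<psi>c[OF x] \<psi>c[OF y]] \<phi>\<psi> x y by simp
    then show "\<psi> (x \<otimes>\<^bsub>R\<^esub> y) = \<psi> x \<otimes>\<^bsub>?P\<^esub> \<psi> y"
      using \<psi>\<phi>[OF P.m_closed[OF \<psi>c[OF x] \<psi>c[OF y]]] by simp
  qed (rule \<psi>c)
  \<comment> \<open>The maps \<open>al\<close> and \<open>ch\<close> are the components of the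
    inverse isomorphism; \<open>i1\<close> and \<open>i2\<close> will be the inclusions of the two
    factors.\<close>
  define al where "al x = fst (\<psi> x)" for x
  define ch where "ch x = snd (\<psi> x)" for x
  have \<psi>_eq: "\<psi> x = (al x, ch x)" for x by (simp add: al_def ch_def)
  have al_c: "al x \<in> carrier A" and ch_c: "ch x \<in> characters A TA" if "x \<in> carrier R" for x
    using \<psi>c[OF that] by (auto simp: \<psi>_eq)
  have al_hom: "al \<in> hom R A" and ch_hom: "ch \<in> hom R (dual A TA)"
    using hom\<psi> al_c ch_c by (auto intro!: homI simp: hom_def \<psi>_eq)
  define i1 where "i1 a = \<phi> (a, \<one>\<^bsub>dual A TA\<^esub>)" for a
  define i2 where "i2 c = \<phi> (\<one>\<^bsub>A\<^esub>, c)" for c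
  have oneD: "\<one>\<^bsub>dual A TA\<^esub> \<in> characters A TA" using D.one_closed by simp
  have i1_c: "i1 a \<in> carrier R" if "a \<in> carrier A" for a
    unfolding i1_def by (rule hom_in_carrier[OF hom\<phi>]) (use that oneD in simp)
  have i2_c: "i2 c \<in> carrier R" if "c \<in> characters A TA" for c
    unfolding i2_def by (rule hom_in_carrier[OF hom\<phi>]) (use that in simp)
  have i1_hom: "i1 \<in> hom A R"
  proof (rule homI)
    fix a b assume a: "a \<in> carrier A" and b: "b \<in> carrier A"
    show "i1 (a \<otimes>\<^bsub>A\<^esub> b) = i1 a \<otimes>\<^bsub>R\<^esub> i1 b"
      unfolding i1_def using hom_mult[OF hom\<phi>, of "(a, \<one>\<^bsub>dual A TA\<^esub>)" "(b, \<one>\<^bsub>dual A TA\<^esub>)"] a b D.one_closed D.l_one[OF D.one_closed]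
      by (simp del: dual_simps(2,3))
  qed (rule i1_c)
  have i2_hom: "i2 \<in> hom (dual A TA) R"
  proof (rule homI)
    fix a b assume a: "a \<in> carrier (dual A TA)" and b: "b \<in> carrier (dual A TA)"
    show "i2 (a \<otimes>\<^bsub>dual A TA\<^esub> b) = i2 a \<otimes>\<^bsub>R\<^esub> i2 b"
      unfolding i2_def using hom_mult[OF hom\<phi>, of "(\<one>\<^bsub>A\<^esub>, a)" "(\<one>\<^bsub>A\<^esub>, b)"] a b
      by (simp del: dual_simps(2,3))
  qed (simp add: i2_c)
  have al_i1: "al (i1 a) = a" if "a \<in> carrier A" for a
    using \<psi>\<phi>[of "(a, \<one>\<^bsub>dual A TA\<^esub>)"] that oneD by (simp add: al_def i1_def del: dual_simps(3))
  have ch_i2: "ch (i2 c) = c" if "c \<in> characters A TA" for c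
    using \<psi>\<phi>[of "(\<one>\<^bsub>A\<^esub>, c)"] that by (simp add: ch_def i2_def)
  define f where "f x = i1 (al x)" for x
  define h where "h x = i2 (ch x)" for x
  have f_hom: "f \<in> hom R R" using hom_compose[OF al_hom i1_hom] by (simp add: f_def[abs_def] o_def)
  have h_hom: "h \<in> hom R R" using hom_compose[OF ch_hom i2_hom] by (simp add: h_def[abs_def] o_def)
  have ff: "f (f x) = f x" if "x \<in> carrier R" for x using al_i1 al_c that by (simp add: f_def)
  have hh: "h (h x) = h x" if "x \<in> carrier R" for x using ch_i2 ch_c that by (simp add: h_def)
  have fh: "f x \<otimes>\<^bsub>R\<^esub> h x = x" if x: "x \<in> carrier R" for x
  proof -
    have "f x \<otimes>\<^bsub>R\<^esub> h x = \<phi> ((al x, \<one>\<^bsub>dual A TA\<^esub>) \<otimes>\<^bsub>?P\<^esub> (\<one>\<^bsub>A\<^esub>, ch x))"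
      unfolding f_def h_def i1_def i2_def
      by (rule hom_mult[OF hom\<phi>, symmetric]) (use al_c ch_c x oneD in auto)
    also have "(al x, \<one>\<^bsub>dual A TA\<^esub>) \<otimes>\<^bsub>?P\<^esub> (\<one>\<^bsub>A\<^esub>, ch x) = \<psi> x"
      unfolding \<psi>_eq using al_c[OF x] D.l_one[of "ch x"] ch_c[OF x] by (simp del: dual_simps(2,3))
    finally show ?thesis using \<phi>\<psi>[OF x] by simp
  qed
  have c_i1: "continuous_map TA T i1"
  proof -
    have "continuous_map TA ?TP (\<lambda>a. (a, \<one>\<^bsub>dual A TA\<^esub>))"
      using oneD by (intro continuous_map_pairedI) (auto simp del: dual_simps(3))
    from continuous_map_compose[OF this c\<phi>] show ?thesis by (simp add: o_def i1_def[abs_def])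
  qed
  have c_i2: "continuous_map (dual_top A TA) T i2"
  proof -
    have "continuous_map (dual_top A TA) ?TP (\<lambda>c. (\<one>\<^bsub>A\<^esub>, c))"
      by (intro continuous_map_pairedI) (auto simp: tA)
    from continuous_map_compose[OF this c\<phi>] show ?thesis by (simp add: o_def i2_def[abs_def])
  qed
  have c_f: "continuous_map T T f"
    using continuous_map_compose[OF continuous_map_compose[OF c\<psi> continuous_map_fst] c_i1]
    by (simp add: f_def[abs_def] al_def o_def)
  have c_h: "continuous_map T T h"
    using continuous_map_compose[OF continuous_map_compose[OF c\<psi> continuous_map_snd] c_i2]
    by (simp add: h_def[abs_def] ch_def o_def)
  \<comment> \<open>The sequences with all entries in G_p form an open subgroup, so its preimage
    contains some \<open>nbhd F\<close> of the identity, and with it the full embedded copy of G_p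
    for each p outside \<open>F\<close>.\<close>
  have good: "\<exists>F. prime_set F \<and> (\<forall>p z. odd_prime p \<longrightarrow> p \<notin> F \<longrightarrow> z \<in> GG p \<longrightarrow> k (embed p z) p \<in> GG p)"
    if k: "k \<in> hom R R" "continuous_map T T k" for k
  proof -
    have "prime_set {}" by (simp add: prime_set_def)
    then have "openin T {x \<in> topspace T. k x \<in> box {}}"
      using openin_continuous_map_preimage[OF k(2) openin_box] by blast
    moreover have "\<one>\<^bsub>R\<^esub> \<in> {x \<in> topspace T. k x \<in> box {}}"
      using hom_one[OF k(1) R.is_group R.is_group] R.one_closed subgroup.one_closed[OF GG]
      by (simp add: box_def R_one)
    ultimately obtain F where F: "prime_set F" "nbhd F \<one>\<^bsub>R\<^esub> \<subseteq> {x \<in> topspace T. k x \<in> box {}}"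
      unfolding openin_resprod_iff by blast
    have "k (embed p z) p \<in> GG p" if p: "odd_prime p" "p \<notin> F" and z: "z \<in> GG p" for p z
    proof -
      have "embed p z \<in> nbhd F \<one>\<^bsub>R\<^esub>"
        using p z F(1) embed_closed[OF p(1) GG_subset[OF p(1) z]] subgroup.one_closed[OF GG]
        by (auto simp: nbhd_def embed_def R_one prime_set_def)
      then have "k (embed p z) \<in> box {}" using F(2) by blast
      then show ?thesis using p by (simp add: box_def)
    qed
    then show ?thesis using F(1) by blast
  qed
  obtain F1 where F1: "prime_set F1" "\<And>p z. odd_prime p \<Longrightarrow> p \<notin> F1 \<Longrightarrow> z \<in> GG p \<Longrightarrow> f (embed p z) p \<in> GG p"
    using good[OF f_hom c_f] by blast
  obtain F2 where F2: "prime_set F2" "\<And>p z. odd_prime p \<Longrightarrow> p \<notin> F2 \<Longrightarrow> z \<in> GG p \<Longrightarrow> h (embed p z) p \<in> GG p"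
    using good[OF h_hom c_h] by blast
  have "card {z \<in> carrier (LL p). f (embed p z) p = z} = card {z \<in> carrier (LL p). h (embed p z) p = z}"
    if p: "odd_prime p" for p
  proof -
    let ?A = "{z \<in> carrier (LL p). f (embed p z) p = z}" and ?B = "{z \<in> carrier (LL p). h (embed p z) p = z}"
    interpret Lp: comm_group "LL p" using p by (rule LL)
    obtain k where k: "\<And>z. z \<in> carrier (LL p) \<Longrightarrow> z [^]\<^bsub>LL p\<^esub> (p ^ k :: nat) = \<one>\<^bsub>LL p\<^esub>" using torsion[OF p] by blast
    \<comment> \<open>The character component of \<open>b\<close> evaluated at the A-component of
      \<open>a\<close>; the sets \<open>?A\<close> and \<open>?B\<close> are the p-parts of the two
      factors, seen inside L_p.\<close>
    define \<beta> where "\<beta> b a = ch (embed p b) (al (embed p a))" for b a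
    have e_c: "embed p z \<in> carrier R" if "z \<in> carrier (LL p)" for z using embed_closed[OF p that] .
    have sub: "subgroup {z \<in> carrier (LL p). g (embed p z) p = z} (LL p)" if g: "g \<in> hom R R" for g
    proof -
      have ghom: "(\<lambda>z. g (embed p z) p) \<in> hom (LL p) (LL p)"
        by (rule homI) (simp_all add: R_comp hom_in_carrier[OF g] e_c p embed_mult[OF p] hom_mult[OF g] R_mult)
      show ?thesis
      proof (rule Lp.subgroupI)
        have "g (embed p \<one>\<^bsub>LL p\<^esub>) p = \<one>\<^bsub>LL p\<^esub>"
          using hom_one[OF g R.is_group R.is_group] p by (simp add: embed_one R_one)
        then show "{z \<in> carrier (LL p). g (embed p z) p = z} \<noteq> {}" using Lp.one_closed by blast
        fix a assume a: "a \<in> {z \<in> carrier (LL p). g (embed p z) p = z}"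
        then show "inv\<^bsub>LL p\<^esub> a \<in> {z \<in> carrier (LL p). g (embed p z) p = z}"
          using group_hom.hom_inv[of "LL p" "LL p" "\<lambda>z. g (embed p z) p" a] ghom Lp.is_group
          by (simp add: group_hom_def group_hom_axioms_def)
        fix b assume b: "b \<in> {z \<in> carrier (LL p). g (embed p z) p = z}"
        then show "a \<otimes>\<^bsub>LL p\<^esub> b \<in> {z \<in> carrier (LL p). g (embed p z) p = z}"
          using hom_mult[OF ghom, of a b] a by simp
      qed auto
    qed
    have \<beta>_norm: "norm (\<beta> b a) = 1" if "a \<in> carrier (LL p)" "b \<in> carrier (LL p)" for a b
      unfolding \<beta>_def using norm_character[OF ch_c[OF e_c[OF that(2)]]] al_c[OF e_c[OF that(1)]] by (simp add: tA)
    have \<beta>_mult: "\<beta> b (a \<otimes>\<^bsub>LL p\<^esub> a') = \<beta> b a * \<beta> b a'"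
      if "a \<in> carrier (LL p)" "a' \<in> carrier (LL p)" "b \<in> carrier (LL p)" for a a' b
      unfolding \<beta>_def using character_mult[OF ch_c[OF e_c[OF that(3)]] al_c[OF e_c[OF that(1)]] al_c[OF e_c[OF that(2)]]]
        hom_mult[OF al_hom e_c[OF that(1)] e_c[OF that(2)]] that by (simp add: embed_mult[OF p])
    have \<beta>_mult': "\<beta> (b \<otimes>\<^bsub>LL p\<^esub> b') a = \<beta> b a * \<beta> b' a"
      if "a \<in> carrier (LL p)" "b \<in> carrier (LL p)" "b' \<in> carrier (LL p)" for a b b'
      unfolding \<beta>_def embed_mult[OF p that(2,3)] hom_mult[OF ch_hom e_c[OF that(2)] e_c[OF that(3)]] dual_simps
      using al_c[OF e_c[OF that(1)]] by simp
    have i1_fixed: "i1 c p \<in> ?A" if c: "c \<in> carrier A" for c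
    proof -
      have "f (i1 c) = i1 c" using al_i1[OF c] by (simp add: f_def)
      then show ?thesis using hom_comp[OF f_hom p i1_c[OF c]] R_comp[OF i1_c[OF c] p] by simp
    qed
    \<comment> \<open>The extension of \<theta> to \<open>A\<close> is composition with the
      p-coordinate of \<open>i1\<close>, which is locally constant. It inherits an order dividing
      p^k, so its image under \<open>i2\<close> is concentrated at \<open>p\<close>.\<close>
    have surj: "\<exists>b\<in>?B. \<forall>a\<in>?A. \<beta> b a = \<theta> a"
      if \<theta>: "\<And>a. a \<in> ?A \<Longrightarrow> norm (\<theta> a) = 1"
        "\<And>a a'. a \<in> ?A \<Longrightarrow> a' \<in> ?A \<Longrightarrow> \<theta> (a \<otimes>\<^bsub>LL p\<^esub> a') = \<theta> a * (\<theta> a' :: complex)" for \<theta>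
    proof -
      define c where "c = restrict (\<lambda>a. \<theta> (i1 a p)) (carrier A)"
      have \<theta>1: "\<theta> \<one>\<^bsub>LL p\<^esub> = 1"
      proof -
        have one: "\<one>\<^bsub>LL p\<^esub> \<in> ?A" using subgroup.one_closed[OF sub[OF f_hom]] .
        have "\<theta> \<one>\<^bsub>LL p\<^esub> * \<theta> \<one>\<^bsub>LL p\<^esub> = \<theta> \<one>\<^bsub>LL p\<^esub>" using \<theta>(2)[OF one one] by simp
        then show ?thesis using \<theta>(1)[OF one] by auto
      qed
      have c: "c \<in> characters A TA"
      proof (rule charactersI)
        show "c \<in> extensional (carrier A)" by (simp add: c_def)
        fix a b assume a: "a \<in> carrier A" and b: "b \<in> carrier A"
        have "i1 (a \<otimes>\<^bsub>A\<^esub> b) p = i1 a p \<otimes>\<^bsub>LL p\<^esub> i1 b p"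
          using hom_mult[OF i1_hom a b] p by (simp add: R_mult)
        then show "c (a \<otimes>\<^bsub>A\<^esub> b) = c a * c b"
          using a b \<theta>(2)[OF i1_fixed[OF a] i1_fixed[OF b]] by (simp add: c_def)
      next
        show "continuous_map TA (top_of_set circle) c"
        proof (rule continuous_map_locally_constant)
          show "c a \<in> topspace (top_of_set circle)" if "a \<in> topspace TA" for a
            using \<theta>(1)[OF i1_fixed] that by (simp add: c_def tA circle_def)
          fix a assume "a \<in> topspace TA"
          then have a: "a \<in> carrier A" by (simp add: tA)
          define F where "F = insert p (bad (i1 a))"
          have F: "prime_set F" using prime_set_bad[OF i1_c[OF a]] p by (auto simp: F_def prime_set_def)
          let ?U = "{b \<in> topspace TA. i1 b \<in> nbhd F (i1 a)}"
          have "openin TA ?U"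
            by (rule openin_continuous_map_preimage[OF c_i1 openin_nbhd_gen[OF F i1_c[OF a]]])
          moreover have "i1 a \<in> nbhd F (i1 a)" by (rule nbhd_self[OF i1_c[OF a]]) (auto simp: F_def)
          then have "a \<in> ?U" using a by (simp add: tA)
          moreover have "\<forall>b\<in>?U. c b = c a"
          proof
            fix b assume b: "b \<in> ?U"
            then have "i1 b p = i1 a p" by (simp add: nbhd_def F_def)
            then show "c b = c a" using a b by (simp add: c_def tA)
          qed
          ultimately show "\<exists>U. openin TA U \<and> a \<in> U \<and> (\<forall>b\<in>U. c b = c a)" by (intro exI[of _ ?U]) blast
        qed
      qed
      have \<theta>pow: "\<theta> (a [^]\<^bsub>LL p\<^esub> (n::nat)) = \<theta> a ^ n \<and> a [^]\<^bsub>LL p\<^esub> n \<in> ?A" if a: "a \<in> ?A" for a n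
      proof (induction n)
        case 0 then show ?case using \<theta>1 subgroup.one_closed[OF sub[OF f_hom]] by simp
      next
        case (Suc n)
        then have "a [^]\<^bsub>LL p\<^esub> n \<in> ?A" and IH: "\<theta> (a [^]\<^bsub>LL p\<^esub> n) = \<theta> a ^ n" by blast+
        then show ?case
          using \<theta>(2)[OF _ a] subgroup.m_closed[OF sub[OF f_hom] _ a] by (simp only: Lp.nat_pow_Suc power_Suc2 IH)
      qed
      have cpow: "c [^]\<^bsub>dual A TA\<^esub> (p ^ k :: nat) = \<one>\<^bsub>dual A TA\<^esub>"
        unfolding dual_pow[OF A.is_group tA c] dual_simps
      proof (rule restrict_ext)
        fix a assume a: "a \<in> carrier A"
        have "i1 a p \<in> carrier (LL p)" using i1_fixed[OF a] by blast
        then have "\<theta> (i1 a p) ^ (p ^ k) = 1" using \<theta>pow[OF i1_fixed[OF a], of "p ^ k"] \<theta>1 k by simp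
        then show "c a ^ (p ^ k) = 1" using a by (simp add: c_def)
      qed
      define b where "b = i2 c p"
      have b_c: "b \<in> carrier (LL p)" unfolding b_def by (rule R_comp[OF i2_c[OF c] p])
      have "i2 c [^]\<^bsub>R\<^esub> (p ^ k :: nat) = i2 (c [^]\<^bsub>dual A TA\<^esub> (p ^ k :: nat))"
        using group_hom.hom_nat_pow[of "dual A TA" R i2 c "p ^ k"] i2_hom D.is_group R.is_group c
        by (simp add: group_hom_def group_hom_axioms_def)
      also have "\<dots> = \<one>\<^bsub>R\<^esub>" unfolding cpow by (rule hom_one[OF i2_hom D.is_group R.is_group])
      finally have eb: "i2 c = embed p b" unfolding b_def by (rule torsion_embed[OF p i2_c[OF c]])
      have "h (i2 c) = i2 c" using ch_i2[OF c] by (simp add: h_def)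
      then have "b \<in> ?B" using b_c eb p by simp
      moreover have "\<beta> b a = \<theta> a" if a: "a \<in> ?A" for a
      proof -
        have ac: "al (embed p a) \<in> carrier A" using al_c e_c a by blast
        have "\<beta> b a = c (al (embed p a))" unfolding \<beta>_def eb[symmetric] ch_i2[OF c] ..
        also have "\<dots> = \<theta> (f (embed p a) p)" using ac by (simp add: c_def f_def)
        finally show ?thesis using a by simp
      qed
      ultimately show ?thesis by blast
    qed
    have finL: "finite (carrier (LL p))" using fin[OF p] .
    have "card ?B \<le> card (carrier (LL p\<lparr>carrier := ?A\<rparr>))"
    proof (rule card_le_pairing[where \<beta> = \<beta>])
      show "group (LL p\<lparr>carrier := ?A\<rparr>)" using sub[OF f_hom] Lp.is_group by (rule subgroup.subgroup_is_group)
      show "finite (carrier (LL p\<lparr>carrier := ?A\<rparr>))" using finL by simp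
      fix b b' assume b: "b \<in> ?B" and b': "b' \<in> ?B"
        and eq: "\<And>a. a \<in> carrier (LL p\<lparr>carrier := ?A\<rparr>) \<Longrightarrow> \<beta> b a = \<beta> b' a"
      have chp: "ch (embed p z) d ^ (p ^ k) = 1" if z: "z \<in> carrier (LL p)" and d: "d \<in> carrier A" for z d
      proof -
        have "ch (embed p z) [^]\<^bsub>dual A TA\<^esub> (p ^ k :: nat) = ch (embed p z [^]\<^bsub>R\<^esub> (p ^ k :: nat))"
          using group_hom.hom_nat_pow[of R "dual A TA" ch "embed p z" "p ^ k"] ch_hom D.is_group R.is_group e_c[OF z]
          by (simp add: group_hom_def group_hom_axioms_def)
        also have "\<dots> = \<one>\<^bsub>dual A TA\<^esub>"
          unfolding embed_pow[OF p z] k[OF z] embed_one[OF p] by (rule hom_one[OF ch_hom R.is_group D.is_group])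
        finally have "restrict (\<lambda>x. ch (embed p z) x ^ (p ^ k)) (carrier A) d = restrict (\<lambda>x. 1) (carrier A) d"
          unfolding dual_pow[OF A.is_group tA ch_c[OF e_c[OF z]]] dual_simps by (rule fun_cong)
        then show ?thesis using d by simp
      qed
      \<comment> \<open>Every element of \<open>A\<close> differs from one coming from its p-part by
        a p^k-th power, on which a character of order dividing p^k is trivial. So
        \<open>ch (embed p z)\<close> is determined by its values on the p-part.\<close>
      have val: "ch (embed p z) c = \<beta> z (i1 c p)" if z: "z \<in> carrier (LL p)" and c: "c \<in> carrier A" for z c
      proof -
        obtain u where u: "u \<in> carrier R" "i1 c = embed p (i1 c p) \<otimes>\<^bsub>R\<^esub> u [^]\<^bsub>R\<^esub> (p ^ k :: nat)"
          using decompose[OF p i1_c[OF c]] .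
        have e1: "embed p (i1 c p) \<in> carrier R" using e_c R_comp[OF i1_c[OF c] p] .
        have alu: "al (u [^]\<^bsub>R\<^esub> (p ^ k :: nat)) = al u [^]\<^bsub>A\<^esub> (p ^ k :: nat)"
          using group_hom.hom_nat_pow[of R A al u "p ^ k"] al_hom A.is_group R.is_group u(1)
          by (simp add: group_hom_def group_hom_axioms_def)
        have "c = al (i1 c)" using al_i1[OF c] by simp
        also have "\<dots> = al (embed p (i1 c p)) \<otimes>\<^bsub>A\<^esub> al u [^]\<^bsub>A\<^esub> (p ^ k :: nat)"
          using u(2) hom_mult[OF al_hom e1 R.nat_pow_closed[OF u(1)]] alu by metis
        finally have ceq: "c = al (embed p (i1 c p)) \<otimes>\<^bsub>A\<^esub> al u [^]\<^bsub>A\<^esub> (p ^ k :: nat)" .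
        have "ch (embed p z) c = ch (embed p z) (al (embed p (i1 c p))) * ch (embed p z) (al u) ^ (p ^ k)"
          using character_mult[OF ch_c[OF e_c[OF z]] al_c[OF e1] A.nat_pow_closed[OF al_c[OF u(1)]]]
            character_pow[OF A.is_group tA ch_c[OF e_c[OF z]] al_c[OF u(1)]] ceq by metis
        then show ?thesis using chp[OF z al_c[OF u(1)]] by (simp add: \<beta>_def)
      qed
      have "ch (embed p b) = ch (embed p b')"
      proof (rule character_eqI)
        fix c assume c: "c \<in> carrier A"
        show "ch (embed p b) c = ch (embed p b') c"
          using val[OF _ c] b b' eq[of "i1 c p"] i1_fixed[OF c] by simp
      qed (use ch_c e_c b b' in auto)
      then have "h (embed p b) = h (embed p b')" by (simp add: h_def)
      then show "b = b'" using b b' by (metis (mono_tags, lifting) mem_Collect_eq)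
    qed (use \<beta>_norm \<beta>_mult in auto)
    moreover have "card ?A \<le> card (carrier (LL p\<lparr>carrier := ?B\<rparr>))"
    proof (rule card_le_pairing[where \<beta> = "\<lambda>a b. \<beta> b a"])
      show "group (LL p\<lparr>carrier := ?B\<rparr>)" using sub[OF h_hom] Lp.is_group by (rule subgroup.subgroup_is_group)
      show "finite (carrier (LL p\<lparr>carrier := ?B\<rparr>))" using finL by simp
      fix a a' assume a: "a \<in> ?A" and a': "a' \<in> ?A"
        and eq: "\<And>b. b \<in> carrier (LL p\<lparr>carrier := ?B\<rparr>) \<Longrightarrow> \<beta> b a = \<beta> b a'"
      have ac: "a \<in> carrier (LL p)" "a' \<in> carrier (LL p)" using a a' by auto
      show "a = a'"
      proof (rule nb_eqI[OF p ac])
        fix z assume z: "z \<in> carrier (LL p)"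
        obtain b where b: "b \<in> ?B" "\<forall>a\<in>?A. \<beta> b a = nb p z a"
          using surj[of "nb p z"] norm_nb[OF p z] nb_mult_right[OF p z] by blast
        then have "nb p z a = nb p z a'" using a a' eq[of b] by simp
        moreover have "nb p z a * nb p a z = 1" "nb p z a' * nb p a' z = 1"
          using symplectic_alternating[OF Lp.is_group duality[OF p] z] ac by auto
        ultimately show "nb p a z = nb p a' z" by (metis mult_cancel_left mult_zero_left zero_neq_one)
      qed
    qed (use \<beta>_norm \<beta>_mult' in auto)
    ultimately show ?thesis by simp
  qed
  moreover have "prime_set (F1 \<union> F2)" using F1(1) F2(1) by (auto simp: prime_set_def)
  ultimately show thesis
    using F1(2) F2(2) by (intro that[of "F1 \<union> F2" f h] f_hom h_hom ff hh fh) auto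
qed

end

lemma infinite_odd_primes: "infinite {p. odd_prime p}"
proof
  assume "finite {p. odd_prime p}"
  then have "finite (insert 2 {p. odd_prime p})" by simp
  moreover have "{p::nat. Factorial_Ring.prime p} \<subseteq> insert 2 {p. odd_prime p}"
  proof
    fix q :: nat assume "q \<in> {p. Factorial_Ring.prime p}"
    then have q: "Factorial_Ring.prime q" by simp
    show "q \<in> insert 2 {p. odd_prime p}"
    proof (cases "q = 2")
      case False
      then have "2 < q" using prime_ge_2_nat[OF q] by simp
      then show ?thesis using q prime_odd_nat[OF q] by (simp add: odd_prime_def)
    qed simp
  qed
  ultimately show False using primes_infinite finite_subset by blast
qed

theorem theorem11p2:
  fixes s N :: "nat \<Rightarrow> nat"
    and nb :: "nat \<Rightarrow> Lelem \<Rightarrow> Lelem \<Rightarrow> complex"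
    and A :: "'a monoid" and TA :: "'a topology"
  assumes sN: "\<And>p. odd_prime p \<Longrightarrow> 4 \<le> s p \<and> s p \<le> N p"
    and nbp: "\<And>p. odd_prime p \<Longrightarrow>
        symplectic_self_duality (Lp s N p) (discrete_topology (carrier (Lp s N p))) (nb p)
        \<and> max_isotropic (Lp s N p) (nb p) (Gp s N p)"
  shows "symplectic_self_duality (resprod (Lp s N) (Gp s N)) (resprod_top (Lp s N) (Gp s N))
           (resprod_nabla (Lp s N) (Gp s N) nb)
       \<and> \<not> standard_via A TA (resprod (Lp s N) (Gp s N)) (resprod_top (Lp s N) (Gp s N))
           (resprod_nabla (Lp s N) (Gp s N) nb)
       \<and> (LCA A TA \<longrightarrow> \<not> (\<exists>\<phi>. top_group_iso (A \<times>\<times> dual A TA) (prod_topology TA (dual_top A TA))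
               (resprod (Lp s N) (Gp s N)) (resprod_top (Lp s N) (Gp s N)) \<phi>))"
proof -
  have loc: "local_example p (s p) (N p)" if "odd_prime p" for p
    using that sN[OF that] by (simp add: local_example_def odd_prime_def)
  have L: "local_example.L p (s p) (N p) = Lp s N p" and G: "local_example.G p (s p) (N p) = Gp s N p"
    if "odd_prime p" for p
    by (simp_all add: local_example.L_def[OF loc[OF that]] local_example.G_def[OF loc[OF that]] Lp_def Gp_def)
  have "restricted_product (Lp s N) (Gp s N)"
  proof (rule restricted_product.intro)
    fix p assume p: "odd_prime p"
    interpret E: local_example p "s p" "N p" using p by (rule loc)
    show "comm_group (Lp s N p)" using E.L.comm_group_axioms by (simp add: L p)
    show "finite (carrier (Lp s N p))" using E.finite_L by (simp add: L p)
    show "subgroup (Gp s N p) (Lp s N p)" using E.subgroup_G by (simp add: L G p)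
  qed
  moreover have "restricted_duality_axioms (Lp s N) (Gp s N) nb"
    by (rule restricted_duality_axioms.intro) (use nbp in auto)
  moreover have "primary_restricted_product_axioms (Lp s N)"
  proof (rule primary_restricted_product_axioms.intro)
    fix p assume p: "odd_prime p"
    interpret E: local_example p "s p" "N p" using p by (rule loc)
    show "\<exists>k. \<forall>z\<in>carrier (Lp s N p). z [^]\<^bsub>Lp s N p\<^esub> (p ^ k :: nat) = \<one>\<^bsub>Lp s N p\<^esub>"
      using E.L_torsion by (auto simp: L p)
  qed
  ultimately interpret primary_restricted_duality "Lp s N" "Gp s N" nb
    by (intro primary_restricted_duality.intro primary_restricted_product.intro restricted_duality.intro)
  have no_iso: False if A: "LCA A TA"
    and \<phi>: "top_group_iso (A \<times>\<times> dual A TA) (prod_topology TA (dual_top A TA)) R T \<phi>" for \<phi>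
  proof -
    obtain F f h where F: "prime_set F" and f: "f \<in> hom R R" and h: "h \<in> hom R R"
      and ff: "\<And>x. x \<in> carrier R \<Longrightarrow> f (f x) = f x" and hh: "\<And>x. x \<in> carrier R \<Longrightarrow> h (h x) = h x"
      and fh: "\<And>x. x \<in> carrier R \<Longrightarrow> f x \<otimes>\<^bsub>R\<^esub> h x = x"
      and fG: "\<And>p z. odd_prime p \<Longrightarrow> p \<notin> F \<Longrightarrow> z \<in> Gp s N p \<Longrightarrow> f (embed p z) p \<in> Gp s N p"
      and hG: "\<And>p z. odd_prime p \<Longrightarrow> p \<notin> F \<Longrightarrow> z \<in> Gp s N p \<Longrightarrow> h (embed p z) p \<in> Gp s N p"
      and card: "\<And>p. odd_prime p \<Longrightarrow> card {z \<in> carrier (Lp s N p). f (embed p z) p = z} =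
          card {z \<in> carrier (Lp s N p). h (embed p z) p = z}"
      by (rule topological_splitting[OF A \<phi>]) blast
    \<comment> \<open>Continuity gives no control over the primes in the finite set
      \<open>F\<close>; any odd prime outside it leads to the contradiction.\<close>
    obtain p where p: "odd_prime p" "p \<notin> F"
      using infinite_odd_primes F unfolding prime_set_def by (metis finite_subset mem_Collect_eq subsetI)
    interpret E: local_example p "s p" "N p" using p(1) by (rule loc)
    note c = embed_closed[OF p(1)]
    have local_hom: "(\<lambda>z. k (embed p z) p) \<in> hom (Lp s N p) (Lp s N p)" if k: "k \<in> hom R R" for k
      by (rule homI) (simp_all add: R_comp hom_in_carrier[OF k] c p embed_mult hom_mult[OF k] R_mult)
    have local_idem: "k (embed p (k (embed p z) p)) p = k (embed p z) p"
      if k: "k \<in> hom R R" "\<And>x. x \<in> carrier R \<Longrightarrow> k (k x) = k x" and z: "z \<in> carrier (Lp s N p)" for k z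
      unfolding hom_embed[OF k(1) p(1) z, symmetric] k(2)[OF c[OF z]] ..
    have local_sum: "f (embed p z) p \<otimes>\<^bsub>Lp s N p\<^esub> h (embed p z) p = z" if z: "z \<in> carrier (Lp s N p)" for z
      using fun_cong[OF fh[OF c[OF z]], of p] p by (simp add: R_mult)
    have card_le: "card (carrier (Lp s N p)) \<le> card (Gp s N p) * card (Gp s N p)"
      by (rule card_le_max_isotropic[OF LL[OF p(1)] fin[OF p(1)] duality[OF p(1)] maxi[OF p(1)]])
    show False
    proof (rule E.no_balanced_splitting[unfolded L[OF p(1)] G[OF p(1)]])
      show "(\<lambda>z. f (embed p z) p) ` Gp s N p \<subseteq> Gp s N p" "(\<lambda>z. h (embed p z) p) ` Gp s N p \<subseteq> Gp s N p"
        using fG[OF p] hG[OF p] by auto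
    qed (use local_hom[OF f] local_hom[OF h] local_idem[OF f ff] local_idem[OF h hh] local_sum card[OF p(1)] card_le in auto)
  qed
  then show ?thesis using symplectic_nabla unfolding standard_via_def by blast
qed

end
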